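(* Let $G$ be a finite group with no non-trivial abelian direct factors, and suppose that the largest two non-central conjugacy class sizes of $G$ (that is, the largest two elements of $\mathrm{cs}^*(G)$) are $m$ and $n$ where $m<n$. Then $\gcd(m,n)=1$ if and only if all of the following hold: $\mathrm{cs}(G)=\{1,m,n\}$; $G=K\rtimes L$ is a semidirect product of subgroups $K\trianglelefteq G$ and $L$, where $K$ is abelian, $\gcd(|K|,|L|)=1$, $\mathrm{Z}(G)<L$ (proper inclusion), $L/\mathrm{Z}(G)$ is cyclic, and $G/\mathrm{Z}(G)$ is a Frobenius group with Frobenius kernel $K\mathrm{Z}(G)/\mathrm{Z}(G)$; and $m=|L:\mathrm{Z}(G)|$, $n=|K|$ satisfy $n\equiv 1\pmod m$.
   Context: For a finite group $G$, $\mathrm{cs}(G)$ denotes the set of sizes of conjugacy classes of $G$, and $\mathrm{cs}^*(G)=\mathrm{cs}(G)\setminus\{1\}$ is the set of sizes of non-central conjugacy classes. $\mathrm{Z}(G)$ is the center of $G$. A group $X$ is a Frobenius group if it has a (non-trivial) proper subgroup $H$ with $H\cap H^g=1$ for all $g\in X\setminus H$; its Frobenius kernel is the normal subgroup consisting of $1$ together with all elements of $X$ lying in no conjugate of $H$. *)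

theory Defs
  imports
    "HOL-Algebra.Group_Action"
    "HOL-Algebra.Elementary_Groups"
    "HOL-Number_Theory.Cong"
begin

definition centre :: "('a, 'b) monoid_scheme \<Rightarrow> 'a set"
  where "centre G = {z \<in> carrier G. \<forall>g \<in> carrier G. g \<otimes>\<^bsub>G\<^esub> z = z \<otimes>\<^bsub>G\<^esub> g}"

(* The restriction to the carrier is the form in which action_by_conjugation
   of HOL-Algebra.Group_Action shows that this is a group action. *)
definition conjugation :: "('a, 'b) monoid_scheme \<Rightarrow> 'a \<Rightarrow> 'a \<Rightarrow> 'a"
  where "conjugation G = (\<lambda>g. \<lambda>x \<in> carrier G. g \<otimes>\<^bsub>G\<^esub> x \<otimes>\<^bsub>G\<^esub> (inv\<^bsub>G\<^esub> g))"

definition conjugacy_classes :: "('a, 'b) monoid_scheme \<Rightarrow> 'a set set"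
  where "conjugacy_classes G = orbits G (carrier G) (conjugation G)"

definition class_sizes :: "('a, 'b) monoid_scheme \<Rightarrow> nat set"
  where "class_sizes G = card ` conjugacy_classes G"

definition noncentral_class_sizes :: "('a, 'b) monoid_scheme \<Rightarrow> nat set"
  where "noncentral_class_sizes G = class_sizes G - {1}"

definition two_largest :: "nat set \<Rightarrow> nat \<Rightarrow> nat \<Rightarrow> bool"
  where "two_largest S m n \<longleftrightarrow>
    m \<in> S \<and> n \<in> S \<and> m < n \<and> (\<forall>k \<in> S. k \<noteq> n \<longrightarrow> k \<le> m)"

definition semidirect_product :: "('a, 'b) monoid_scheme \<Rightarrow> 'a set \<Rightarrow> 'a set \<Rightarrow> bool"
  where "semidirect_product G K L \<longleftrightarrow>
    K \<lhd> G \<and> subgroup L G \<and> K \<inter> L = {\<one>\<^bsub>G\<^esub>} \<and> K <#>\<^bsub>G\<^esub> L = carrier G"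

definition direct_product :: "('a, 'b) monoid_scheme \<Rightarrow> 'a set \<Rightarrow> 'a set \<Rightarrow> bool"
  where "direct_product G A B \<longleftrightarrow>
    A \<lhd> G \<and> B \<lhd> G \<and> A \<inter> B = {\<one>\<^bsub>G\<^esub>} \<and> A <#>\<^bsub>G\<^esub> B = carrier G"

definition direct_factor :: "('a, 'b) monoid_scheme \<Rightarrow> 'a set \<Rightarrow> bool"
  where "direct_factor G A \<longleftrightarrow> (\<exists>B. direct_product G A B)"

definition abelian_subgroup :: "('a, 'b) monoid_scheme \<Rightarrow> 'a set \<Rightarrow> bool"
  where "abelian_subgroup G A \<longleftrightarrow> subgroup A G \<and> comm_group (G\<lparr>carrier := A\<rparr>)"

definition no_abelian_direct_factors :: "('a, 'b) monoid_scheme \<Rightarrow> bool"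
  where "no_abelian_direct_factors G \<longleftrightarrow>
    (\<forall>A. direct_factor G A \<and> abelian_subgroup G A \<longrightarrow> A = {\<one>\<^bsub>G\<^esub>})"

definition conjugate :: "('a, 'b) monoid_scheme \<Rightarrow> 'a set \<Rightarrow> 'a \<Rightarrow> 'a set"
  where "conjugate G H g = (inv\<^bsub>G\<^esub> g) <#\<^bsub>G\<^esub> H #>\<^bsub>G\<^esub> g"

definition frobenius_complement :: "('a, 'b) monoid_scheme \<Rightarrow> 'a set \<Rightarrow> bool"
  where "frobenius_complement X H \<longleftrightarrow>
    subgroup H X \<and> H \<noteq> {\<one>\<^bsub>X\<^esub>} \<and> H \<noteq> carrier X \<and>
    (\<forall>g \<in> carrier X - H. H \<inter> conjugate X H g = {\<one>\<^bsub>X\<^esub>})"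

definition frobenius_kernel :: "('a, 'b) monoid_scheme \<Rightarrow> 'a set \<Rightarrow> 'a set"
  where "frobenius_kernel X H =
    insert \<one>\<^bsub>X\<^esub> (carrier X - (\<Union>g \<in> carrier X. conjugate X H g))"

(* All complements of a finite Frobenius group are conjugate, so at most one N qualifies. *)
definition frobenius_group_with_kernel :: "('a, 'b) monoid_scheme \<Rightarrow> 'a set \<Rightarrow> bool"
  where "frobenius_group_with_kernel X N \<longleftrightarrow>
    group X \<and> (\<exists>H. frobenius_complement X H \<and> N = frobenius_kernel X H)"

(* The quotient A/N of subgroups N \<le> A of G, with N normal in A;
   its elements are also elements of G Mod N. *)
definition quotient_in :: "('a, 'b) monoid_scheme \<Rightarrow> 'a set \<Rightarrow> 'a set \<Rightarrow> 'a set monoid"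
  where "quotient_in G A N = (G\<lparr>carrier := A\<rparr>) Mod N"

end

theory Submission
  imports "HOL-Algebra.Multiplicative_Group" "HOL-Algebra.Sylow" "HOL-Algebra.Zassenhaus" Defs
begin

text \<open>
  Suppose \<open>gcd(m, n) = 1\<close>. A product of two classes of coprime sizes is again a class. Multiplying a
  class of size \<open>m\<close> with one of size \<open>n\<close> gives a class of size \<open>n\<close>, by maximality, and it follows that
  \<open>[y, G]\<close> has order dividing \<open>n\<close> and centralizes \<open>y\<close> whenever \<open>y\<close> has class size \<open>m\<close>.
  Write \<open>|G| = a b\<close>, where \<open>a\<close> collects the primes dividing \<open>n\<close>, and split every element into its
  \<open>a\<close>-part and its \<open>b\<close>-part. The \<open>b\<close>-part of an element of class size \<open>m\<close> is central; a noncentral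
  \<open>b\<close>-element \<open>x\<close> has class size \<open>n\<close>, and the \<open>a\<close>-elements of \<open>C(x)\<close> are central. Counting then leaves
  only the class sizes \<open>1\<close>, \<open>m\<close> and \<open>n\<close>. The centre and the elements of class size \<open>m\<close> form an abelian
  normal subgroup \<open>K Z(G)\<close>, the complement is \<open>L = C(x)\<close>, and \<open>L / Z(G)\<close> is an abelian group acting
  fixed point freely on \<open>K\<close>, hence cyclic.
\<close>

section \<open>Conjugation and class sizes\<close>

text \<open>The obstacle is that nothing is known in advance about class sizes below
  \<open>m\<close>. Maximality acts only from \<open>m\<close> upwards: a class size of at least
  \<open>m\<close> is \<open>m\<close> or \<open>n\<close>, and a multiple of \<open>m\<close> is
  \<open>m\<close>. The arguments therefore build products whose classes are forced to be that
  large. Smaller sizes are excluded in two stages: for noncentral elements killed by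
  \<open>b\<close>, coprime action on an abelian normal subgroup is available, and the general case
  reduces to that one by counting centralizers.

  The primes of \<open>n\<close> determine \<open>a\<close> because commutators with an element of
  class size \<open>m\<close> lie in a normal subgroup of order dividing \<open>n\<close>; then
  \<open>m\<close> is prime to \<open>a\<close> and divides \<open>b\<close>. The hypothesis on
  direct factors enters where the part of the centre killed by \<open>a\<close> splits off from
  \<open>G\<close>. In the converse direction coprimality is read off from the congruence.\<close>

lemma carrier_quotient_in: "carrier (quotient_in G A N) = (\<lambda>x. N #>\<^bsub>G\<^esub> x) ` A"
  by (simp add: quotient_in_def carrier_FactGroup)

context group
begin

definition cj :: "'a \<Rightarrow> 'a \<Rightarrow> 'a"
  where "cj g y = g \<otimes> y \<otimes> inv g"

text \<open>The acting group is arbitrary because later counts compare classes of \<open>G\<close>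
  with orbits of centralizers and of normal subgroups.\<close>

definition orb :: "'a set \<Rightarrow> 'a \<Rightarrow> 'a set"
  where "orb H y = (\<lambda>g. cj g y) ` H"

definition centralizer :: "'a \<Rightarrow> 'a set"
  where "centralizer y = {g \<in> carrier G. g \<otimes> y = y \<otimes> g}"

lemma inv_cancel_left [simp]:
  "\<lbrakk>g \<in> carrier G; x \<in> carrier G\<rbrakk> \<Longrightarrow> inv g \<otimes> (g \<otimes> x) = x"
  "\<lbrakk>g \<in> carrier G; x \<in> carrier G\<rbrakk> \<Longrightarrow> g \<otimes> (inv g \<otimes> x) = x"
  by (simp_all flip: m_assoc)

lemma cj_closed [simp, intro]:
  "\<lbrakk>g \<in> carrier G; y \<in> carrier G\<rbrakk> \<Longrightarrow> cj g y \<in> carrier G"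
  by (simp add: cj_def)

lemma cj_one_left [simp]: "y \<in> carrier G \<Longrightarrow> cj \<one> y = y"
  by (simp add: cj_def)

lemma cj_one_right [simp]: "g \<in> carrier G \<Longrightarrow> cj g \<one> = \<one>"
  by (simp add: cj_def)

lemma cj_mult_left:
  "\<lbrakk>g \<in> carrier G; h \<in> carrier G; y \<in> carrier G\<rbrakk> \<Longrightarrow> cj (g \<otimes> h) y = cj g (cj h y)"
  by (simp add: cj_def m_assoc inv_mult_group)

lemma cj_mult_right:
  "\<lbrakk>g \<in> carrier G; x \<in> carrier G; y \<in> carrier G\<rbrakk> \<Longrightarrow> cj g (x \<otimes> y) = cj g x \<otimes> cj g y"
  by (simp add: cj_def m_assoc)

lemma cj_inv_right:
  "\<lbrakk>g \<in> carrier G; x \<in> carrier G\<rbrakk> \<Longrightarrow> cj g (inv x) = inv (cj g x)"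
  by (simp add: cj_def m_assoc inv_mult_group)

lemma cj_pow_right:
  "\<lbrakk>g \<in> carrier G; x \<in> carrier G\<rbrakk> \<Longrightarrow> cj g (x [^] (k::nat)) = cj g x [^] k"
  by (induction k) (simp_all add: cj_mult_right)

lemma cj_inv_cancel [simp]:
  "\<lbrakk>g \<in> carrier G; x \<in> carrier G\<rbrakk> \<Longrightarrow> cj g (cj (inv g) x) = x"
  "\<lbrakk>g \<in> carrier G; x \<in> carrier G\<rbrakk> \<Longrightarrow> cj (inv g) (cj g x) = x"
  by (simp_all flip: cj_mult_left)

lemma cj_eq_iff_commute:
  "\<lbrakk>g \<in> carrier G; y \<in> carrier G\<rbrakk> \<Longrightarrow> cj g y = y \<longleftrightarrow> g \<otimes> y = y \<otimes> g"
  by (simp add: cj_def inv_solve_right')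

lemma cj_inj:
  "\<lbrakk>g \<in> carrier G; x \<in> carrier G; y \<in> carrier G\<rbrakk> \<Longrightarrow> cj g x = cj g y \<longleftrightarrow> x = y"
  by (metis cj_inv_cancel(2))

lemma mem_centralizer:
  "y \<in> carrier G \<Longrightarrow> g \<in> centralizer y \<longleftrightarrow> g \<in> carrier G \<and> cj g y = y"
  by (auto simp: centralizer_def cj_eq_iff_commute)

lemma mem_centralizer_sym:
  "\<lbrakk>x \<in> carrier G; y \<in> carrier G\<rbrakk> \<Longrightarrow> x \<in> centralizer y \<longleftrightarrow> y \<in> centralizer x"
  by (auto simp: centralizer_def)

lemma subgroup_centralizer:
  assumes "y \<in> carrier G" shows "subgroup (centralizer y) G"
proof
  show "\<And>g. g \<in> centralizer y \<Longrightarrow> inv g \<in> centralizer y"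
    using assms by (auto simp: mem_centralizer) (metis cj_inv_cancel(2))
qed (use assms in \<open>auto simp: mem_centralizer cj_mult_left\<close>)

lemma self_mem_centralizer: "y \<in> carrier G \<Longrightarrow> y \<in> centralizer y"
  by (simp add: centralizer_def)

lemma centralizer_pow:
  assumes "y \<in> carrier G"
  shows "centralizer y \<subseteq> centralizer (y [^] (k::nat))"
  using assms by (auto simp: mem_centralizer cj_pow_right)

lemma centralizer_mult:
  assumes "x \<in> carrier G" "y \<in> carrier G"
  shows "centralizer x \<inter> centralizer y \<subseteq> centralizer (x \<otimes> y)"
  using assms by (auto simp: mem_centralizer cj_mult_right)

lemma mem_centre: "z \<in> centre G \<longleftrightarrow> z \<in> carrier G \<and> centralizer z = carrier G"
  by (auto simp: centre_def centralizer_def)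

lemma centre_subset_centralizer:
  "y \<in> carrier G \<Longrightarrow> centre G \<subseteq> centralizer y"
  by (auto simp: centre_def centralizer_def)

lemma subgroup_centre: "subgroup (centre G) G"
proof
  fix x y assume "x \<in> centre G" "y \<in> centre G"
  then have "x \<in> carrier G" "y \<in> carrier G" "\<And>g. g \<in> carrier G \<Longrightarrow> cj g x = x"
    "\<And>g. g \<in> carrier G \<Longrightarrow> cj g y = y"
    using mem_centralizer by (auto simp: mem_centre)
  then show "x \<otimes> y \<in> centre G"
    by (auto simp: mem_centre mem_centralizer cj_mult_right)
next
  fix x assume "x \<in> centre G"
  then have x: "x \<in> carrier G" "\<And>g. g \<in> carrier G \<Longrightarrow> cj g x = x"
    using mem_centralizer by (auto simp: mem_centre)
  then show "inv x \<in> centre G"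
    by (auto simp: mem_centre mem_centralizer cj_inv_right)
qed (auto simp: centre_def)

lemma mem_centre_cj:
  "z \<in> centre G \<longleftrightarrow> z \<in> carrier G \<and> (\<forall>g \<in> carrier G. cj g z = z)"
  by (auto simp: mem_centre mem_centralizer)

lemma orb_subset: "\<lbrakk>H \<subseteq> carrier G; y \<in> carrier G\<rbrakk> \<Longrightarrow> orb H y \<subseteq> carrier G"
  by (auto simp: orb_def)

lemma self_mem_orb: "\<lbrakk>subgroup H G; y \<in> carrier G\<rbrakk> \<Longrightarrow> y \<in> orb H y"
  unfolding orb_def by (rule image_eqI[of _ _ \<one>]) (auto simp: subgroup.one_closed)

lemma orb_mono: "H \<subseteq> K \<Longrightarrow> orb H y \<subseteq> orb K y"
  by (auto simp: orb_def)

lemma cj_mem_orb: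
  "\<lbrakk>subgroup H G; y \<in> carrier G; u \<in> orb H y; h \<in> H\<rbrakk> \<Longrightarrow> cj h u \<in> orb H y"
  by (auto simp: orb_def subgroup.mem_carrier subgroup.m_closed simp flip: cj_mult_left)

lemma orb_eq:
  assumes H: "subgroup H G" and y: "y \<in> carrier G" and u: "u \<in> orb H y"
  shows "orb H u = orb H y"
proof -
  obtain h where h: "h \<in> H" "u = cj h y" using u by (auto simp: orb_def)
  have hc: "h \<in> carrier G" using H h subgroup.mem_carrier by metis
  have "y = cj (inv h) u" using h hc y by simp
  moreover have "inv h \<in> H" using H h subgroup.m_inv_closed by metis
  ultimately have "y \<in> orb H u" by (auto simp: orb_def)
  have uc: "u \<in> carrier G" using h hc y by simp
  show ?thesis
  proof
    show "orb H u \<subseteq> orb H y"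
      using cj_mem_orb[OF H y u] by (auto simp: orb_def[of H u])
    show "orb H y \<subseteq> orb H u"
      using cj_mem_orb[OF H uc \<open>y \<in> orb H u\<close>] by (auto simp: orb_def[of H y])
  qed
qed

lemma class_sizes_eq: "class_sizes G = (\<lambda>y. card (orb (carrier G) y)) ` carrier G"
proof -
  have "orbit G (conjugation G) y = orb (carrier G) y" if "y \<in> carrier G" for y
    using that by (auto simp: orbit_def conjugation_def orb_def cj_def)
  then have "conjugacy_classes G = orb (carrier G) ` carrier G"
    by (auto simp: conjugacy_classes_def orbits_def)
  then show ?thesis by (auto simp: class_sizes_def)
qed

lemma normal_cj:
  assumes "N \<lhd> G" "g \<in> carrier G" "x \<in> N" shows "cj g x \<in> N"
  using normal.inv_op_closed2[OF assms] by (simp add: cj_def)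

lemma normalI_cj:
  assumes "subgroup N G" "\<And>g x. \<lbrakk>g \<in> carrier G; x \<in> N\<rbrakk> \<Longrightarrow> cj g x \<in> N"
  shows "N \<lhd> G"
  unfolding normal_inv_iff using assms by (auto simp: cj_def)

lemma normal_centre: "centre G \<lhd> G"
  by (rule normalI_cj[OF subgroup_centre]) (auto simp: mem_centre_cj)

lemma commute_cj_pow:
  assumes "y \<in> carrier G" "c \<in> carrier G" "c \<otimes> y = y \<otimes> c"
  shows "(y \<otimes> c) [^] (k::nat) = y [^] k \<otimes> c [^] k"
  using assms by (intro pow_mult_distrib) auto

lemma mult_mem_centre: "\<lbrakk>x \<in> centre G; y \<in> centre G\<rbrakk> \<Longrightarrow> x \<otimes> y \<in> centre G"
  using subgroup.m_closed[OF subgroup_centre] .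

lemma mem_centralizer_closed: "g \<in> centralizer y \<Longrightarrow> g \<in> carrier G"
  by (simp add: centralizer_def)

lemma mem_coset_centre_iff:
  assumes "g \<in> carrier G" "h \<in> carrier G"
  shows "centre G #> g = centre G #> h \<longleftrightarrow> (\<exists>z \<in> centre G. g = z \<otimes> h)"
proof
  assume "centre G #> g = centre G #> h"
  then have "g \<in> centre G #> h" using rcos_self[OF assms(1) subgroup_centre] by simp
  then show "\<exists>z \<in> centre G. g = z \<otimes> h" by (auto simp: r_coset_def)
next
  assume "\<exists>z \<in> centre G. g = z \<otimes> h"
  then have "g \<in> centre G #> h" by (auto simp: r_coset_def)
  then show "centre G #> g = centre G #> h"
    using repr_independence[OF _ assms(2) subgroup_centre] by simp
qed

lemma coset_centre_eq_centre_iff: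
  "g \<in> carrier G \<Longrightarrow> centre G #> g = centre G \<longleftrightarrow> g \<in> centre G"
  using coset_join1[OF _ _ subgroup_centre] coset_join2[OF _ subgroup_centre] subgroup.subset[OF subgroup_centre]
  by blast

lemma centre_coset_hom: "(\<lambda>g. centre G #> g) \<in> hom G (G Mod centre G)"
  by (rule normal.r_coset_hom_Mod[OF normal_centre])

lemma conjugate_eq_image:
  "conjugate G H g = (\<lambda>h. inv g \<otimes> h \<otimes> g) ` H"
  by (auto simp: conjugate_def l_coset_def r_coset_def)

lemma pow_eq_of_cong:
  assumes x: "x \<in> carrier G" and k: "x [^] (k::nat) = \<one>" and "[i = j] (mod k)"
  shows "x [^] i = x [^] j"
proof -
  have "x [^] i = x [^] (i mod k)" for i
  proof -
    have "x [^] i = x [^] (k * (i div k) + i mod k)" by simp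
    also have "\<dots> = (x [^] k) [^] (i div k) \<otimes> x [^] (i mod k)"
      using x by (simp only: nat_pow_mult nat_pow_pow)
    finally show ?thesis using x k by simp
  qed
  then show ?thesis using assms(3) by (metis cong_def)
qed

lemma pow_dvd_eq_one:
  "\<lbrakk>x \<in> carrier G; x [^] (k::nat) = \<one>; k dvd l\<rbrakk> \<Longrightarrow> x [^] l = \<one>"
  by (metis nat_pow_one nat_pow_pow dvd_def)

lemma eq_one_of_coprime_pows:
  assumes x: "x \<in> carrier G" and "x [^] (i::nat) = \<one>" "x [^] (j::nat) = \<one>" "coprime i j"
  shows "x = \<one>"
proof -
  have "ord x dvd i" "ord x dvd j" using assms pow_eq_id[OF x] by simp_all
  with assms(4) have "ord x = 1" by (rule coprime_common_divisor_nat)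
  then show ?thesis using x ord_eq_1 by simp
qed

text \<open>If \<open>c\<close> commutes with \<open>y\<close>, then \<open>1 = (y c)\<^sup>i = y\<^sup>i c\<^sup>i = c\<^sup>i\<close>.\<close>

lemma commutator_trivial:
  assumes "g \<in> carrier G" "y \<in> carrier G" "c \<in> carrier G" "cj g y = y \<otimes> c" "c \<otimes> y = y \<otimes> c"
    and "y [^] (i::nat) = \<one>" "c [^] (j::nat) = \<one>" "coprime i j"
  shows "c = \<one>"
proof -
  have "(y \<otimes> c) [^] i = \<one>" using assms(1,2,6) cj_pow_right[of g y i] assms(4) by simp
  then have "c [^] i = \<one>" using assms commute_cj_pow[of y c i] by simp
  then show ?thesis using assms eq_one_of_coprime_pows by blast
qed

lemma subgroup_pow_closed:
  "\<lbrakk>subgroup H G; h \<in> H\<rbrakk> \<Longrightarrow> h [^] (k::nat) \<in> H"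
  by (induction k) (auto simp: subgroup.one_closed subgroup.m_closed)

end

section \<open>Orbit counting in finite groups\<close>

locale finite_group = group +
  assumes fin [simp, intro]: "finite (carrier G)"
begin

lemma finite_subgroup: "subgroup H G \<Longrightarrow> finite H"
  using subgroup.subset finite_subset[OF _ fin] by metis

lemma card_subgroup_pos: "subgroup H G \<Longrightarrow> card H > 0"
  using finite_subgroup[of H] subgroup.one_closed[of H G] by (auto simp: card_gt_0_iff)

lemma card_subgroup_dvd:
  assumes "subgroup H G" "subgroup K G" "H \<subseteq> K"
  shows "card H dvd card K"
proof -
  interpret K: group "G\<lparr>carrier := K\<rparr>"
    using assms subgroup_imp_group by auto
  have "subgroup H (G\<lparr>carrier := K\<rparr>)"
    using subgroup_incl assms by auto
  from K.lagrange[OF this] have "card K = card (rcosets\<^bsub>G\<lparr>carrier := K\<rparr>\<^esub> H) * card H"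
    by (simp add: order_def)
  then show ?thesis by simp
qed

lemma pow_card_subgroup:
  assumes H: "subgroup H G" and h: "h \<in> H"
  shows "h [^] card H = \<one>"
proof -
  interpret H: group "G\<lparr>carrier := H\<rparr>" using H subgroup_imp_group by auto
  have "h [^]\<^bsub>G\<lparr>carrier := H\<rparr>\<^esub> order (G\<lparr>carrier := H\<rparr>) = \<one>"
    using H.pow_order_eq_1[of h] h by simp
  then show ?thesis by (simp add: order_def nat_pow_def)
qed

lemma sylow_in_subgroup:
  assumes H: "subgroup H G" and q: "prime (q::nat)" and r: "card H = q ^ r * t"
  obtains P where "subgroup P G" "P \<subseteq> H" "card P = q ^ r"
proof -
  interpret H: group "G\<lparr>carrier := H\<rparr>" using H subgroup_imp_group by auto
  obtain P where P: "subgroup P (G\<lparr>carrier := H\<rparr>)" "card P = q ^ r"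
    using sylow_thm[OF q H.is_group, of r t] r finite_subgroup[OF H] by (auto simp: order_def)
  then show ?thesis
    using that incl_subgroup[OF H P(1)] subgroup.subset[OF P(1)] by simp
qed

text \<open>By Sylow, a common prime \<open>q\<close> of \<open>card H\<close> and \<open>l\<close>
  yields a nontrivial element of \<open>H\<close> killed by \<open>q\<close> and by
  \<open>k\<close>, although \<open>q\<close> is prime to \<open>k\<close>.\<close>

lemma coprime_card_if_exponent:
  assumes H: "subgroup H G" and exp: "\<And>h. h \<in> H \<Longrightarrow> h [^] (k::nat) = \<one>" and cop: "coprime k l"
  shows "coprime (card H) l"
proof (rule ccontr)
  assume "\<not> coprime (card H) l"
  then obtain q where q: "prime q" "q dvd card H" "q dvd l"
    using prime_factor_nat[of "gcd (card H) l"] by (auto simp: coprime_iff_gcd_eq_1)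
  then obtain P where P: "subgroup P G" "P \<subseteq> H" "card P = q"
    using sylow_in_subgroup[OF H q(1), of 1] by (auto elim!: dvdE)
  then obtain x where x: "x \<in> P" "x \<noteq> \<one>"
  proof (cases "P \<subseteq> {\<one>}")
    case True
    then have "card P \<le> 1" using card_mono[of "{\<one>}" P] by simp
    then show ?thesis using P(3) prime_gt_1_nat[OF q(1)] by simp
  qed auto
  have "x [^] q = \<one>" using pow_card_subgroup P x by metis
  moreover have "coprime q k" using cop q
    using coprime_divisors[OF q(3) dvd_refl[of k]] by (simp add: coprime_commute)
  moreover have "x \<in> H" "x \<in> carrier G" using x(1) P(2) subgroup.mem_carrier[OF H] by auto
  ultimately show False using exp[of x] eq_one_of_coprime_pows[of x q k] x(2) by simp
qed

lemma pow_eq_one_of_card_dvd: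
  assumes "subgroup H G" "v \<in> H" "card H dvd k" shows "v [^] k = \<one>"
  using pow_dvd_eq_one[OF _ pow_card_subgroup[OF assms(1,2)] assms(3)]
    subgroup.mem_carrier[OF assms(1,2)] .

lemma card_orb:
  assumes H: "subgroup H G" and y: "y \<in> carrier G"
  shows "card (orb H y) * card (H \<inter> centralizer y) = card H"
proof -
  have Hc: "\<And>h. h \<in> H \<Longrightarrow> h \<in> carrier G" using H subgroup.mem_carrier by metis
  have fib: "card {h \<in> H. cj h y = u} = card (H \<inter> centralizer y)" if u: "u \<in> orb H y" for u
  proof -
    obtain k where k: "k \<in> H" "u = cj k y" using u unfolding orb_def by blast
    have "(\<lambda>h. k \<otimes> h) ` (H \<inter> centralizer y) = {h \<in> H. cj h y = u}" (is "?L = ?R")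
    proof
      show "?L \<subseteq> ?R"
        using k H y Hc by (auto simp: mem_centralizer cj_mult_left subgroup.m_closed)
      show "?R \<subseteq> ?L"
      proof
        fix h assume "h \<in> ?R"
        then have "h = k \<otimes> (inv k \<otimes> h)" "inv k \<otimes> h \<in> H \<inter> centralizer y"
          using k H y Hc
          by (auto simp: mem_centralizer cj_mult_left subgroup.m_closed subgroup.m_inv_closed)
        then show "h \<in> ?L" by blast
      qed
    qed
    moreover have "inj_on (\<lambda>h. k \<otimes> h) (H \<inter> centralizer y)"
      using k Hc by (auto simp: inj_on_def)
    ultimately show ?thesis by (metis card_image)
  qed
  have "card H = (\<Sum>u \<in> orb H y. card {h \<in> H. cj h y = u})"
    using sum.image_gen[OF finite_subgroup[OF H], of "\<lambda>_. 1::nat" "\<lambda>h. cj h y"]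
    by (simp add: orb_def)
  with fib show ?thesis by simp
qed

lemma card_class: "y \<in> carrier G \<Longrightarrow> card (orb (carrier G) y) * card (centralizer y) = order G"
  using card_orb[OF subgroup_self, of y] subgroup.subset[OF subgroup_centralizer[of y]]
  by (simp add: order_def Int_absorb1)

lemma finite_orb [simp]: "subgroup H G \<Longrightarrow> finite (orb H y)"
  by (simp add: orb_def finite_subgroup)

lemma card_orb_pos: "\<lbrakk>subgroup H G; y \<in> carrier G\<rbrakk> \<Longrightarrow> card (orb H y) > 0"
  using self_mem_orb[of H y] by (auto simp: card_gt_0_iff)

lemma orb_eq_self_iff:
  assumes "subgroup H G" "y \<in> carrier G"
  shows "card (orb H y) = 1 \<longleftrightarrow> H \<subseteq> centralizer y"
proof
  assume "card (orb H y) = 1"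
  then have "orb H y = {y}" using self_mem_orb[OF assms] by (metis card_1_singletonE singletonD)
  then have "cj h y = y" if "h \<in> H" for h using that by (auto simp: orb_def)
  then show "H \<subseteq> centralizer y" using assms(2) subgroup.subset[OF assms(1)]
    by (auto simp: mem_centralizer)
next
  assume "H \<subseteq> centralizer y"
  then have "orb H y = {y}" using assms self_mem_orb[OF assms]
    by (auto simp: orb_def mem_centralizer)
  then show "card (orb H y) = 1" by simp
qed

lemma class_size_1_iff:
  "y \<in> carrier G \<Longrightarrow> card (orb (carrier G) y) = 1 \<longleftrightarrow> y \<in> centre G"
  using orb_eq_self_iff[OF subgroup_self, of y] subgroup.subset[OF subgroup_centralizer[of y]]
  by (auto simp: mem_centre)

lemma class_size_dvd:
  assumes "x \<in> carrier G" "y \<in> carrier G" "centralizer x \<subseteq> centralizer y"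
  shows "card (orb (carrier G) y) dvd card (orb (carrier G) x)"
proof -
  obtain k where k: "card (centralizer y) = card (centralizer x) * k"
    using card_subgroup_dvd[OF subgroup_centralizer subgroup_centralizer] assms by (meson dvdE)
  have "card (orb (carrier G) y) * (card (centralizer x) * k) =
    card (orb (carrier G) x) * card (centralizer x)"
    using card_class[OF assms(1)] card_class[OF assms(2)] k by metis
  then have "card (orb (carrier G) y) * k = card (orb (carrier G) x)"
    using card_subgroup_pos[OF subgroup_centralizer[OF assms(1)]] by (simp add: ac_simps)
  then show ?thesis by (metis dvd_triv_left)
qed

lemma centralizer_eqI:
  assumes "x \<in> carrier G" "y \<in> carrier G" "centralizer x \<subseteq> centralizer y"
    "card (orb (carrier G) x) = card (orb (carrier G) y)"
  shows "centralizer x = centralizer y"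
proof -
  have "card (orb (carrier G) y) * card (centralizer x) = card (orb (carrier G) y) * card (centralizer y)"
    using card_class[OF assms(1)] card_class[OF assms(2)] assms(4) by simp
  then have "card (centralizer x) = card (centralizer y)"
    using card_orb_pos[OF subgroup_self assms(2)] by (metis mult_left_cancel less_not_refl2)
  then show ?thesis
    using card_subset_eq[OF finite_subgroup[OF subgroup_centralizer[OF assms(2)]] assms(3)] by simp
qed

text \<open>Orbits of \<open>H\<close> inside one orbit of a group normalizing \<open>H\<close> all have the same size.\<close>

lemma card_orb_dvd_of_normalizing:
  assumes H: "subgroup H G" and C: "subgroup C G" and y: "y \<in> carrier G"
    and HC: "H \<subseteq> C" and nrm: "\<And>c h. \<lbrakk>c \<in> C; h \<in> H\<rbrakk> \<Longrightarrow> cj c h \<in> H"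
  shows "card (orb H y) dvd card (orb C y)"
proof -
  have Hc: "H \<subseteq> carrier G" and Cc: "C \<subseteq> carrier G"
    using H C subgroup.subset by auto
  have uc: "u \<in> carrier G" if "u \<in> orb C y" for u using orb_subset[OF Cc y] that by auto
  have "\<Union> (orb H ` orb C y) = orb C y"
  proof
    show "\<Union> (orb H ` orb C y) \<subseteq> orb C y"
      using orb_mono[OF HC] orb_eq[OF C y] by blast
    show "orb C y \<subseteq> \<Union> (orb H ` orb C y)"
      using self_mem_orb[OF H] uc by blast
  qed
  moreover have "card (orb H u) = card (orb H y)" if u: "u \<in> orb C y" for u
  proof -
    obtain c where c: "c \<in> C" "u = cj c y" using u by (auto simp: orb_def)
    have cc: "c \<in> carrier G" using c Cc by auto
    have *: "cj h (cj c y) = cj c (cj (cj (inv c) h) y)" if "h \<in> carrier G" for h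
      using that cc y by (simp add: cj_def m_assoc inv_mult_group)
    have ci: "inv c \<in> C" using c C subgroup.m_inv_closed by metis
    have "orb H u = cj c ` orb H y"
    proof
      show "orb H u \<subseteq> cj c ` orb H y"
        using * nrm[OF ci] Hc by (auto simp: orb_def c)
      show "cj c ` orb H y \<subseteq> orb H u"
      proof -
        have "cj c (cj h y) = cj (cj c h) u" if "h \<in> H" for h
          using *[of "cj c h"] that Hc cc c by auto
        then show ?thesis using nrm[OF c(1)] by (auto simp: orb_def)
      qed
    qed
    moreover have "inj_on (cj c) (orb H y)"
      using orb_subset[OF Hc y] cc by (auto simp: inj_on_def cj_inj subset_iff)
    ultimately show ?thesis by (simp add: card_image)
  qed
  moreover have "orb H u \<inter> orb H v = {}"
    if "u \<in> orb C y" "v \<in> orb C y" "orb H u \<noteq> orb H v" for u v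
    using orb_eq[OF H uc[OF that(1)]] orb_eq[OF H uc[OF that(2)]] that(3) by blast
  ultimately show ?thesis
    using dvd_partition[of "orb H ` orb C y" "card (orb H y)"] finite_orb[OF C, of y] by simp
qed

text \<open>The length of the \<open>H\<close>-orbit of \<open>y\<close> divides
  \<open>card H\<close>, and it divides \<open>card (orb C y)\<close> because \<open>C\<close>
  normalizes \<open>H\<close>; so it is 1.\<close>

lemma centralizes_if_coprime:
  assumes H: "subgroup H G" and C: "subgroup C G" and y: "y \<in> carrier G"
    and HC: "H \<subseteq> C" and nrm: "\<And>c h. \<lbrakk>c \<in> C; h \<in> H\<rbrakk> \<Longrightarrow> cj c h \<in> H"
    and cop: "coprime (card H) (card (orb C y))"
  shows "H \<subseteq> centralizer y"
proof -
  have "card (orb H y) dvd card H" using card_orb[OF H y] by (metis dvd_triv_left)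
  with card_orb_dvd_of_normalizing[OF H C y HC nrm] cop have "card (orb H y) = 1"
    by (metis coprime_common_divisor_nat)
  then show ?thesis using orb_eq_self_iff[OF H y] by simp
qed

lemma normal_centralizes_if_coprime:
  assumes N: "N \<lhd> G" and y: "y \<in> carrier G"
    and cop: "coprime (card N) (card (orb (carrier G) y))"
  shows "N \<subseteq> centralizer y"
  using centralizes_if_coprime[OF normal_imp_subgroup[OF N] subgroup_self y _ normal_cj[OF N] cop]
    subgroup.subset[OF normal_imp_subgroup[OF N]] by auto

text \<open>With \<open>I = C\<^sub>G(x) \<inter> C\<^sub>G(y)\<close>, both class sizes divide \<open>|G : I|\<close>, hence so does their product.\<close>

lemma orb_centralizer_coprime:
  assumes x: "x \<in> carrier G" and y: "y \<in> carrier G"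
    and cop: "coprime (card (orb (carrier G) x)) (card (orb (carrier G) y))"
  shows "orb (centralizer x) y = orb (carrier G) y"
proof -
  let ?p = "card (orb (carrier G) x)" and ?q = "card (orb (carrier G) y)"
  let ?I = "centralizer x \<inter> centralizer y"
  let ?r = "card (orb (centralizer x) y)" and ?s = "card (orb (centralizer y) x)"
  have 1: "?p * (?r * card ?I) = order G" "?q * (?s * card ?I) = order G"
    using card_orb[OF subgroup_centralizer[OF x] y] card_orb[OF subgroup_centralizer[OF y] x]
      card_class[OF x] card_class[OF y] by (simp_all add: Int_commute)
  have "card ?I > 0"
    using card_subgroup_pos subgroups_Inter_pair subgroup_centralizer x y by blast
  moreover have "?p * ?r * card ?I = ?q * ?s * card ?I" using 1 by (simp only: mult.assoc)
  ultimately have "?p * ?r = ?q * ?s" by simp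
  then have "?q dvd ?p * ?r" by simp
  then have "?q dvd ?r" using cop by (simp add: coprime_commute coprime_dvd_mult_right_iff)
  moreover have "?r > 0" using card_orb_pos subgroup_centralizer x y by blast
  ultimately have "?q \<le> ?r" by (rule dvd_imp_le)
  moreover have "orb (centralizer x) y \<subseteq> orb (carrier G) y"
    using orb_mono subgroup.subset[OF subgroup_centralizer[OF x]] by blast
  ultimately show ?thesis
    using card_subset_eq[of "orb (carrier G) y" "orb (centralizer x) y"]
      card_mono[of "orb (carrier G) y" "orb (centralizer x) y"] finite_orb[OF subgroup_self] by auto
qed

text \<open>Since \<open>centralizer x\<close> is transitive on the class of \<open>y\<close>, a
  single conjugation carries \<open>(x, y)\<close> to \<open>(u, v)\<close>. So the product of the
  two classes is a single class.\<close>

lemma mult_mem_class_coprime: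
  assumes x: "x \<in> carrier G" and y: "y \<in> carrier G"
    and cop: "coprime (card (orb (carrier G) x)) (card (orb (carrier G) y))"
    and u: "u \<in> orb (carrier G) x" and v: "v \<in> orb (carrier G) y"
  shows "u \<otimes> v \<in> orb (carrier G) (x \<otimes> y)"
proof -
  obtain g where g: "g \<in> carrier G" "u = cj g x" using u by (auto simp: orb_def)
  have "v \<in> carrier G" using v orb_subset y by blast
  then have "cj (inv g) v \<in> orb (carrier G) y"
    using cj_mem_orb[OF subgroup_self y v] g by simp
  then obtain h where h: "h \<in> centralizer x" "cj (inv g) v = cj h y"
    using orb_centralizer_coprime[OF x y cop] by (auto simp: orb_def)
  have hc: "h \<in> carrier G" "cj h x = x" using h x mem_centralizer by auto
  have "v = cj (g \<otimes> h) y" using h g hc y \<open>v \<in> carrier G\<close>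
    by (metis cj_inv_cancel(1) cj_mult_left)
  moreover have "u = cj (g \<otimes> h) x" using g hc x by (simp add: cj_mult_left)
  ultimately have "u \<otimes> v = cj (g \<otimes> h) (x \<otimes> y)" using g hc x y by (simp add: cj_mult_right)
  then show ?thesis using g hc by (auto simp: orb_def)
qed

text \<open>The index of \<open>centralizer x \<inter> centralizer y\<close> is the product of the
  two class sizes, and this intersection centralizes \<open>x \<otimes> y\<close>.\<close>

lemma class_size_mult_dvd:
  assumes x: "x \<in> carrier G" and y: "y \<in> carrier G"
    and cop: "coprime (card (orb (carrier G) x)) (card (orb (carrier G) y))"
  shows "card (orb (carrier G) (x \<otimes> y)) dvd card (orb (carrier G) x) * card (orb (carrier G) y)"
proof -
  let ?I = "centralizer x \<inter> centralizer y"
  have I: "subgroup ?I G" using subgroups_Inter_pair subgroup_centralizer x y by blast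
  have xy: "x \<otimes> y \<in> carrier G" using x y by simp
  have "card ?I dvd card (centralizer (x \<otimes> y))"
    using card_subgroup_dvd[OF I subgroup_centralizer[OF xy] centralizer_mult[OF x y]] .
  then obtain k where k: "card (centralizer (x \<otimes> y)) = card ?I * k" by auto
  have "card (orb (carrier G) x) * (card (orb (carrier G) y) * card ?I) = order G"
    using card_orb[OF subgroup_centralizer[OF x] y] card_class[OF x] orb_centralizer_coprime[OF x y cop]
    by simp
  also have "\<dots> = card (orb (carrier G) (x \<otimes> y)) * (card ?I * k)"
    using card_class[OF xy] k by simp
  finally have "card (orb (carrier G) x) * card (orb (carrier G) y) = card (orb (carrier G) (x \<otimes> y)) * k"
    using card_subgroup_pos[OF I] by (simp add: ac_simps)
  then show ?thesis by simp
qed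

section \<open>Left stabilizers of conjugacy classes\<close>

definition stab :: "'a set \<Rightarrow> 'a set"
  where "stab B = {s \<in> carrier G. (\<lambda>b. s \<otimes> b) ` B = B}"

lemma subgroup_stab:
  assumes "B \<subseteq> carrier G" shows "subgroup (stab B) G"
proof
  have c: "\<And>b. b \<in> B \<Longrightarrow> b \<in> carrier G" using assms by auto
  show "s \<otimes> t \<in> stab B" if "s \<in> stab B" "t \<in> stab B" for s t
  proof -
    have "(\<lambda>b. s \<otimes> t \<otimes> b) ` B = (\<lambda>b. s \<otimes> b) ` (\<lambda>b. t \<otimes> b) ` B"
      unfolding image_image using that c by (intro image_cong) (auto simp: stab_def m_assoc)
    then show ?thesis using that by (simp add: stab_def)
  qed
  show "\<one> \<in> stab B" using c by (auto simp: stab_def intro: rev_image_eqI)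
  show "inv s \<in> stab B" if "s \<in> stab B" for s
  proof -
    have s: "s \<in> carrier G" "(\<lambda>b. s \<otimes> b) ` B = B" using that by (auto simp: stab_def)
    have "(\<lambda>b. inv s \<otimes> b) ` (\<lambda>b. s \<otimes> b) ` B = (\<lambda>b. b) ` B"
      unfolding image_image using s c by (intro image_cong) auto
    then have "(\<lambda>b. inv s \<otimes> b) ` B = B" using s by simp
    then show ?thesis using s by (simp add: stab_def)
  qed
qed (auto simp: stab_def)

text \<open>\<open>B\<close> is a disjoint union of right cosets of its stabilizer.\<close>

lemma card_stab_dvd:
  assumes B: "B \<subseteq> carrier G"
  shows "card (stab B) dvd card B"
proof -
  have S: "subgroup (stab B) G" by (rule subgroup_stab[OF B])
  have Sc: "\<And>s. s \<in> stab B \<Longrightarrow> s \<in> carrier G" by (simp add: stab_def)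
  have fB: "finite B" using B finite_subset by auto
  let ?P = "(\<lambda>b. stab B #> b) ` B"
  have "\<Union> ?P = B"
  proof
    show "\<Union> ?P \<subseteq> B" by (auto simp: r_coset_def stab_def)
    show "B \<subseteq> \<Union> ?P" using B rcos_self[OF _ S] by auto
  qed
  moreover have "card (stab B #> b) = card (stab B)" if "b \<in> B" for b
    using card_rcosets_equal[OF rcosetsI[of "stab B" b]] subgroup.subset[OF S] that B by auto
  moreover have "(stab B #> u) \<inter> (stab B #> v) = {}"
    if "u \<in> B" "v \<in> B" "stab B #> u \<noteq> stab B #> v" for u v
    using repr_independence[OF _ _ S] that B by blast
  ultimately show ?thesis
    using dvd_partition[of ?P "card (stab B)"] fB by simp
qed

text \<open>Conjugation maps the class onto itself, so it preserves the stabilizer of the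
  class.\<close>

lemma normal_stab_class:
  assumes x: "x \<in> carrier G"
  shows "stab (orb (carrier G) x) \<lhd> G"
proof (rule normalI_cj)
  let ?B = "orb (carrier G) x"
  have Bc: "?B \<subseteq> carrier G" using orb_subset x by blast
  show S: "subgroup (stab ?B) G" by (rule subgroup_stab[OF Bc])
  fix g s assume g: "g \<in> carrier G" and s: "s \<in> stab ?B"
  have sc: "s \<in> carrier G" "(\<lambda>b. s \<otimes> b) ` ?B = ?B" using s by (auto simp: stab_def)
  have *: "cj g s \<otimes> b \<in> ?B" if b: "b \<in> ?B" for b
  proof -
    have bc: "b \<in> carrier G" using b Bc by auto
    have "cj (inv g) b \<in> ?B" using cj_mem_orb[OF subgroup_self x b] g by simp
    then have "s \<otimes> cj (inv g) b \<in> ?B" using sc by auto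
    then have "cj g (s \<otimes> cj (inv g) b) \<in> ?B" using cj_mem_orb[OF subgroup_self x] g by simp
    then show ?thesis using g sc bc by (simp add: cj_mult_right)
  qed
  have "(\<lambda>b. cj g s \<otimes> b) ` ?B = ?B"
    using * Bc g sc finite_orb[OF subgroup_self]
    by (intro card_subset_eq) (auto intro!: card_image simp: inj_on_def subset_iff)
  then show "cj g s \<in> stab ?B" using g sc by (simp add: stab_def)
qed

text \<open>If the class product \<open>x\<^sup>G y\<^sup>G\<close> is no larger than \<open>y\<^sup>G\<close>, then \<open>u y\<^sup>G\<close> is the same set for all \<open>u\<close> in \<open>x\<^sup>G\<close>.\<close>

lemma commutator_mem_stab:
  assumes x: "x \<in> carrier G" and y: "y \<in> carrier G" and g: "g \<in> carrier G"
    and cop: "coprime (card (orb (carrier G) x)) (card (orb (carrier G) y))"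
    and eq: "card (orb (carrier G) (x \<otimes> y)) = card (orb (carrier G) y)"
  shows "inv x \<otimes> cj g x \<in> stab (orb (carrier G) y)"
proof -
  let ?B = "orb (carrier G) y" and ?E = "orb (carrier G) (x \<otimes> y)"
  have Bc: "?B \<subseteq> carrier G" using orb_subset y by blast
  have *: "(\<lambda>b. u \<otimes> b) ` ?B = ?E" if u: "u \<in> orb (carrier G) x" for u
  proof (rule card_subset_eq)
    have uc: "u \<in> carrier G" using u orb_subset x by blast
    show "(\<lambda>b. u \<otimes> b) ` ?B \<subseteq> ?E" using mult_mem_class_coprime[OF x y cop u] by auto
    have "inj_on (\<lambda>b. u \<otimes> b) ?B" using uc Bc by (auto simp: inj_on_def subset_iff)
    then show "card ((\<lambda>b. u \<otimes> b) ` ?B) = card ?E" using eq by (simp add: card_image)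
  qed (simp add: subgroup_self)
  have "(\<lambda>b. inv x \<otimes> cj g x \<otimes> b) ` ?B = (\<lambda>b. inv x \<otimes> b) ` (\<lambda>b. cj g x \<otimes> b) ` ?B"
    unfolding image_image using x g Bc by (intro image_cong) (auto simp: m_assoc subset_iff)
  also have "\<dots> = (\<lambda>b. inv x \<otimes> b) ` (\<lambda>b. x \<otimes> b) ` ?B"
    using *[of "cj g x"] *[of x] self_mem_orb[OF subgroup_self x] g by (simp add: orb_def)
  also have "\<dots> = (\<lambda>b. b) ` ?B"
    unfolding image_image using x Bc by (intro image_cong) (auto simp: subset_iff)
  finally show ?thesis using x g by (simp add: stab_def)
qed

abbreviation csize :: "'a \<Rightarrow> nat"
  where "csize y \<equiv> card (orb (carrier G) y)"

lemma csize_pos: "y \<in> carrier G \<Longrightarrow> csize y > 0"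
  by (rule card_orb_pos[OF subgroup_self])

lemma csize_cj: "\<lbrakk>g \<in> carrier G; y \<in> carrier G\<rbrakk> \<Longrightarrow> csize (cj g y) = csize y"
  using orb_eq[OF subgroup_self, of y "cj g y"] by (auto simp: orb_def)

text \<open>Left translation by \<open>x\<close> embeds the class of \<open>y\<close> into that of
  \<open>x \<otimes> y\<close>.\<close>

lemma class_size_le_class_size_mult:
  assumes x: "x \<in> carrier G" and y: "y \<in> carrier G" and cop: "coprime (csize x) (csize y)"
  shows "csize y \<le> csize (x \<otimes> y)"
proof -
  let ?B = "orb (carrier G) y"
  have "?B \<subseteq> carrier G" using orb_subset y by blast
  then have "inj_on (\<lambda>b. x \<otimes> b) ?B" using x by (auto simp: inj_on_def subset_iff)
  moreover have "(\<lambda>b. x \<otimes> b) ` ?B \<subseteq> orb (carrier G) (x \<otimes> y)"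
    using mult_mem_class_coprime[OF x y cop self_mem_orb[OF subgroup_self x]] by auto
  ultimately show ?thesis
    using finite_orb[OF subgroup_self] card_image card_mono by metis
qed

end

section \<open>Fixed-point-free abelian groups are cyclic\<close>

text \<open>The map \<open>j \<mapsto> c * j + d\<close> permutes the residues modulo
  \<open>q\<close>. The case \<open>c = d = 1\<close> shifts an orbit product; \<open>d = 0\<close>
  replaces a generator by one of its powers.\<close>

lemma (in comm_monoid) finprod_affine_reindex:
  assumes q: "coprime c (q::nat)" and per: "\<And>j. f (j mod q) = f j" and f: "\<And>j. f j \<in> carrier G"
  shows "finprod G (\<lambda>j. f (c * j + d)) {..<q} = finprod G f {..<q}"
proof -
  define h where "h j = (c * j + d) mod q" for j
  have inj: "inj_on h {..<q}"
  proof (rule inj_onI)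
    fix i j assume ij: "i \<in> {..<q}" "j \<in> {..<q}" "h i = h j"
    then have "[c * i + d = c * j + d] (mod q)" by (simp add: h_def cong_def)
    then have "[c * i = c * j] (mod q)" by (simp add: cong_add_rcancel_nat)
    then have "[i = j] (mod q)" using q cong_mult_lcancel_nat by blast
    then show "i = j" using ij by (simp add: cong_def)
  qed
  have "h ` {..<q} \<subseteq> {..<q}" by (auto simp: h_def)
  then have "h ` {..<q} = {..<q}" using inj by (simp add: endo_inj_surj)
  then have "finprod G f {..<q} = finprod G (\<lambda>j. f (h j)) {..<q}"
    using finprod_reindex[of f h "{..<q}"] inj f by auto
  then show ?thesis by (simp add: h_def per)
qed

lemma (in comm_monoid) finprod_swap:
  assumes "finite I" "finite J" and f: "\<And>i j. f i j \<in> carrier G"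
  shows "finprod G (\<lambda>i. finprod G (f i) J) I = finprod G (\<lambda>j. finprod G (\<lambda>i. f i j) I) J"
  using assms(1)
proof (induction I rule: finite_induct)
  case empty
  then show ?case by simp
next
  case (insert i I)
  have "finprod G (\<lambda>j. finprod G (\<lambda>i. f i j) (insert i I)) J =
    finprod G (\<lambda>j. f i j \<otimes> finprod G (\<lambda>i. f i j) I) J"
    using insert.hyps f by (intro finprod_cong') auto
  also have "\<dots> = finprod G (f i) J \<otimes> finprod G (\<lambda>j. finprod G (\<lambda>i. f i j) I) J"
    using f by (intro finprod_multf) auto
  finally show ?case using insert f by (simp add: Pi_iff)
qed

context group
begin

text \<open>The group \<open>\<langle>g, h\<rangle>\<close> acts on \<open>K\<close> as \<open>C\<^sub>q \<times> C\<^sub>q\<close>. The product of \<open>k\<^sup>u\<close> over any subgroup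
  of order \<open>q\<close> is a fixed point, hence trivial; multiplying over the subgroups
  \<open>\<langle>h g\<^sup>i\<rangle>\<close> and comparing with the product over \<open>\<langle>g\<rangle>\<close> leaves \<open>k\<^sup>q = 1\<close>.\<close>

lemma pow_eq_one_of_fixed_point_free:
  assumes K: "K \<lhd> G" and comm: "comm_group (G\<lparr>carrier := K\<rparr>)" and q: "prime (q::nat)"
    and g: "g \<in> carrier G" and h: "h \<in> carrier G" and gh: "g \<otimes> h = h \<otimes> g"
    and gq: "\<And>k. k \<in> K \<Longrightarrow> cj (g [^] q) k = k" and hq: "\<And>k. k \<in> K \<Longrightarrow> cj (h [^] q) k = k"
    and fg: "\<And>k. \<lbrakk>k \<in> K; cj g k = k\<rbrakk> \<Longrightarrow> k = \<one>"
    and fh: "\<And>k i::nat. \<lbrakk>k \<in> K; cj (h \<otimes> g [^] i) k = k\<rbrakk> \<Longrightarrow> k = \<one>"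
    and k: "k \<in> K"
  shows "k [^] q = \<one>"
proof -
  let ?K = "G\<lparr>carrier := K\<rparr>"
  interpret K: comm_group ?K by (rule comm)
  have Ks: "subgroup K G" by (rule normal_imp_subgroup[OF K])
  have Kc: "\<And>k. k \<in> K \<Longrightarrow> k \<in> carrier G" using Ks subgroup.mem_carrier by metis
  have cjK: "\<And>u k. \<lbrakk>u \<in> carrier G; k \<in> K\<rbrakk> \<Longrightarrow> cj u k \<in> K" using normal_cj[OF K] .
  have q1: "q > 1" using prime_gt_1_nat q by simp
  have cj_finprod: "cj u (finprod ?K f J) = finprod ?K (\<lambda>j. cj u (f j)) J"
    if u: "u \<in> carrier G" and f: "\<And>j. f j \<in> K" and "finite J" for u J and f :: "nat \<Rightarrow> 'a"
    using \<open>finite J\<close>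
  proof (induction J rule: finite_induct)
    case empty
    then show ?case using u by simp
  next
    case (insert j J)
    have "finprod ?K f J \<in> K" using K.finprod_closed[of f J] f by auto
    then show ?case
      using insert u f cjK Kc by (simp add: cj_mult_right Pi_iff)
  qed
  have per: "cj (u [^] (j mod q)) k = cj (u [^] j) k"
    if u: "u \<in> carrier G" "\<And>k. k \<in> K \<Longrightarrow> cj (u [^] q) k = k" and k: "k \<in> K" for u k and j :: nat
  proof -
    have *: "cj ((u [^] q) [^] i) k = k" for i :: nat
      by (induction i) (use u k Kc in \<open>auto simp: cj_mult_left\<close>)
    have "u [^] j = u [^] (j mod q) \<otimes> (u [^] q) [^] (j div q)"
      using u(1) by (simp add: nat_pow_pow nat_pow_mult)
    then show ?thesis using * u(1) k Kc by (simp add: cj_mult_left)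
  qed
  \<comment> \<open>Conjugation by \<open>u\<close> shifts the index by one, which modulo
    \<open>q\<close> only permutes the factors; so the product is fixed by \<open>u\<close>.\<close>
  have norm: "finprod ?K (\<lambda>j. cj (u [^] j) k) {..<q} = \<one>"
    if u: "u \<in> carrier G" "\<And>k. k \<in> K \<Longrightarrow> cj (u [^] q) k = k"
      "\<And>k. \<lbrakk>k \<in> K; cj u k = k\<rbrakk> \<Longrightarrow> k = \<one>" and k: "k \<in> K" for u k
  proof (rule u(3))
    let ?f = "\<lambda>j::nat. cj (u [^] j) k"
    have fK: "\<And>j. ?f j \<in> K" using cjK u(1) k by simp
    show "finprod ?K ?f {..<q} \<in> K" using K.finprod_closed[of ?f "{..<q}"] fK by auto
    have "cj u (finprod ?K ?f {..<q}) = finprod ?K (\<lambda>j. cj u (?f j)) {..<q}"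
      by (rule cj_finprod[OF u(1) fK]) simp
    also have "(\<lambda>j. cj u (?f j)) = (\<lambda>j. ?f (1 * j + 1))"
    proof
      fix j :: nat
      have "u \<otimes> u [^] j = u [^] j \<otimes> u" using u(1) by (metis nat_pow_Suc nat_pow_Suc2)
      then show "cj u (?f j) = ?f (1 * j + 1)" using u(1) k Kc by (simp flip: cj_mult_left)
    qed
    also have "finprod ?K (\<lambda>j. ?f (1 * j + 1)) {..<q} = finprod ?K ?f {..<q}"
      by (rule K.finprod_affine_reindex) (use per[OF u(1,2) k] fK in auto)
    finally show "cj u (finprod ?K ?f {..<q}) = finprod ?K ?f {..<q}" .
  qed
  define f where "f i j = cj ((h \<otimes> g [^] i) [^] j) k" for i j :: nat
  have hgc: "h \<otimes> g [^] i \<in> carrier G" for i :: nat using g h by simp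
  have hg: "(h \<otimes> g [^] i) [^] j = h [^] j \<otimes> g [^] (i * j)" for i j :: nat
  proof -
    have "g [^] i \<otimes> h = h \<otimes> g [^] i" using gh g h by (simp add: group_commutes_pow)
    then show ?thesis using g h pow_mult_distrib[of h "g [^] i" j] by (simp add: nat_pow_pow)
  qed
  have fK: "f i j \<in> K" for i j using cjK hgc k by (simp add: f_def)
  have "cj ((h \<otimes> g [^] i) [^] q) k' = k'" if k': "k' \<in> K" for i :: nat and k'
  proof -
    have "cj (g [^] (i * q)) k' = cj (g [^] (i * q mod q)) k'"
      using per[OF g gq k', of "i * q"] by simp
    then have "cj (g [^] (i * q)) k' = k'" using k' Kc by simp
    then show ?thesis unfolding hg using g h k' Kc hq by (simp add: cj_mult_left)
  qed
  then have "finprod ?K (\<lambda>j. cj ((h \<otimes> g [^] i) [^] j) k) {..<q} = \<one>" for i :: nat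
    by (intro norm[OF hgc _ _ k] fh)
  then have "finprod ?K (f i) {..<q} = \<one>" for i
    unfolding f_def .
  then have "finprod ?K (\<lambda>i. finprod ?K (f i) {..<q}) {..<q} = \<one>"
    using K.finprod_one by simp
  moreover have "finprod ?K (\<lambda>i. finprod ?K (f i) {..<q}) {..<q} =
    finprod ?K (\<lambda>j. finprod ?K (\<lambda>i. f i j) {..<q}) {..<q}"
    by (rule K.finprod_swap) (use fK in auto)
  \<comment> \<open>For fixed \<open>j \<noteq> 0\<close> the exponents \<open>i * j\<close> run
    through all residues modulo \<open>q\<close>, so up to order the factors are the conjugates of
    \<open>k'\<close> by the powers of \<open>g\<close>.\<close>
  moreover have "finprod ?K (\<lambda>i. f i j) {..<q} = \<one>" if j: "j < q" "0 < j" for j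
  proof -
    define k' where "k' = cj (h [^] j) k"
    have k'K: "k' \<in> K" using cjK h k by (simp add: k'_def)
    have "h [^] j \<otimes> g [^] i = g [^] i \<otimes> h [^] j" for i :: nat
      using gh g h by (metis group_commutes_pow nat_pow_closed)
    then have eq: "f i j = cj (g [^] (j * i + 0)) k'" for i
      unfolding f_def hg k'_def using g h k Kc by (simp add: mult.commute flip: cj_mult_left)
    have "\<not> q dvd j" using j by (simp add: nat_dvd_not_less)
    then have "coprime j q" using q prime_imp_coprime[of q j] by (simp add: coprime_commute)
    then have "finprod ?K (\<lambda>i. cj (g [^] (j * i + 0)) k') {..<q} = finprod ?K (\<lambda>i. cj (g [^] i) k') {..<q}"
      by (rule K.finprod_affine_reindex) (use per[OF g gq k'K] cjK g k'K in auto)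
    also have "\<dots> = \<one>" by (rule norm[OF g gq fg k'K])
    finally show ?thesis by (simp only: eq)
  qed
  moreover have "finprod ?K (\<lambda>i. f i 0) {..<q} = k [^] q"
  proof -
    have "f i 0 = k" for i using k Kc by (simp add: f_def)
    moreover have "k [^]\<^bsub>?K\<^esub> q = k [^] q" by (simp add: nat_pow_def)
    ultimately show ?thesis using K.finprod_const[of k "{..<q}"] k by simp
  qed
  moreover have "finprod ?K (\<lambda>j. finprod ?K (\<lambda>i. f i j) {..<q}) {..<q} =
      finprod ?K (\<lambda>i. f i 0) {..<q}"
  proof -
    have cl: "finprod ?K (\<lambda>i. f i j) {..<q} \<in> K" for j
      using K.finprod_closed[of "\<lambda>i. f i j" "{..<q}"] fK by auto
    have ins: "{..<q} = insert 0 {0<..<q}" using q1 by auto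
    have "finprod ?K (\<lambda>j. finprod ?K (\<lambda>i. f i j) {..<q}) {0<..<q} = \<one>\<^bsub>?K\<^esub>"
      by (rule K.finprod_one_eqI) (use \<open>\<And>j. \<lbrakk>j < q; 0 < j\<rbrakk> \<Longrightarrow> finprod ?K (\<lambda>i. f i j) {..<q} = \<one>\<close> in simp)
    moreover have "finprod ?K (\<lambda>j. finprod ?K (\<lambda>i. f i j) {..<q}) (insert 0 {0<..<q}) =
      finprod ?K (\<lambda>i. f i 0) {..<q} \<otimes>\<^bsub>?K\<^esub> finprod ?K (\<lambda>j. finprod ?K (\<lambda>i. f i j) {..<q}) {0<..<q}"
      by (rule K.finprod_insert) (use cl in auto)
    moreover have "finprod ?K (\<lambda>i. f i 0) {..<q} \<in> carrier ?K"
      using cl by simp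
    ultimately show ?thesis using ins K.r_one by simp
  qed
  ultimately show ?thesis by simp
qed

text \<open>A power that kills \<open>x \<otimes> y\<close>, multiplied by \<open>ord y\<close>,
  also kills \<open>x\<close>; so \<open>ord x\<close> divides the order of the product, and
  symmetrically for \<open>ord y\<close>.\<close>

lemma ord_mult_coprime:
  assumes x: "x \<in> carrier G" and y: "y \<in> carrier G" and xy: "x \<otimes> y = y \<otimes> x"
    and cop: "coprime (ord x) (ord y)"
  shows "ord x * ord y dvd ord (x \<otimes> y)"
proof -
  let ?k = "ord (x \<otimes> y)"
  have eq: "x [^] (?k * j) \<otimes> y [^] (?k * j) = \<one>" for j
  proof -
    have "x [^] (?k * j) \<otimes> y [^] (?k * j) = (x \<otimes> y) [^] (?k * j)"
      using pow_mult_distrib[OF xy x y] by simp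
    also have "\<dots> = ((x \<otimes> y) [^] ?k) [^] j" using x y by (simp only: nat_pow_pow m_closed)
    also have "\<dots> = \<one>" using x y by simp
    finally show ?thesis .
  qed
  have "y [^] (?k * ord y) = \<one>" "x [^] (?k * ord x) = \<one>"
    using x y by (simp_all add: pow_eq_id)
  then have "x [^] (?k * ord y) = \<one>" "y [^] (?k * ord x) = \<one>"
    using eq[of "ord y"] eq[of "ord x"] x y by simp_all
  then have "ord x dvd ?k * ord y" "ord y dvd ?k * ord x"
    using x y by (simp_all add: pow_eq_id)
  then have "ord x dvd ?k" "ord y dvd ?k"
    using cop by (simp_all add: coprime_dvd_mult_left_iff coprime_commute)
  then show ?thesis using cop by (simp add: divides_mult)
qed

end

text \<open>An element of maximal order works: if a prime \<open>q\<close> occurred to a higher power in the order of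
  some \<open>x\<close>, exchanging the \<open>q\<close>-parts of the two elements would increase the order.\<close>

lemma (in comm_group) ord_eq_exponent:
  assumes fin: "finite (carrier G)"
  obtains a where "a \<in> carrier G" "\<And>x. x \<in> carrier G \<Longrightarrow> ord x dvd ord a"
proof -
  have pos: "ord x > 0" if "x \<in> carrier G" for x using ord_ge_1[OF fin that] by simp
  have ne: "ord ` carrier G \<noteq> {}" by auto
  obtain a where a: "a \<in> carrier G" "ord a = Max (ord ` carrier G)"
    using Max_in[OF _ ne] fin by auto
  have le: "ord x \<le> ord a" if "x \<in> carrier G" for x
    using a fin that by (simp add: Max_ge)
  have "ord x dvd ord a" if x: "x \<in> carrier G" for x
  proof (rule ccontr)
    assume "\<not> ord x dvd ord a"
    then obtain q where q: "prime q" "multiplicity q (ord a) < multiplicity q (ord x)"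
      using multiplicity_le_imp_dvd[of "ord x" "ord a"] pos[OF x] not_le by blast
    define u where "u = multiplicity q (ord x)"
    define v where "v = multiplicity q (ord a)"
    have nu: "\<not> is_unit q" using q(1) by auto
    have nzx: "ord x \<noteq> 0" and nza: "ord a \<noteq> 0" using pos x a(1) by auto
    obtain r where r: "ord x = q ^ u * r" "\<not> q dvd r"
      using multiplicity_decompose'[OF nzx nu] unfolding u_def by blast
    obtain t where t: "ord a = q ^ v * t" "\<not> q dvd t"
      using multiplicity_decompose'[OF nza nu] unfolding v_def by blast
    have q0: "q > 1" using prime_gt_1_nat[OF q(1)] .
    have r0: "r \<noteq> 0" and t0: "t \<noteq> 0" using r t by (metis dvd_0_right)+
    have ox: "ord (x [^] r) = q ^ u" using ord_pow[OF x, of r] r(1) r0 by simp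
    have oa: "ord (a [^] (q ^ v)) = t" using ord_pow[OF a(1), of "q ^ v"] t(1) q0 by simp
    have "coprime (q ^ u) t" using prime_imp_coprime[OF q(1) t(2)] by simp
    then have "q ^ u * t dvd ord (x [^] r \<otimes> a [^] (q ^ v))"
      using ord_mult_coprime[of "x [^] r" "a [^] (q ^ v)"] ox oa x a(1) by (simp add: m_comm)
    then have "q ^ u * t \<le> ord (x [^] r \<otimes> a [^] (q ^ v))"
      using pos[of "x [^] r \<otimes> a [^] (q ^ v)"] x a(1) by (simp add: dvd_imp_le)
    also have "\<dots> \<le> q ^ v * t" using le[of "x [^] r \<otimes> a [^] (q ^ v)"] x a(1) t(1) by simp
    finally have "q ^ u \<le> q ^ v" using t0 by simp
    then show False using q(2) q0 by (simp add: u_def v_def)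
  qed
  then show ?thesis using that a(1) by blast
qed

text \<open>Let \<open>a\<close> have order equal to the exponent \<open>N\<close>. An element that
  is no power of \<open>a\<close> has a power \<open>b\<close> outside \<open>S\<close> with
  \<open>b [^] q\<close> in \<open>S\<close> for some prime \<open>q\<close>. If \<open>q\<close>
  divides \<open>N\<close>, removing from \<open>b\<close> a \<open>q\<close>-th root of
  \<open>b [^] q\<close> taken in \<open>S\<close> leaves a \<open>q\<close>-torsion element, a
  power of \<open>a\<close> by hypothesis. Otherwise \<open>b\<close> is a power of
  \<open>b [^] q\<close>.\<close>

lemma (in comm_group) cyclic_group_if_prime_torsion_cyclic:
  assumes fin: "finite (carrier G)"
    and tors: "\<And>q u v. \<lbrakk>prime (q::nat); u \<in> carrier G; v \<in> carrier G; u [^] q = \<one>; v [^] q = \<one>; u \<noteq> \<one>\<rbrakk>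
      \<Longrightarrow> \<exists>i::nat. v = u [^] i"
  shows "cyclic_group G"
proof -
  obtain a where a: "a \<in> carrier G" "\<And>x. x \<in> carrier G \<Longrightarrow> ord x dvd ord a"
    using ord_eq_exponent[OF fin] by blast
  define N where "N = ord a"
  have N0: "N > 0" using ord_ge_1[OF fin a(1)] by (simp add: N_def)
  have pN: "x [^] N = \<one>" if "x \<in> carrier G" for x
    using a(2)[OF that] that by (simp add: N_def pow_eq_id)
  define S where "S = range (\<lambda>i::nat. a [^] i)"
  have Sm: "u \<otimes> v \<in> S" if "u \<in> S" "v \<in> S" for u v
    using that a(1) by (auto simp: S_def nat_pow_mult)
  have "c \<in> S" if c: "c \<in> carrier G" for c
  proof (rule ccontr)
    assume cS: "c \<notin> S"
    define P where "P k \<longleftrightarrow> 0 < k \<and> c [^] k \<in> S" for k :: nat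
    have "c [^] N = a [^] (0::nat)" using pN[OF c] by simp
    then have PN: "P N" using N0 unfolding P_def S_def by blast
    define k where "k = (LEAST k. P k)"
    have k: "P k" unfolding k_def by (rule LeastI[of P, OF PN])
    have least: "\<not> P j" if "j < k" for j using not_less_Least that unfolding k_def by blast
    have "k \<noteq> 1" using k cS c by (auto simp: P_def)
    then obtain q where q: "prime q" "q dvd k" using prime_factor_nat by blast
    then obtain k' where k': "k = q * k'" by auto
    have q1: "q > 1" using prime_gt_1_nat[OF q(1)] .
    define b where "b = c [^] k'"
    have bc: "b \<in> carrier G" using c by (simp add: b_def)
    have "0 < k'" "k' < k" using k k' q1 by (auto simp: P_def)
    then have bS: "b \<notin> S" using least[of k'] by (auto simp: P_def b_def)
    have "b [^] q = c [^] k" using c by (simp add: b_def k' nat_pow_pow mult.commute)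
    then obtain s :: nat where s: "b [^] q = a [^] s" using k by (auto simp: P_def S_def)
    show False
    proof (cases "q dvd N")
      case True
      then obtain N' where N': "N = q * N'" by auto
      \<comment> \<open>Since \<open>N\<close> kills \<open>b\<close>, this power is trivial. Hence
        \<open>q\<close> divides \<open>s\<close>, which provides the root
        \<open>a [^] s'\<close>.\<close>
      have "a [^] (s * N') = (b [^] q) [^] N'" using a(1) by (simp add: s nat_pow_pow)
      also have "\<dots> = \<one>" using pN[OF bc] bc by (simp add: nat_pow_pow N')
      finally have "N dvd s * N'" using a(1) by (simp add: pow_eq_id N_def)
      then have "q dvd s" using N' N0 by simp
      then obtain s' where s': "s = q * s'" by auto
      define v where "v = b \<otimes> inv (a [^] s')"
      have vc: "v \<in> carrier G" using bc a(1) by (simp add: v_def)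
      have "v [^] q = b [^] q \<otimes> inv (a [^] s)"
        using bc a(1) by (simp add: v_def pow_mult_distrib m_comm nat_pow_inv nat_pow_pow s' mult.commute)
      then have "v [^] q = \<one>" using s a(1) by simp
      moreover have "(a [^] N') [^] q = \<one>" using pN[OF a(1)] a(1) by (simp add: nat_pow_pow N' mult.commute)
      moreover have "a [^] N' \<noteq> \<one>"
        using a(1) N' N0 q1 by (auto simp: pow_eq_id simp flip: N_def dest: dvd_imp_le)
      ultimately obtain i :: nat where i: "v = (a [^] N') [^] i" using tors[OF q(1) _ vc] a(1) by blast
      then have "v \<in> S" using a(1) by (auto simp: S_def nat_pow_pow)
      moreover have "b = v \<otimes> a [^] s'" using bc a(1) by (simp add: v_def m_assoc)
      ultimately have "b \<in> S" using Sm by (auto simp: S_def)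
      with bS show False by simp
    next
      case False
      then have "coprime q N" using q(1) prime_imp_coprime by blast
      then obtain u where "[q * u = 1] (mod N)" using cong_solve_coprime_nat by auto
      then have "b [^] (q * u) = b" using pow_eq_of_cong[OF bc pN[OF bc]] bc by (metis nat_pow_eone)
      then have "b = a [^] (s * u)" using bc a(1) s by (metis nat_pow_pow)
      with bS show False by (auto simp: S_def)
    qed
  qed
  then have "carrier G \<subseteq> S" by blast
  moreover have "S \<subseteq> range (\<lambda>i::int. a [^] i)" by (force simp: S_def int_pow_int simp flip: int_pow_int)
  moreover have "range (\<lambda>i::int. a [^] i) \<subseteq> carrier G" using a(1) by auto
  ultimately show ?thesis using a(1) unfolding cyclic_group by blast
qed

section \<open>Coprime parts of an element\<close>

text \<open>Primes shared with \<open>n\<close> are moved into \<open>a\<close> one at a time. The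
  last clause says, without factorizations, that every prime of \<open>a\<close> divides
  \<open>n\<close>; it later turns \<open>coprime m n\<close> into
  \<open>coprime m a\<close>.\<close>

lemma exists_coprime_split:
  fixes N n :: nat
  assumes "N > 0"
  shows "\<exists>a b. N = a * b \<and> coprime b n \<and> (\<forall>k. coprime k n \<longrightarrow> coprime k a)"
  using assms
proof (induction N rule: less_induct)
  case (less N)
  show ?case
  proof (cases "coprime N n")
    case True
    then show ?thesis by (intro exI[of _ 1] exI[of _ N]) simp
  next
    case False
    then obtain q where q: "prime q" "q dvd N" "q dvd n"
      using prime_factor_nat[of "gcd N n"] by (auto simp: coprime_iff_gcd_eq_1)
    then obtain N' where N': "N = q * N'" by auto
    have "N' < N" "0 < N'" using N' less.prems prime_gt_1_nat[OF q(1)] by auto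
    then obtain a b where ab: "N' = a * b" "coprime b n" "\<forall>k. coprime k n \<longrightarrow> coprime k a"
      using less.IH by blast
    have "coprime k (q * a)" if "coprime k n" for k
      using ab(3) that coprime_divisors[OF dvd_refl q(3)] by simp
    then show ?thesis
      using ab N' by (intro exI[of _ "q * a"] exI[of _ b]) auto
  qed
qed

text \<open>By the congruences, \<open>g\<^bsup>ea\<^esup>\<close> and \<open>g\<^bsup>eb\<^esup>\<close> are the factors of \<open>g\<close> of order dividing \<open>a\<close> and \<open>b\<close>.\<close>

locale coprime_split = finite_group +
  fixes a b ea eb :: nat
  assumes order_split: "order G = a * b" and coprime_ab: "coprime a b"
    and ea: "[ea = 1] (mod a)" "[ea = 0] (mod b)"
    and eb: "[eb = 0] (mod a)" "[eb = 1] (mod b)"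
begin

definition apart :: "'a \<Rightarrow> 'a" where "apart g = g [^] ea"

definition bpart :: "'a \<Rightarrow> 'a" where "bpart g = g [^] eb"

lemma apart_closed [simp]: "g \<in> carrier G \<Longrightarrow> apart g \<in> carrier G"
  and bpart_closed [simp]: "g \<in> carrier G \<Longrightarrow> bpart g \<in> carrier G"
  by (simp_all add: apart_def bpart_def)

lemma apart_mem: "\<lbrakk>subgroup H G; h \<in> H\<rbrakk> \<Longrightarrow> apart h \<in> H"
  and bpart_mem: "\<lbrakk>subgroup H G; h \<in> H\<rbrakk> \<Longrightarrow> bpart h \<in> H"
  by (simp_all add: apart_def bpart_def subgroup_pow_closed)

lemma pow_ab: "g \<in> carrier G \<Longrightarrow> g [^] (a * b) = \<one>"
  using pow_order_eq_1 order_split by metis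

lemma apart_pow: "g \<in> carrier G \<Longrightarrow> apart g [^] a = \<one>"
proof -
  assume g: "g \<in> carrier G"
  have "a * b dvd ea * a" using ea(2) by (auto simp: cong_0_iff)
  then show ?thesis
    using pow_dvd_eq_one[OF g pow_ab[OF g]] g by (simp add: apart_def nat_pow_pow)
qed

lemma bpart_pow: "g \<in> carrier G \<Longrightarrow> bpart g [^] b = \<one>"
proof -
  assume g: "g \<in> carrier G"
  have "a * b dvd eb * b" using eb(1) by (auto simp: cong_0_iff)
  then show ?thesis
    using pow_dvd_eq_one[OF g pow_ab[OF g]] g by (simp add: bpart_def nat_pow_pow)
qed

lemma apart_mult_bpart: "g \<in> carrier G \<Longrightarrow> apart g \<otimes> bpart g = g"
proof -
  assume g: "g \<in> carrier G"
  have "[ea + eb = 1 + 0] (mod a)" using ea(1) eb(1) by (rule cong_add)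
  moreover have "[ea + eb = 0 + 1] (mod b)" using ea(2) eb(2) by (rule cong_add)
  ultimately have "[ea + eb = 1] (mod a * b)" using coprime_ab coprime_cong_mult_nat by simp
  then show ?thesis
    using pow_eq_of_cong[OF g pow_ab[OF g]] g by (simp add: apart_def bpart_def nat_pow_mult)
qed

lemma a_elt_parts:
  assumes "u \<in> carrier G" "u [^] a = \<one>"
  shows "apart u = u" "bpart u = \<one>"
  using pow_eq_of_cong[OF assms ea(1)] pow_eq_of_cong[OF assms eb(1)] assms
  by (simp_all add: apart_def bpart_def)

lemma b_elt_parts:
  assumes "w \<in> carrier G" "w [^] b = \<one>"
  shows "apart w = \<one>" "bpart w = w"
  using pow_eq_of_cong[OF assms ea(2)] pow_eq_of_cong[OF assms eb(2)] assms
  by (simp_all add: apart_def bpart_def)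

lemma eq_one_of_pow_ab:
  "\<lbrakk>x \<in> carrier G; x [^] a = \<one>; x [^] b = \<one>\<rbrakk> \<Longrightarrow> x = \<one>"
  using eq_one_of_coprime_pows coprime_ab by blast

lemma parts_mult:
  assumes "u \<in> carrier G" "u [^] a = \<one>" "w \<in> carrier G" "w [^] b = \<one>" "u \<otimes> w = w \<otimes> u"
  shows "apart (u \<otimes> w) = u" "bpart (u \<otimes> w) = w"
  using assms a_elt_parts[of u] b_elt_parts[of w]
  by (simp_all add: apart_def bpart_def pow_mult_distrib)

lemma centralizer_parts:
  assumes g: "g \<in> carrier G"
  shows "centralizer g = centralizer (apart g) \<inter> centralizer (bpart g)"
  using centralizer_pow[OF g] centralizer_mult[of "apart g" "bpart g"] apart_mult_bpart[OF g] g
  by (auto simp: apart_def bpart_def)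

lemma centralizer_mult_coprime:
  assumes "u \<in> carrier G" "u [^] a = \<one>" "w \<in> carrier G" "w [^] b = \<one>" "u \<otimes> w = w \<otimes> u"
  shows "centralizer (u \<otimes> w) = centralizer u \<inter> centralizer w"
  using centralizer_parts[of "u \<otimes> w"] parts_mult[OF assms] assms by simp

lemma parts_commute: "g \<in> carrier G \<Longrightarrow> apart g \<otimes> bpart g = bpart g \<otimes> apart g"
  by (simp add: apart_def bpart_def nat_pow_mult add.commute)

lemma mem_centre_of_parts:
  "\<lbrakk>g \<in> carrier G; apart g \<in> centre G; bpart g \<in> centre G\<rbrakk> \<Longrightarrow> g \<in> centre G"
  using mult_mem_centre[of "apart g" "bpart g"] apart_mult_bpart by simp

text \<open>Otherwise a Sylow \<open>q\<close>-subgroup of \<open>H\<close>, whose elements satisfy \<open>h\<^sup>b = 1\<close>, would lie in \<open>Z\<close>.\<close>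

lemma noncentral_b_element_exists:
  assumes H: "subgroup H G" and Z: "subgroup Z G" and k: "card H = card Z * k"
    and q: "prime q" "q dvd k" "q dvd b"
  shows "\<exists>w \<in> H. w [^] b = \<one> \<and> w \<notin> Z"
proof (rule ccontr)
  assume neg: "\<not> ?thesis"
  have "card H > 0" "q > 1" using card_subgroup_pos[OF H] prime_gt_1_nat q by auto
  then have "card H \<noteq> 0" "\<not> is_unit q" by auto
  from multiplicity_decompose'[OF this] obtain t
    where rt: "card H = q ^ multiplicity q (card H) * t" "\<not> q dvd t" by blast
  define r where "r = multiplicity q (card H)"
  note rt = rt[folded r_def]
  obtain P where P: "subgroup P G" "P \<subseteq> H" "card P = q ^ r"
    using sylow_in_subgroup[OF H q(1) rt(1)] by blast
  have "q ^ r dvd a * b"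
    using rt(1) lagrange[OF H] order_split by (metis dvd_mult dvd_triv_left)
  moreover have "coprime (q ^ r) a"
    using coprime_divisors[OF q(3) dvd_refl[of a]] coprime_ab
    by (simp add: coprime_commute)
  ultimately have "q ^ r dvd b" by (simp add: coprime_dvd_mult_right_iff)
  then have "w [^] b = \<one>" if "w \<in> P" for w
    using pow_card_subgroup[OF P(1) that] P subgroup.mem_carrier[OF P(1) that] pow_dvd_eq_one by metis
  then have "P \<subseteq> Z" using neg P(2) by auto
  then have "q ^ r dvd card Z" using card_subgroup_dvd[OF P(1) Z] P(3) by simp
  then have "q ^ r * q dvd q ^ r * t" using q(2) k rt(1) by (metis mult_dvd_mono)
  then show False using rt(2) \<open>q > 1\<close> by simp
qed

section \<open>Abelian normal subgroups and coprime action\<close>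

definition adjoin :: "'a set \<Rightarrow> 'a \<Rightarrow> 'a set"
  where "adjoin N y = {v \<otimes> y [^] k | v (k::nat). v \<in> N}"

text \<open>Conjugation changes \<open>y\<close> only by elements of \<open>N\<close>, hence the
  normality. Applied to \<open>y\<close> of class size \<open>m\<close>, this gives an abelian
  normal subgroup that contains \<open>y\<close> and is killed by \<open>a\<close>.\<close>

lemma normal_adjoin:
  assumes N: "N \<lhd> G" and y: "y \<in> carrier G" "y [^] a = \<one>"
    and comm: "\<forall>u \<in> N. \<forall>v \<in> N. u \<otimes> v = v \<otimes> u"
    and Ny: "N \<subseteq> centralizer y" and Na: "\<forall>v \<in> N. v [^] a = \<one>"
    and yN: "\<forall>g \<in> carrier G. inv y \<otimes> cj g y \<in> N"
  shows "adjoin N y \<lhd> G" "N \<subseteq> adjoin N y" "y \<in> adjoin N y" "adjoin N y \<subseteq> centralizer y"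
    "\<forall>v \<in> adjoin N y. v [^] a = \<one>"
    "\<forall>u \<in> adjoin N y. \<forall>v \<in> adjoin N y. u \<otimes> v = v \<otimes> u"
proof -
  let ?V = "adjoin N y"
  have Ns: "subgroup N G" using N normal_imp_subgroup by auto
  have Nc: "\<And>v. v \<in> N \<Longrightarrow> v \<in> carrier G" using Ns subgroup.mem_carrier by metis
  have "a > 0" using order_split order_gt_0_iff_finite fin by (metis nat_0_less_mult_iff)
  have vy: "v \<otimes> y = y \<otimes> v" if "v \<in> N" for v using that Ny by (auto simp: centralizer_def)
  have vyk: "v \<otimes> y [^] k = y [^] k \<otimes> v" if "v \<in> N" for v and k :: nat
    using vy[OF that] Nc[OF that] y by (simp add: group_commutes_pow)
  have mult: "(v \<otimes> y [^] k) \<otimes> (v' \<otimes> y [^] k') = (v \<otimes> v') \<otimes> y [^] (k + k')"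
    if "v \<in> N" "v' \<in> N" for v v' and k k' :: nat
  proof -
    have "(v \<otimes> y [^] k) \<otimes> (v' \<otimes> y [^] k') = v \<otimes> (y [^] k \<otimes> v') \<otimes> y [^] k'"
      using that Nc y by (simp add: m_assoc)
    also have "y [^] k \<otimes> v' = v' \<otimes> y [^] k" using vyk[OF that(2)] by simp
    finally show ?thesis using that Nc y by (simp add: m_assoc nat_pow_mult)
  qed
  have Va: "v [^] a = \<one>" if "v \<in> ?V" for v
  proof -
    obtain n k where v: "n \<in> N" "v = n \<otimes> y [^] (k::nat)" using \<open>v \<in> ?V\<close> by (auto simp: adjoin_def)
    have "v [^] a = n [^] a \<otimes> (y [^] k) [^] a"
      unfolding v(2) using vyk[OF v(1)] Nc[OF v(1)] y(1) by (intro pow_mult_distrib) auto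
    also have "(y [^] k) [^] a = (y [^] a) [^] k" using y(1) by (simp only: nat_pow_pow mult.commute)
    finally show ?thesis using Na v(1) y(2) by simp
  qed
  then show "\<forall>v \<in> ?V. v [^] a = \<one>" by blast
  have Vcomm: "v \<otimes> g = g \<otimes> v" if vg: "v \<in> ?V" "g \<in> ?V" for v g
  proof -
    obtain n k where v: "n \<in> N" "v = n \<otimes> y [^] (k::nat)" using vg by (auto simp: adjoin_def)
    obtain n' k' where g: "n' \<in> N" "g = n' \<otimes> y [^] (k'::nat)" using vg by (auto simp: adjoin_def)
    show ?thesis
      unfolding v(2) g(2) mult[OF v(1) g(1)] mult[OF g(1) v(1)] comm[rule_format, OF v(1) g(1)]
      by (simp only: add.commute)
  qed
  then show "\<forall>u \<in> ?V. \<forall>v \<in> ?V. u \<otimes> v = v \<otimes> u" by blast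
  show NV: "N \<subseteq> ?V"
  proof
    fix v assume "v \<in> N"
    then have "v = v \<otimes> y [^] (0::nat)" using Nc y by simp
    then show "v \<in> ?V" using \<open>v \<in> N\<close> unfolding adjoin_def by blast
  qed
  have "\<one> \<otimes> y [^] (1::nat) \<in> ?V" unfolding adjoin_def using subgroup.one_closed[OF Ns] by blast
  then show yV: "y \<in> ?V" using y by simp
  have Vc: "?V \<subseteq> carrier G" using Nc y by (auto simp: adjoin_def)
  show "?V \<subseteq> centralizer y" using Vcomm yV Vc by (auto simp: centralizer_def)
  have "subgroup ?V G"
  proof
    show "?V \<subseteq> carrier G" by fact
    show "\<one> \<in> ?V" using NV subgroup.one_closed[OF Ns] by auto
    show m: "x \<otimes> z \<in> ?V" if xz: "x \<in> ?V" "z \<in> ?V" for x z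
    proof -
      obtain n k where v: "n \<in> N" "x = n \<otimes> y [^] (k::nat)" using xz by (auto simp: adjoin_def)
      obtain n' k' where g: "n' \<in> N" "z = n' \<otimes> y [^] (k'::nat)" using xz by (auto simp: adjoin_def)
      have "n \<otimes> n' \<in> N" using v g Ns subgroup.m_closed by metis
      then show ?thesis unfolding v(2) g(2) mult[OF v(1) g(1)] adjoin_def by blast
    qed
    have p: "x [^] (k::nat) \<in> ?V" if "x \<in> ?V" for x k
      by (induction k) (use that m \<open>\<one> \<in> ?V\<close> in auto)
    show "inv x \<in> ?V" if "x \<in> ?V" for x
    proof -
      have x: "x \<in> carrier G" using that Vc by auto
      \<comment> \<open>The power \<open>a - 1\<close> supplies inverses (here \<open>a > 0\<close>
        matters), so natural exponents suffice in \<open>adjoin\<close>.\<close>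
      have "x [^] (a - 1) \<otimes> x = \<one>"
        using Va[OF that] x \<open>a > 0\<close> by (metis Suc_pred' nat_pow_Suc diff_Suc_1)
      then have "inv x = x [^] (a - 1)" using x inv_equality by simp
      then show ?thesis using p[OF that] by simp
    qed
  qed
  then show "?V \<lhd> G"
  proof (rule normalI_cj)
    fix g x assume g: "g \<in> carrier G" and x: "x \<in> ?V"
    obtain n k where v: "n \<in> N" "x = n \<otimes> y [^] (k::nat)" using x by (auto simp: adjoin_def)
    define c where "c = inv y \<otimes> cj g y"
    have c: "c \<in> N" "cj g y = c \<otimes> y"
      using yN[rule_format, OF g] y g vy[OF yN[rule_format, OF g], symmetric] by (simp_all add: c_def)
    have "cj g x = (cj g n \<otimes> c [^] k) \<otimes> y [^] k"
      unfolding v(2) using g c(2) v(1) y(1) Nc[OF c(1)] Nc[OF v(1)] pow_mult_distrib[OF vy[OF c(1)], of k]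
      by (simp add: cj_mult_right cj_pow_right m_assoc)
    moreover have "cj g n \<otimes> c [^] k \<in> N"
      using normal_cj[OF N g v(1)] subgroup_pow_closed[OF Ns c(1)] Ns subgroup.m_closed by metis
    ultimately show "cj g x \<in> ?V" unfolding adjoin_def by blast
  qed
qed

text \<open>The decomposition \<open>V = C\<^sub>V(w) \<times> [V, w]\<close>. Since \<open>[u, w] = (u\<inverse> w u) w\<inverse>\<close>, the set \<open>[V, w]\<close>
  is in bijection with an orbit of \<open>V\<close>.\<close>

lemma coprime_action_split:
  assumes V: "subgroup V G" and Va: "\<forall>v \<in> V. v [^] a = \<one>"
    and comm: "\<forall>u \<in> V. \<forall>v \<in> V. u \<otimes> v = v \<otimes> u"
    and w: "w \<in> carrier G" "w [^] b = \<one>" and wV: "\<forall>v \<in> V. cj w v \<in> V"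
  defines "M \<equiv> (\<lambda>u. inv u \<otimes> cj w u) ` V"
  shows "subgroup M G" "M \<subseteq> V" "card M = card (orb V w)" "M \<inter> centralizer w = {\<one>}"
    "\<forall>y \<in> V. \<exists>v \<in> V \<inter> centralizer w. \<exists>t \<in> M. y = v \<otimes> t"
proof -
  have Vc: "\<And>v. v \<in> V \<Longrightarrow> v \<in> carrier G" using V subgroup.mem_carrier by metis
  \<comment> \<open>As \<open>V\<close> is abelian and preserved by \<open>w\<close>, the map
    \<open>u \<mapsto> inv u \<otimes> cj w u\<close> is an endomorphism of \<open>V\<close> with
    image \<open>M\<close>.\<close>
  have mult: "(inv u \<otimes> cj w u) \<otimes> (inv v \<otimes> cj w v) = inv (u \<otimes> v) \<otimes> cj w (u \<otimes> v)"
    if uv: "u \<in> V" "v \<in> V" for u v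
  proof -
    have "inv (u \<otimes> v) = inv u \<otimes> inv v"
      using comm[rule_format, OF uv] inv_mult_group[of v u] Vc uv by simp
    moreover have "cj w u \<otimes> inv v = inv v \<otimes> cj w u"
      using comm[rule_format, OF wV[rule_format, OF uv(1)] subgroup.m_inv_closed[OF V uv(2)]] .
    then have "cj w u \<otimes> (inv v \<otimes> cj w v) = inv v \<otimes> (cj w u \<otimes> cj w v)"
      using Vc uv w by (simp flip: m_assoc)
    ultimately show ?thesis using Vc uv w by (simp add: m_assoc cj_mult_right)
  qed
  show MV: "M \<subseteq> V"
    unfolding M_def using wV subgroup.m_closed[OF V] subgroup.m_inv_closed[OF V] by blast
  have one: "\<one> \<in> V" using subgroup.one_closed[OF V] .
  show M: "subgroup M G"
  proof
    show "M \<subseteq> carrier G" using MV Vc by auto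
    show "\<one> \<in> M" unfolding M_def using one w by (intro image_eqI[of _ _ \<one>]) auto
    show "x \<otimes> y \<in> M" if xy: "x \<in> M" "y \<in> M" for x y
    proof -
      obtain u v where u: "u \<in> V" "x = inv u \<otimes> cj w u" and v: "v \<in> V" "y = inv v \<otimes> cj w v"
        using xy by (auto simp: M_def)
      have "x \<otimes> y = inv (u \<otimes> v) \<otimes> cj w (u \<otimes> v)"
        unfolding u(2) v(2) by (rule mult[OF u(1) v(1)])
      then show ?thesis
        unfolding M_def using subgroup.m_closed[OF V u(1) v(1)] by blast
    qed
    show "inv x \<in> M" if x: "x \<in> M" for x
    proof -
      obtain u where u: "u \<in> V" "x = inv u \<otimes> cj w u" using x by (auto simp: M_def)
      have iu: "inv u \<in> V" using u V subgroup.m_inv_closed by metis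
      have "(inv (inv u) \<otimes> cj w (inv u)) \<otimes> x = \<one>"
        unfolding u(2) mult[OF iu u(1)] using u Vc w by simp
      then have "inv x = inv (inv u) \<otimes> cj w (inv u)"
        using inv_equality u Vc w by auto
      then show ?thesis unfolding M_def using iu by blast
    qed
  qed
  have inv_cj: "inv u \<otimes> cj w u = cj (inv u) w \<otimes> inv w" if "u \<in> V" for u
    using that Vc w by (simp add: cj_def m_assoc)
  have "M = (\<lambda>t. t \<otimes> inv w) ` orb V w"
  proof
    show "M \<subseteq> (\<lambda>t. t \<otimes> inv w) ` orb V w"
      unfolding M_def orb_def using inv_cj subgroup.m_inv_closed[OF V] by auto
    show "(\<lambda>t. t \<otimes> inv w) ` orb V w \<subseteq> M"
    proof -
      have "cj u w \<otimes> inv w \<in> M" if "u \<in> V" for u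
      proof -
        have iu: "inv u \<in> V" using subgroup.m_inv_closed[OF V that] .
        have "cj u w \<otimes> inv w = inv (inv u) \<otimes> cj w (inv u)" using inv_cj[OF iu] Vc[OF that] by simp
        then show ?thesis unfolding M_def using iu by blast
      qed
      then show ?thesis by (auto simp: orb_def)
    qed
  qed
  moreover have "inj_on (\<lambda>t. t \<otimes> inv w) (orb V w)"
    using orb_subset[OF subgroup.subset[OF V] w(1)] w by (auto simp: inj_on_def subset_iff)
  ultimately show cM: "card M = card (orb V w)" by (simp add: card_image)
  \<comment> \<open>Such a \<open>c\<close> commutes with \<open>w\<close>, and
    \<open>c \<otimes> w\<close> is a conjugate of \<open>w\<close>. Since \<open>a\<close> kills
    \<open>c\<close> and \<open>b\<close> kills \<open>w\<close>, it is trivial.\<close>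
  have triv: "c = \<one>" if c: "c \<in> M" "c \<in> centralizer w" for c
  proof -
    obtain u where u: "u \<in> V" "c = inv u \<otimes> cj w u" using c by (auto simp: M_def)
    have cc: "c \<in> V" "c \<in> carrier G" using c(1) MV Vc by auto
    have cw: "c \<otimes> w = w \<otimes> c" using c(2) by (simp add: centralizer_def)
    have "cj (inv u) w = c \<otimes> w"
      using u(2) inv_cj[OF u(1)] w Vc[OF u(1)] by (simp add: m_assoc)
    with cw have "cj (inv u) w = w \<otimes> c" by simp
    then show ?thesis
      using commutator_trivial[OF inv_closed[OF Vc[OF u(1)]] w(1) cc(2) _ cw w(2) Va[rule_format, OF cc(1)]]
        coprime_ab by (simp only: coprime_commute)
  qed
  have "\<one> \<in> M \<inter> centralizer w"
    using subgroup.one_closed[OF M] subgroup.one_closed[OF subgroup_centralizer[OF w(1)]] by blast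
  with triv show "M \<inter> centralizer w = {\<one>}" by blast
  let ?C = "V \<inter> centralizer w"
  have Cw: "subgroup (centralizer w) G" by (rule subgroup_centralizer[OF w(1)])
  \<comment> \<open>Injectivity comes from the trivial intersection; surjectivity onto
    \<open>V\<close> then follows from orbit counting,
    \<open>card ?C * card M = card V\<close>.\<close>
  have "inj_on (\<lambda>(v, t). v \<otimes> t) (?C \<times> M)"
  proof (rule inj_onI, clarify)
    fix v t v' t' assume vt: "v \<in> V" "v \<in> centralizer w" "t \<in> M" "v' \<in> V" "v' \<in> centralizer w" "t' \<in> M"
      and eq: "v \<otimes> t = v' \<otimes> t'"
    have car: "v \<in> carrier G" "v' \<in> carrier G" "t \<in> carrier G" "t' \<in> carrier G"
      using vt MV Vc by auto
    have "inv v' \<otimes> v \<otimes> t = inv v' \<otimes> (v' \<otimes> t')" using eq car by (simp add: m_assoc)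
    then have "inv v' \<otimes> v \<otimes> t = t'" using car by simp
    then have "inv v' \<otimes> v = t' \<otimes> inv t" using car inv_solve_right[of "inv v' \<otimes> v" t' t] by simp
    moreover have "inv v' \<otimes> v \<in> centralizer w"
      using vt(2,5) subgroup.m_closed[OF Cw] subgroup.m_inv_closed[OF Cw] by blast
    moreover have "t' \<otimes> inv t \<in> M"
      using vt(3,6) subgroup.m_closed[OF M] subgroup.m_inv_closed[OF M] by blast
    ultimately have 1: "t' \<otimes> inv t = \<one>" "inv v' \<otimes> v = \<one>" using triv by auto
    show "v = v' \<and> t = t'"
      using 1 car inv_equality[of "t'" "inv t"] inv_equality[of "inv v'" v] by auto
  qed
  then have "card ((\<lambda>(v, t). v \<otimes> t) ` (?C \<times> M)) = card ?C * card M"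
    by (simp add: card_image card_cartesian_product)
  also have "\<dots> = card V" using card_orb[OF V w(1)] cM by (simp add: mult.commute)
  finally have "(\<lambda>(v, t). v \<otimes> t) ` (?C \<times> M) = V"
    using MV V by (intro card_subset_eq finite_subgroup) (auto intro: subgroup.m_closed)
  then show "\<forall>y \<in> V. \<exists>v \<in> ?C. \<exists>t \<in> M. y = v \<otimes> t" by fastforce
qed

end

section \<open>Coprime largest class sizes\<close>

locale coprime_largest_class_sizes = coprime_split +
  fixes m n :: nat
  assumes largest: "two_largest (noncentral_class_sizes G) m n"
    and n_dvd_a: "n dvd a" and coprime_m_a: "coprime m a"
begin

lemma m_less_n: "m < n"
  using largest by (simp add: two_largest_def)

lemma m_gt_1: "m > 1"
proof -
  have "m \<in> class_sizes G" "m \<noteq> 1"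
    using largest by (auto simp: two_largest_def noncentral_class_sizes_def)
  then show ?thesis using csize_pos by (force simp: class_sizes_eq)
qed

lemma n_gt_1: "n > 1" using m_gt_1 m_less_n by simp

lemma exists_csize_m: obtains y where "y \<in> carrier G" "csize y = m"
  using largest by (auto simp: two_largest_def noncentral_class_sizes_def class_sizes_eq)

lemma exists_csize_n: obtains x where "x \<in> carrier G" "csize x = n"
  using largest by (auto simp: two_largest_def noncentral_class_sizes_def class_sizes_eq)

lemma csize_cases:
  assumes "y \<in> carrier G" "y \<notin> centre G"
  obtains "csize y = m" | "csize y = n" | "1 < csize y" "csize y < m"
proof -
  have "csize y \<in> noncentral_class_sizes G"
    using assms class_size_1_iff by (auto simp: noncentral_class_sizes_def class_sizes_eq)
  then have "csize y = n \<or> csize y \<le> m" using largest by (auto simp: two_largest_def)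
  moreover have "csize y > 1" using assms class_size_1_iff[of y] csize_pos[of y] by linarith
  ultimately show ?thesis using that by linarith
qed

lemma coprime_m_n: "coprime m n"
  using coprime_m_a n_dvd_a coprime_divisors[of m m n a] by simp

lemma coprime_b_n: "coprime b n"
  using coprime_ab n_dvd_a coprime_divisors[of b b n a] by (simp add: coprime_commute)

lemma m_dvd_b: "m dvd b"
proof -
  obtain y where "y \<in> carrier G" "csize y = m" by (rule exists_csize_m)
  then have "m dvd a * b" using card_class order_split by (metis dvd_triv_left)
  then show ?thesis using coprime_m_a by (simp add: coprime_dvd_mult_right_iff)
qed

lemma not_m_dvd_n: "\<not> m dvd n"
  using coprime_m_n m_gt_1 by (auto simp: coprime_absorb_left)

section \<open>Consequences of maximality\<close>

lemma csize_eq_m_or_n: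
  assumes y: "y \<in> carrier G" and ge: "m \<le> csize y"
  shows "csize y = m \<or> csize y = n"
proof -
  have "y \<notin> centre G" using class_size_1_iff[OF y] ge m_gt_1 by auto
  from csize_cases[OF y this] show ?thesis using ge by cases auto
qed

lemma csize_eq_m:
  assumes y: "y \<in> carrier G" and d: "m dvd csize y" shows "csize y = m"
  using csize_eq_m_or_n[OF y dvd_imp_le[OF d csize_pos[OF y]]] d not_m_dvd_n by auto

lemma csize_eq_n:
  assumes y: "y \<in> carrier G" and d: "n dvd csize y" shows "csize y = n"
  using csize_eq_m_or_n[OF y] dvd_imp_le[OF d csize_pos[OF y]] m_less_n by auto

text \<open>\<open>N\<close> is the centre of the stabilizer under left multiplication of a class of size \<open>n\<close>.\<close>

lemma commutator_subgroup_exists: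
  assumes y: "y \<in> carrier G" "csize y = m"
  obtains N where "N \<lhd> G" "card N dvd n"
    "\<forall>u \<in> N. \<forall>v \<in> N. u \<otimes> v = v \<otimes> u"
    "N \<subseteq> centralizer y" "\<forall>g \<in> carrier G. inv y \<otimes> cj g y \<in> N"
proof -
  obtain x where x: "x \<in> carrier G" "csize x = n" by (rule exists_csize_n)
  define S where "S = stab (orb (carrier G) x)"
  define N where "N = {s \<in> S. \<forall>t \<in> S. t \<in> centralizer s}"
  have Sn: "S \<lhd> G" unfolding S_def by (rule normal_stab_class[OF x(1)])
  have S: "subgroup S G" using Sn normal_imp_subgroup by auto
  have Sc: "\<And>s. s \<in> S \<Longrightarrow> s \<in> carrier G" using S subgroup.mem_carrier by metis
  have Sdvd: "card S dvd n"
    unfolding S_def x(2)[symmetric] using card_stab_dvd orb_subset x(1) by blast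
  have Ns: "subgroup N G"
  proof
    show "N \<subseteq> carrier G" using Sc by (auto simp: N_def)
    show "\<one> \<in> N" using S Sc by (auto simp: N_def mem_centralizer subgroup.one_closed)
    show "u \<otimes> v \<in> N" if "u \<in> N" "v \<in> N" for u v
      using that Sc centralizer_mult[of u v] S by (auto simp: N_def subgroup.m_closed)
    show "inv u \<in> N" if "u \<in> N" for u
      using that Sc S by (auto simp: N_def mem_centralizer cj_inv_right subgroup.m_inv_closed)
  qed
  have Nn: "N \<lhd> G"
  proof (rule normalI_cj[OF Ns])
    fix g s assume g: "g \<in> carrier G" and s: "s \<in> N"
    have "cj t (cj g s) = cj g s" if t: "t \<in> S" for t
    proof -
      have "cj (inv g) t \<in> S" using normal_cj[OF Sn _ t] g by simp
      then have "cj (cj (inv g) t) s = s" using s Sc by (auto simp: N_def mem_centralizer)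
      moreover have "cj t (cj g s) = cj g (cj (cj (inv g) t) s)"
        using g t s Sc by (simp add: N_def cj_def m_assoc inv_mult_group)
      ultimately show ?thesis by simp
    qed
    then show "cj g s \<in> N"
      using normal_cj[OF Sn g] s Sc g by (auto simp: N_def mem_centralizer)
  qed
  have cop: "coprime (card S) m"
    using coprime_divisors[OF Sdvd dvd_refl[of m]] coprime_m_n by (simp add: coprime_commute)
  \<comment> \<open>The order of \<open>S\<close> is prime to \<open>m\<close>, so \<open>S\<close>
    centralizes every element of class size \<open>m\<close>, in particular \<open>y\<close> and
    \<open>cj g y\<close>. Hence their quotient centralizes \<open>S\<close>; this is why it lands
    in the centre of \<open>S\<close>.\<close>
  have Sy: "S \<subseteq> centralizer y" if "y \<in> carrier G" "csize y = m" for y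
    using normal_centralizes_if_coprime[OF Sn that(1)] that(2) cop by simp
  have yN: "inv y \<otimes> cj g y \<in> N" if g: "g \<in> carrier G" for g
  proof -
    have yx: "coprime (csize y) (csize x)" using coprime_m_n x y by simp
    have "n \<le> csize (y \<otimes> x)" using class_size_le_class_size_mult[OF y(1) x(1) yx] x by simp
    then have "csize (y \<otimes> x) = n"
      using csize_eq_m_or_n[of "y \<otimes> x"] x y m_less_n by auto
    then have "inv y \<otimes> cj g y \<in> S"
      unfolding S_def using commutator_mem_stab[OF y(1) x(1) g yx] x by simp
    moreover have "t \<in> centralizer (inv y \<otimes> cj g y)" if t: "t \<in> S" for t
    proof -
      have "cj t y = y" "cj t (cj g y) = cj g y"
        using Sy[OF y] Sy[of "cj g y"] y g t csize_cj[OF g y(1)] by (auto simp: mem_centralizer)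
      then show ?thesis using Sc[OF t] y g by (simp add: mem_centralizer cj_mult_right cj_inv_right)
    qed
    ultimately show ?thesis by (simp add: N_def)
  qed
  show ?thesis
  proof (rule that[OF Nn])
    show "card N dvd n"
      using card_subgroup_dvd[OF Ns S] Sdvd by (auto simp: N_def intro: dvd_trans)
    show "N \<subseteq> centralizer y" using Sy[OF y] by (auto simp: N_def)
    show "\<forall>u \<in> N. \<forall>v \<in> N. u \<otimes> v = v \<otimes> u"
    proof (intro ballI)
      fix u v assume "u \<in> N" "v \<in> N"
      then have "v \<in> centralizer u" by (auto simp: N_def)
      then show "u \<otimes> v = v \<otimes> u" by (simp add: centralizer_def)
    qed
    show "\<forall>g \<in> carrier G. inv y \<otimes> cj g y \<in> N" using yN by blast
  qed
qed

text \<open>With \<open>c\<close> the commutator of \<open>y\<close> and \<open>g\<close>,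
  conjugation by \<open>g\<close> multiplies the \<open>b\<close>-part by \<open>c [^] eb\<close>.
  This factor commutes with the \<open>b\<close>-part and is killed by \<open>n\<close>, which is
  prime to \<open>b\<close>; so it is trivial.\<close>

lemma bpart_central_of_csize_m:
  assumes y: "y \<in> carrier G" "csize y = m"
  shows "bpart y \<in> centre G"
proof -
  obtain N where N: "N \<lhd> G" "card N dvd n" "\<forall>u \<in> N. \<forall>v \<in> N. u \<otimes> v = v \<otimes> u" "N \<subseteq> centralizer y"
    and yN: "\<forall>g \<in> carrier G. inv y \<otimes> cj g y \<in> N"
    by (rule commutator_subgroup_exists[OF y])
  have Ns: "subgroup N G" by (rule normal_imp_subgroup[OF N(1)])
  have "cj g (bpart y) = bpart y" if g: "g \<in> carrier G" for g
  proof -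
    define c where "c = inv y \<otimes> cj g y"
    have c: "c \<in> N" "c \<in> carrier G" "cj g y = y \<otimes> c"
      using yN g y by (simp_all add: c_def)
    have cy: "c \<otimes> y = y \<otimes> c" using c N(4) by (auto simp: centralizer_def)
    have cf: "c [^] eb \<in> N" using subgroup_pow_closed[OF Ns c(1)] .
    have 1: "cj g (bpart y) = bpart y \<otimes> c [^] eb"
      unfolding bpart_def using g y c cy by (simp add: cj_pow_right pow_mult_distrib)
    have 2: "c [^] eb \<otimes> bpart y = bpart y \<otimes> c [^] eb"
      unfolding bpart_def using cy c y by (metis group_commutes_pow nat_pow_closed)
    have "c [^] eb = \<one>"
      using commutator_trivial[of g "bpart y" "c [^] eb" b n] g y c 1 2 bpart_pow coprime_b_n
        pow_eq_one_of_card_dvd[OF Ns cf N(2)] by simp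
    then show ?thesis using 1 y by simp
  qed
  then show ?thesis using y by (simp add: mem_centre_cj)
qed

text \<open>The \<open>b\<close>-part is central, so the \<open>a\<close>-part alone determines the
  centralizer. Hence an element of class size \<open>m\<close> killed by \<open>a\<close> can always
  be chosen.\<close>

lemma apart_csize_m:
  assumes y: "y \<in> carrier G" "csize y = m"
  shows "csize (apart y) = m" "centralizer (apart y) = centralizer y"
proof -
  have "centralizer (bpart y) = carrier G"
    using bpart_central_of_csize_m[OF y] by (simp add: mem_centre)
  then show eq: "centralizer (apart y) = centralizer y"
    using centralizer_parts[OF y(1)] subgroup.subset[OF subgroup_centralizer[of "apart y"]] y by auto
  have "csize (apart y) dvd csize y" "csize y dvd csize (apart y)"
    using class_size_dvd[of y "apart y"] class_size_dvd[of "apart y" y] eq y by auto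
  then show "csize (apart y) = m" using y by (simp add: dvd_antisym)
qed

text \<open>With \<open>u\<close> the \<open>a\<close>-part of \<open>y\<close>, the class size of \<open>u w\<close> is a multiple of \<open>m\<close>, hence equal to \<open>m\<close>.\<close>

lemma b_element_central_of_commute_csize_m:
  assumes y: "y \<in> carrier G" "csize y = m" and w: "w \<in> centralizer y" "w [^] b = \<one>"
  shows "w \<in> centre G"
proof -
  define u where "u = apart y"
  have u: "u \<in> carrier G" "csize u = m" "u [^] a = \<one>" "w \<in> centralizer u"
    using apart_csize_m[OF y] apart_pow y w by (simp_all add: u_def)
  have wc: "w \<in> carrier G" and uw: "u \<otimes> w = w \<otimes> u" using u by (auto simp: centralizer_def)
  have "centralizer (u \<otimes> w) \<subseteq> centralizer u"
    using centralizer_mult_coprime[OF u(1,3) wc w(2) uw] by simp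
  then have "m dvd csize (u \<otimes> w)" using class_size_dvd[of "u \<otimes> w" u] u wc by simp
  then have "csize (u \<otimes> w) = m" using csize_eq_m u wc by simp
  then have "bpart (u \<otimes> w) \<in> centre G" using bpart_central_of_csize_m u wc by simp
  then show ?thesis using parts_mult[OF u(1,3) wc w(2) uw] by simp
qed

text \<open>Multiplication by \<open>w\<close> must not enlarge the class of \<open>y\<close>. The
  product has class size \<open>m\<close> or \<open>n\<close>, and \<open>n\<close> would have to
  divide \<open>csize w * m\<close>, hence \<open>csize w\<close>.\<close>

lemma commutator_mem_stab_csize_m:
  assumes y: "y \<in> carrier G" "csize y = m" and w: "w \<in> carrier G"
    and dvd: "csize w dvd n" and ne: "csize w \<noteq> n" and g: "g \<in> carrier G"
  shows "inv w \<otimes> cj g w \<in> stab (orb (carrier G) y)"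
proof -
  have cop: "coprime (csize w) (csize y)"
    using coprime_divisors[OF dvd dvd_refl[of m]] coprime_m_n y by (simp add: coprime_commute)
  have ge: "m \<le> csize (w \<otimes> y)" using class_size_le_class_size_mult[OF w y(1) cop] y by simp
  have "csize (w \<otimes> y) \<noteq> n"
  proof
    assume "csize (w \<otimes> y) = n"
    then have "n dvd csize w * m" using class_size_mult_dvd[OF w y(1) cop] y by simp
    then have "n dvd csize w" using coprime_m_n by (simp add: coprime_commute coprime_dvd_mult_left_iff)
    then show False using dvd ne dvd_antisym by blast
  qed
  then have "csize (w \<otimes> y) = m"
    using ge csize_eq_m_or_n[of "w \<otimes> y"] w y by auto
  then show ?thesis using commutator_mem_stab[OF w y(1) g cop] y by simp
qed

lemma card_stab_csize_m:
  assumes "y \<in> carrier G" "csize y = m"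
  shows "card (stab (orb (carrier G) y)) dvd m"
  using card_stab_dvd[of "orb (carrier G) y"] orb_subset assms by blast

text \<open>Otherwise, for \<open>y\<close> of class size \<open>m\<close>, the commutator \<open>[w, y]\<close> would lie both in the stabilizer of
  \<open>y\<^sup>G\<close>, whose order divides \<open>m\<close>, and in a normal subgroup of order dividing \<open>n\<close>.\<close>

lemma csize_bpart_of_csize_n:
  assumes x: "x \<in> carrier G" "csize x = n" and nc: "bpart x \<notin> centre G"
  shows "csize (bpart x) = n"
proof (rule ccontr)
  assume ne: "csize (bpart x) \<noteq> n"
  define w where "w = bpart x"
  have w: "w \<in> carrier G" "w [^] b = \<one>" "csize w dvd n" "csize w \<noteq> n"
    using x bpart_pow class_size_dvd[of x "bpart x"] centralizer_parts[of x] ne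
    by (auto simp: w_def)
  obtain y where y: "y \<in> carrier G" "csize y = m" by (rule exists_csize_m)
  obtain N where N: "N \<lhd> G" "card N dvd n" "\<forall>u \<in> N. \<forall>v \<in> N. u \<otimes> v = v \<otimes> u" "N \<subseteq> centralizer y"
    and yN: "\<forall>g \<in> carrier G. inv y \<otimes> cj g y \<in> N"
    by (rule commutator_subgroup_exists[OF y])
  let ?T = "stab (orb (carrier G) y)"
  define c where "c = inv w \<otimes> cj y w"
  have Ns: "subgroup N G" by (rule normal_imp_subgroup[OF N(1)])
  have T: "?T \<lhd> G" by (rule normal_stab_class[OF y(1)])
  have cT: "c \<in> ?T" unfolding c_def using commutator_mem_stab_csize_m[OF y w(1,3,4) y(1)] .
  \<comment> \<open>Conjugating this element by \<open>y\<close> gives \<open>c\<close>, so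
    normality puts \<open>c\<close> into \<open>N\<close> as well.\<close>
  have "inv y \<otimes> cj (inv w) y \<in> N" using yN w by simp
  then have "cj y (inv y \<otimes> cj (inv w) y) \<in> N" using normal_cj[OF N(1) y(1)] by simp
  moreover have "cj y (inv y \<otimes> cj (inv w) y) = c"
    unfolding c_def using y w by (simp add: cj_def m_assoc)
  ultimately have cN: "c \<in> N" by simp
  have "c = \<one>"
    using eq_one_of_coprime_pows[of c m n] coprime_m_n subgroup.mem_carrier[OF Ns cN]
      pow_eq_one_of_card_dvd[OF normal_imp_subgroup[OF T] cT card_stab_csize_m[OF y]]
      pow_eq_one_of_card_dvd[OF Ns cN N(2)] by simp
  moreover have "w \<otimes> c = cj y w" unfolding c_def using y w by simp
  ultimately have "cj y w = w" using w by simp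
  then have "w \<in> centralizer y" using mem_centralizer mem_centralizer_sym y w by blast
  then have "w \<in> centre G" using b_element_central_of_commute_csize_m[OF y] w by simp
  then show False using nc by (simp add: w_def)
qed

text \<open>Choose \<open>y\<close> of class size \<open>m\<close> in an abelian normal \<open>V\<close> and write \<open>y = v t\<close> with
  \<open>v \<in> C\<^sub>V(w)\<close> and \<open>t \<in> [V, w]\<close>. The centralizer of \<open>v w\<close> permutes \<open>[V, w]\<close>, so
  \<open>|C(v w)| \<le> |[V, w]| |C(y) \<inter> C(w)| \<le> |C(y)|\<close> and \<open>v w\<close> has class size at least \<open>m\<close>.
  This rules out all possible class sizes of \<open>v w\<close>.\<close>

lemma b_element_csize_not_less:
  assumes w: "w \<in> carrier G" "w [^] b = \<one>" "w \<notin> centre G"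
  shows "\<not> csize w < m"
proof
  assume less: "csize w < m"
  obtain y0 where y0: "y0 \<in> carrier G" "csize y0 = m" by (rule exists_csize_m)
  define y where "y = apart y0"
  have y: "y \<in> carrier G" "csize y = m" "y [^] a = \<one>"
    using apart_csize_m[OF y0] apart_pow y0 by (simp_all add: y_def)
  obtain N where N: "N \<lhd> G" "card N dvd n" "\<forall>u \<in> N. \<forall>v \<in> N. u \<otimes> v = v \<otimes> u"
    "N \<subseteq> centralizer y" "\<forall>g \<in> carrier G. inv y \<otimes> cj g y \<in> N"
    by (rule commutator_subgroup_exists[OF y(1,2)])
  have "\<forall>v \<in> N. v [^] a = \<one>"
    using pow_eq_one_of_card_dvd[OF normal_imp_subgroup[OF N(1)]] dvd_trans[OF N(2) n_dvd_a] by blast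
  note V = normal_adjoin[OF N(1) y(1,3) N(3,4) this N(5)]
  let ?V = "adjoin N y"
  have Vs: "subgroup ?V G" using V(1) normal_imp_subgroup by auto
  have Vc: "\<And>v. v \<in> ?V \<Longrightarrow> v \<in> carrier G" using Vs subgroup.mem_carrier by metis
  have wV: "\<forall>v \<in> ?V. cj w v \<in> ?V" using normal_cj[OF V(1) w(1)] by blast
  define M where "M = (\<lambda>u. inv u \<otimes> cj w u) ` ?V"
  note split = coprime_action_split[OF Vs V(5,6) w(1,2) wV, folded M_def]
  obtain v t where v: "v \<in> ?V" "v \<in> centralizer w" and t: "t \<in> M" and vt: "y = v \<otimes> t"
    using split(5) V(3) by blast
  have car: "v \<in> carrier G" "t \<in> carrier G" using v t split(2) Vc by auto
  have va: "v [^] a = \<one>" and vw: "v \<otimes> w = w \<otimes> v" using V(5) v by (auto simp: centralizer_def)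
  let ?H = "centralizer v \<inter> centralizer w"
  have H: "subgroup ?H G" using subgroups_Inter_pair subgroup_centralizer car w by blast
  have CH: "centralizer (v \<otimes> w) = ?H"
    using centralizer_mult_coprime[OF car(1) va w(1,2) vw] .
  have bp: "bpart (v \<otimes> w) = w" using parts_mult[OF car(1) va w(1,2) vw] by simp
  have vwc: "v \<otimes> w \<in> carrier G" using car w by simp
  \<comment> \<open>The \<open>b\<close>-part of \<open>v \<otimes> w\<close> is the noncentral
    \<open>w\<close>, which excludes class sizes 1 and \<open>m\<close>; class size \<open>n\<close>
    would give \<open>csize w = n\<close>, against \<open>csize w < m\<close>.\<close>
  have "csize (v \<otimes> w) < m"
  proof -
    have "v \<otimes> w \<notin> centre G"
      using bpart_mem[OF subgroup_centre, of "v \<otimes> w"] bp w(3) by auto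
    moreover have "csize (v \<otimes> w) \<noteq> n"
      using csize_bpart_of_csize_n[OF vwc] bp w(3) less m_less_n by auto
    moreover have "csize (v \<otimes> w) \<noteq> m"
      using bpart_central_of_csize_m[OF vwc] bp w(3) by auto
    ultimately show ?thesis using csize_cases[OF vwc] by blast
  qed
  moreover have "csize (v \<otimes> w) * card ?H = m * card (centralizer y)"
    using card_class[OF vwc] card_class[OF y(1)] CH y(2) by simp
  ultimately have big: "card (centralizer y) < card ?H"
    using mult_le_mono2[of "card ?H" "card (centralizer y)" m] mult_less_mono1[of _ m "card ?H"]
      card_subgroup_pos[OF H] by (metis leD not_le)
  have "orb ?H t \<subseteq> M"
  proof -
    obtain u where u: "u \<in> ?V" "t = inv u \<otimes> cj w u" using t by (auto simp: M_def)
    have "cj h t \<in> M" if h: "h \<in> ?H" for h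
    proof -
      have hc: "h \<in> carrier G" "h \<otimes> w = w \<otimes> h" using h by (auto simp: centralizer_def)
      have "cj h (cj w u) = cj w (cj h u)"
        using hc w(1) Vc[OF u(1)] by (simp flip: cj_mult_left)
      then have "cj h t = inv (cj h u) \<otimes> cj w (cj h u)"
        using hc w u Vc by (simp add: cj_mult_right cj_inv_right)
      then show ?thesis unfolding M_def using normal_cj[OF V(1) hc(1) u(1)] by blast
    qed
    then show ?thesis by (auto simp: orb_def)
  qed
  then have orbH: "card (orb ?H t) \<le> card (orb ?V w)"
    using card_mono[OF finite_subgroup[OF split(1)]] split(3) by metis
  have "?H \<inter> centralizer t \<subseteq> centralizer y \<inter> centralizer w"
    using centralizer_mult[OF car] vt by auto
  then have "card (?H \<inter> centralizer t) \<le> card (centralizer y \<inter> centralizer w)"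
    using finite_subgroup[OF subgroup_centralizer[OF y(1)]] by (intro card_mono) auto
  then have "card ?H \<le> card (orb ?V w) * card (centralizer y \<inter> centralizer w)"
    using mult_le_mono[OF orbH] card_orb[OF H car(2)] by metis
  also have "\<dots> \<le> card (orb (centralizer y) w) * card (centralizer y \<inter> centralizer w)"
    using orb_mono[OF V(4)] finite_orb[OF subgroup_centralizer[OF y(1)]]
    by (intro mult_le_mono1 card_mono) auto
  also have "\<dots> = card (centralizer y)" using card_orb[OF subgroup_centralizer[OF y(1)] w(1)] .
  finally show False using big by simp
qed

lemma csize_b_element:
  assumes w: "w \<in> carrier G" "w [^] b = \<one>" "w \<notin> centre G"
  shows "csize w = n"
proof -
  have "csize w \<noteq> m" using bpart_central_of_csize_m[OF w(1)] b_elt_parts[OF w(1,2)] w(3) by auto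
  then show ?thesis using csize_cases[OF w(1,3)] b_element_csize_not_less[OF w] by blast
qed

text \<open>The index of the centre is a multiple of \<open>m\<close>, whose primes divide
  \<open>b\<close>. Such an \<open>x\<close> later defines the complement
  \<open>centralizer x\<close>.\<close>

lemma b_element_exists: obtains x where "x \<in> carrier G" "x [^] b = \<one>" "x \<notin> centre G"
proof -
  obtain y where y: "y \<in> carrier G" "csize y = m" by (rule exists_csize_m)
  obtain j where j: "card (centralizer y) = card (centre G) * j"
    using card_subgroup_dvd[OF subgroup_centre subgroup_centralizer[OF y(1)]]
      centre_subset_centralizer[OF y(1)] by (auto elim: dvdE)
  have "card (carrier G) = card (centre G) * (m * j)"
    using card_class[OF y(1)] y(2) j by (simp add: order_def ac_simps)
  moreover obtain q where "prime q" "q dvd m" using m_gt_1 prime_factor_nat[of m] by auto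
  ultimately show ?thesis
    using noncentral_b_element_exists[OF subgroup_self subgroup_centre, of "m * j" q] m_dvd_b that
    by (auto intro: dvd_trans)
qed

text \<open>For \<open>v\<close> in \<open>centralizer x\<close> killed by \<open>a\<close>, the
  class size of \<open>v \<otimes> x\<close> is a multiple of \<open>n\<close>, hence
  \<open>n\<close>, which forces \<open>centralizer x \<subseteq> centralizer v\<close>. So
  \<open>csize u\<close> divides \<open>n\<close>; equality and proper divisors need different
  arguments.\<close>

lemma a_element_central_of_commute:
  assumes x: "x \<in> carrier G" "x [^] b = \<one>" "x \<notin> centre G" and u: "u \<in> centralizer x" "u [^] a = \<one>"
  shows "u \<in> centre G"
proof (rule ccontr)
  assume nc: "u \<notin> centre G"
  have cx: "csize x = n" using csize_b_element[OF x] .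
  have C: "subgroup (centralizer x) G" by (rule subgroup_centralizer[OF x(1)])
  have sub: "centralizer x \<subseteq> centralizer v" if v: "v \<in> centralizer x" "v [^] a = \<one>" for v
  proof -
    have vc: "v \<in> carrier G" "v \<otimes> x = x \<otimes> v" using v by (auto simp: centralizer_def)
    have eq: "centralizer (v \<otimes> x) = centralizer v \<inter> centralizer x"
      using centralizer_mult_coprime[OF vc(1) v(2) x(1,2) vc(2)] .
    have "n dvd csize (v \<otimes> x)" using class_size_dvd[of "v \<otimes> x" x] eq x vc cx by simp
    then have "csize (v \<otimes> x) = n" using csize_eq_n x vc by simp
    then have "centralizer (v \<otimes> x) = centralizer x"
      using centralizer_eqI[of "v \<otimes> x" x] eq x vc cx by simp
    then show ?thesis using eq by auto
  qed
  have uc: "u \<in> carrier G" using u by (simp add: centralizer_def)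
  obtain y where y: "y \<in> carrier G" "csize y = m" by (rule exists_csize_m)
  have ud: "csize u dvd n" using class_size_dvd[OF x(1) uc sub[OF u]] cx by simp
  show False
  proof (cases "csize u = n")
    case True
    then have eq: "centralizer x = centralizer u"
      using centralizer_eqI[OF x(1) uc sub[OF u]] cx by simp
    let ?U = "{v \<in> centralizer x. v [^] a = \<one>}"
    have Uc: "v \<in> carrier G" if "v \<in> ?U" for v using that subgroup.subset[OF C] by auto
    have commU: "v \<otimes> v' = v' \<otimes> v" if "v \<in> ?U" "v' \<in> centralizer x" for v v'
      using sub[of v] that by (auto simp: centralizer_def[of v])
    have U: "subgroup ?U G"
    proof
      show "?U \<subseteq> carrier G" using Uc by blast
      show "\<one> \<in> ?U" using C subgroup.one_closed by auto
      show "v \<otimes> v' \<in> ?U" if "v \<in> ?U" "v' \<in> ?U" for v v'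
        using that commU[of v v'] Uc C by (auto simp: pow_mult_distrib subgroup.m_closed)
      show "inv v \<in> ?U" if "v \<in> ?U" for v
        using that Uc[OF that] C by (auto simp: nat_pow_inv subgroup.m_inv_closed)
    qed
    have "cj c v \<in> ?U" if "c \<in> centralizer x" "v \<in> ?U" for c v
    proof -
      have "c \<in> carrier G" using that subgroup.subset[OF C] by auto
      then have "cj c v = v" using commU[OF that(2,1)] Uc[OF that(2)] cj_eq_iff_commute[of c v] by simp
      then show ?thesis using that by simp
    qed
    moreover have "coprime (card ?U) m"
      using coprime_card_if_exponent[OF U, of a m] coprime_m_a by (simp add: coprime_commute)
    \<comment> \<open>This orbit has length \<open>m\<close>, prime to \<open>card ?U\<close>, so
      \<open>?U\<close> centralizes \<open>y\<close>. Then \<open>y\<close> commutes with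
      \<open>u\<close>, hence with \<open>x\<close>, and \<open>x\<close> would be central.\<close>
    moreover have "orb (centralizer x) y = orb (carrier G) y"
      using orb_centralizer_coprime[OF x(1) y(1)] coprime_m_n cx y(2) by (simp add: coprime_commute)
    ultimately have "?U \<subseteq> centralizer y"
      using centralizes_if_coprime[OF U C y(1)] y(2) by auto
    then have "u \<in> centralizer y" using u by auto
    then have "y \<in> centralizer x" using eq mem_centralizer_sym y uc by blast
    then have "x \<in> centralizer y" using mem_centralizer_sym y x by blast
    then show False using b_element_central_of_commute_csize_m[OF y _ x(2)] x(3) by simp
  next
    case False
    \<comment> \<open>Commutators with \<open>u\<close> lie in this stabilizer. It centralizes
      \<open>u\<close> and its order is prime to \<open>a\<close>, so they vanish.\<close>
    let ?T = "stab (orb (carrier G) y)"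
    have T: "?T \<lhd> G" by (rule normal_stab_class[OF y(1)])
    have Tm: "card ?T dvd m" by (rule card_stab_csize_m[OF y])
    have "coprime (card ?T) (csize u)"
      using coprime_divisors[OF Tm ud] coprime_m_n by simp
    then have Tu: "?T \<subseteq> centralizer u" using normal_centralizes_if_coprime[OF T uc] by simp
    have "cj g u = u" if g: "g \<in> carrier G" for g
    proof -
      define c where "c = inv u \<otimes> cj g u"
      have c: "c \<in> ?T" "c \<in> carrier G" "cj g u = u \<otimes> c"
        using commutator_mem_stab_csize_m[OF y uc ud False g] g uc by (simp_all add: c_def)
      have "c [^] m = \<one>"
        using pow_eq_one_of_card_dvd[OF normal_imp_subgroup[OF T] c(1) Tm] .
      moreover have "c \<otimes> u = u \<otimes> c" using c(1) Tu by (auto simp: centralizer_def)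
      ultimately have "c = \<one>"
        using commutator_trivial[OF g uc c(2,3), of a m] u coprime_m_a by (simp add: coprime_commute)
      then show ?thesis using c uc by simp
    qed
    then show False using nc uc by (simp add: mem_centre_cj)
  qed
qed

text \<open>The \<open>a\<close>-part of a common element is central since it commutes with
  \<open>x\<close>, the \<open>b\<close>-part since it commutes with \<open>y\<close>.\<close>

lemma centralizer_inter_eq_centre:
  assumes x: "x \<in> carrier G" "x [^] b = \<one>" "x \<notin> centre G" and y: "y \<in> carrier G" "csize y = m"
  shows "centralizer x \<inter> centralizer y = centre G"
proof
  show "centre G \<subseteq> centralizer x \<inter> centralizer y"
    using centre_subset_centralizer x y by blast
  show "centralizer x \<inter> centralizer y \<subseteq> centre G"
  proof
    fix g assume g: "g \<in> centralizer x \<inter> centralizer y"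
    then have gc: "g \<in> carrier G" by (simp add: centralizer_def)
    have "apart g \<in> centralizer x"
      using g apart_mem[OF subgroup_centralizer[OF x(1)]] by blast
    then have "apart g \<in> centre G"
      using a_element_central_of_commute[OF x] apart_pow[OF gc] by blast
    moreover have "bpart g \<in> centralizer y"
      using g bpart_mem[OF subgroup_centralizer[OF y(1)]] by blast
    then have "bpart g \<in> centre G"
      using b_element_central_of_commute_csize_m[OF y] bpart_pow[OF gc] by blast
    ultimately show "g \<in> centre G" using mem_centre_of_parts gc by blast
  qed
qed

lemma orb_centralizer_b_element:
  assumes x: "x \<in> carrier G" "x [^] b = \<one>" "x \<notin> centre G" and y: "y \<in> carrier G" "csize y = m"
  shows "orb (centralizer y) x = orb (carrier G) x"
  using orb_centralizer_coprime[OF y(1) x(1)] coprime_m_n y csize_b_element[OF x] by simp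

lemma card_centralizer_csize_m:
  assumes y: "y \<in> carrier G" "csize y = m"
  shows "card (centralizer y) = n * card (centre G)"
proof -
  obtain x where x: "x \<in> carrier G" "x [^] b = \<one>" "x \<notin> centre G" by (rule b_element_exists)
  have "card (orb (centralizer y) x) * card (centralizer y \<inter> centralizer x) = card (centralizer y)"
    using card_orb[OF subgroup_centralizer[OF y(1)] x(1)] .
  then show ?thesis
    using centralizer_inter_eq_centre[OF x y] orb_centralizer_b_element[OF x y] csize_b_element[OF x]
    by (simp add: Int_commute)
qed

lemma order_eq: "order G = m * n * card (centre G)"
proof -
  obtain y where y: "y \<in> carrier G" "csize y = m" by (rule exists_csize_m)
  show ?thesis using card_class[OF y(1)] card_centralizer_csize_m[OF y] y(2) by simp
qed

lemma card_centralizer_csize_n: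
  assumes x: "x \<in> carrier G" "csize x = n"
  shows "card (centralizer x) = m * card (centre G)"
proof -
  have "n * card (centralizer x) = order G" using card_class[OF x(1)] x(2) by simp
  also have "\<dots> = n * (m * card (centre G))" by (simp add: order_eq)
  finally show ?thesis using n_gt_1 by auto
qed

text \<open>Since \<open>|C(g)| |C(x)| > |G| |Z(G)|\<close>, some noncentral element centralizes both \<open>g\<close> and \<open>x\<close>.\<close>

lemma csize_not_less:
  assumes g: "g \<in> carrier G" "g \<notin> centre G" shows "\<not> csize g < m"
proof
  assume less: "csize g < m"
  obtain x where x: "x \<in> carrier G" "x [^] b = \<one>" "x \<notin> centre G" by (rule b_element_exists)
  obtain y where y: "y \<in> carrier G" "csize y = m" by (rule exists_csize_m)
  have bp: "bpart g \<in> centre G"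
  proof (rule ccontr)
    assume "bpart g \<notin> centre G"
    then have "csize (bpart g) = n" using csize_b_element[of "bpart g"] bpart_pow g by simp
    moreover have "csize (bpart g) dvd csize g"
      using class_size_dvd[of g "bpart g"] centralizer_parts[OF g(1)] g by simp
    ultimately have "n \<le> csize g" using csize_pos[OF g(1)] by (auto dest: dvd_imp_le)
    then show False using less m_less_n by simp
  qed
  have "csize g * card (centralizer g) = m * card (centralizer y)"
    using card_class[OF g(1)] card_class[OF y(1)] y(2) by simp
  then have big: "card (centralizer y) < card (centralizer g)"
    using less card_subgroup_pos[OF subgroup_centralizer[OF g(1)]]
      mult_le_mono2[of "card (centralizer g)" "card (centralizer y)" m]
      mult_less_mono1[of "csize g" m "card (centralizer g)"] by linarith
  let ?I = "centralizer g \<inter> centralizer x"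
  have "\<not> ?I \<subseteq> centre G"
  proof
    assume "?I \<subseteq> centre G"
    then have I: "card ?I \<le> card (centre G)"
      using card_mono[OF finite_subgroup[OF subgroup_centre]] by blast
    have "card (orb (centralizer g) x) \<le> n"
      using card_mono[OF finite_orb[OF subgroup_self], of "orb (centralizer g) x" x]
        orb_mono[OF subgroup.subset[OF subgroup_centralizer[OF g(1)]]] csize_b_element[OF x] by auto
    then have "card (centralizer g) \<le> n * card (centre G)"
      using mult_le_mono[OF _ I] card_orb[OF subgroup_centralizer[OF g(1)] x(1)] by metis
    then show False using big card_centralizer_csize_m[OF y] by simp
  qed
  then obtain h where h: "h \<in> centralizer g" "h \<in> centralizer x" "h \<notin> centre G" by blast
  have hc: "h \<in> carrier G" using h mem_centralizer_closed by blast
  have "apart h \<in> centre G"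
    using a_element_central_of_commute[OF x] apart_mem[OF subgroup_centralizer[OF x(1)] h(2)]
      apart_pow[OF hc] by blast
  \<comment> \<open>This noncentral element killed by \<open>b\<close> commutes with
    \<open>apart g\<close>, which is therefore central; together with \<open>bp\<close> this makes
    \<open>g\<close> central.\<close>
  then have w: "bpart h \<notin> centre G" using mem_centre_of_parts[OF hc] h(3) by blast
  have "bpart h \<in> centralizer g" using bpart_mem[OF subgroup_centralizer[OF g(1)] h(1)] .
  then have "bpart h \<in> centralizer (apart g)" using centralizer_parts[OF g(1)] by blast
  then have "apart g \<in> centralizer (bpart h)" using mem_centralizer_sym g hc by simp
  then have "apart g \<in> centre G"
    using a_element_central_of_commute[of "bpart h" "apart g"] w hc g apart_pow bpart_pow by simp
  then show False using mem_centre_of_parts[OF g(1) _ bp] g(2) by blast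
qed

lemma csize_cases_noncentral:
  assumes "g \<in> carrier G" "g \<notin> centre G" shows "csize g = m \<or> csize g = n"
  using csize_cases[OF assms] csize_not_less[OF assms] by blast

lemma class_sizes_eq_1_m_n: "class_sizes G = {1, m, n}"
proof
  show "class_sizes G \<subseteq> {1, m, n}"
    unfolding class_sizes_eq using csize_cases_noncentral class_size_1_iff by fastforce
  have "csize \<one> = 1" using class_size_1_iff[of \<one>] subgroup.one_closed[OF subgroup_centre] by simp
  then have "1 \<in> class_sizes G" unfolding class_sizes_eq by (metis image_eqI one_closed)
  then show "{1, m, n} \<subseteq> class_sizes G"
    using largest by (simp add: two_largest_def noncentral_class_sizes_def)
qed

text \<open>It suffices that \<open>apart g\<close> commutes with some noncentral element killed by
  \<open>b\<close>. If \<open>bpart g\<close> is central, \<open>centralizer g\<close> contains one,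
  because the centre has index \<open>m\<close> in it.\<close>

lemma apart_central_of_csize_n:
  assumes g: "g \<in> carrier G" "csize g = n"
  shows "apart g \<in> centre G"
proof (cases "bpart g \<in> centre G")
  case False
  have "apart g \<in> centralizer (bpart g)"
    using parts_commute[OF g(1)] g by (simp add: centralizer_def)
  then show ?thesis
    using a_element_central_of_commute[of "bpart g"] False g apart_pow bpart_pow by simp
next
  case True
  obtain q where q: "prime q" "q dvd m" using m_gt_1 prime_factor_nat[of m] by auto
  have "card (centralizer g) = card (centre G) * m"
    using card_centralizer_csize_n[OF g] by simp
  then obtain w where w: "w \<in> centralizer g" "w [^] b = \<one>" "w \<notin> centre G"
    using noncentral_b_element_exists[OF subgroup_centralizer[OF g(1)] subgroup_centre _ q(1)]
      q m_dvd_b dvd_trans by blast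
  have wc: "w \<in> carrier G" using w mem_centralizer_closed by blast
  have "w \<in> centralizer (apart g)" using w(1) centralizer_parts[OF g(1)] by blast
  then have "apart g \<in> centralizer w" using mem_centralizer_sym wc g by simp
  then show ?thesis using a_element_central_of_commute[OF wc w(2,3)] apart_pow g by simp
qed

text \<open>The \<open>a\<close>-part of \<open>z\<close> lies in an abelian normal subgroup of
  order prime to \<open>csize y\<close>, which therefore centralizes \<open>y\<close>; the
  \<open>b\<close>-part is central.\<close>

lemma commute_of_csize_m:
  assumes y: "y \<in> carrier G" "csize y = m" and z: "z \<in> carrier G" "csize z = m"
  shows "z \<in> centralizer y"
proof -
  let ?u = "apart z"
  have u: "?u \<in> carrier G" "csize ?u = m" "?u [^] a = \<one>"
    using apart_csize_m[OF z] apart_pow z by simp_all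
  obtain N where N: "N \<lhd> G" "card N dvd n" "\<forall>u \<in> N. \<forall>v \<in> N. u \<otimes> v = v \<otimes> u"
    "N \<subseteq> centralizer ?u" "\<forall>g \<in> carrier G. inv ?u \<otimes> cj g ?u \<in> N"
    by (rule commutator_subgroup_exists[OF u(1,2)])
  have "\<forall>v \<in> N. v [^] a = \<one>"
    using pow_eq_one_of_card_dvd[OF normal_imp_subgroup[OF N(1)]] dvd_trans[OF N(2) n_dvd_a] by blast
  note V = normal_adjoin[OF N(1) u(1,3) N(3,4) this N(5)]
  have "coprime (card (adjoin N ?u)) m"
    using coprime_card_if_exponent[OF normal_imp_subgroup[OF V(1)], of a m] V(5) coprime_m_a
    by (simp add: coprime_commute)
  then have "?u \<in> centralizer y"
    using normal_centralizes_if_coprime[OF V(1) y(1)] y(2) V(3) by auto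
  moreover have "bpart z \<in> centralizer y"
    using bpart_central_of_csize_m[OF z] centre_subset_centralizer[OF y(1)] by blast
  ultimately have "apart z \<otimes> bpart z \<in> centralizer y"
    by (rule subgroup.m_closed[OF subgroup_centralizer[OF y(1)]])
  then show ?thesis using apart_mult_bpart[OF z(1)] by simp
qed

text \<open>In the end \<open>F\<close> turns out to be \<open>K Z(G)\<close> and \<open>Fa\<close> to be the Frobenius kernel \<open>K\<close> itself.\<close>

definition F :: "'a set"
  where "F = {g \<in> carrier G. csize g = 1 \<or> csize g = m}"

text \<open>Elements of \<open>centralizer y\<close> have central \<open>b\<close>-part. One of
  class size \<open>n\<close> would also have central \<open>a\<close>-part, so only sizes 1 and
  \<open>m\<close> occur. This makes \<open>F\<close> a subgroup.\<close>

lemma F_eq_centralizer: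
  assumes y: "y \<in> carrier G" "csize y = m" shows "F = centralizer y"
proof
  show "F \<subseteq> centralizer y"
    using commute_of_csize_m[OF y] centre_subset_centralizer[OF y(1)] class_size_1_iff
    by (auto simp: F_def)
  show "centralizer y \<subseteq> F"
  proof
    fix g assume g: "g \<in> centralizer y"
    have gc: "g \<in> carrier G" using g mem_centralizer_closed by blast
    have bp: "bpart g \<in> centre G"
      using b_element_central_of_commute_csize_m[OF y bpart_mem[OF subgroup_centralizer[OF y(1)] g]]
        bpart_pow[OF gc] by blast
    have "g \<in> centre G" if "csize g = n"
      using apart_central_of_csize_n[OF gc that] mem_centre_of_parts[OF gc] bp by blast
    then show "g \<in> F" using csize_cases_noncentral[OF gc] class_size_1_iff[OF gc] gc by (auto simp: F_def)
  qed
qed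

lemma subgroup_F: "subgroup F G"
proof -
  obtain y where y: "y \<in> carrier G" "csize y = m" by (rule exists_csize_m)
  show ?thesis unfolding F_eq_centralizer[OF y] by (rule subgroup_centralizer[OF y(1)])
qed

lemma F_closed: "f \<in> F \<Longrightarrow> f \<in> carrier G"
  by (simp add: F_def)

lemma F_commute:
  assumes "f \<in> F" "g \<in> F" shows "f \<otimes> g = g \<otimes> f"
proof (cases "csize g = 1")
  case True
  then show ?thesis using assms class_size_1_iff by (auto simp: F_def centre_def)
next
  case False
  then have "f \<in> centralizer g" using F_eq_centralizer[of g] assms by (auto simp: F_def)
  then show ?thesis by (simp add: centralizer_def)
qed

lemma normal_F: "F \<lhd> G"
  by (rule normalI_cj[OF subgroup_F]) (auto simp: F_def csize_cj)

lemma centre_subset_F: "centre G \<subseteq> F"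
  using class_size_1_iff by (auto simp: F_def centre_def)

lemma bpart_F: "f \<in> F \<Longrightarrow> bpart f \<in> centre G"
  using bpart_central_of_csize_m[of f] bpart_mem[OF subgroup_centre, of f] class_size_1_iff
  by (auto simp: F_def)

definition Fa :: "'a set"
  where "Fa = {f \<in> F. f [^] a = \<one>}"

lemma Fa_closed: "f \<in> Fa \<Longrightarrow> f \<in> carrier G"
  by (simp add: Fa_def F_closed)

lemma subgroup_Fa: "subgroup Fa G"
proof
  show "Fa \<subseteq> carrier G" using Fa_closed by blast
  show "\<one> \<in> Fa" using subgroup.one_closed[OF subgroup_F] by (simp add: Fa_def)
  show "u \<otimes> v \<in> Fa" if "u \<in> Fa" "v \<in> Fa" for u v
    using that F_commute[of u v] subgroup.m_closed[OF subgroup_F] F_closed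
    by (auto simp: Fa_def pow_mult_distrib)
  show "inv u \<in> Fa" if "u \<in> Fa" for u
    using that subgroup.m_inv_closed[OF subgroup_F] F_closed by (auto simp: Fa_def nat_pow_inv)
qed

lemma normal_Fa: "Fa \<lhd> G"
proof (rule normalI_cj[OF subgroup_Fa])
  show "cj g f \<in> Fa" if "g \<in> carrier G" "f \<in> Fa" for g f
    using that normal_cj[OF normal_F, of g f] cj_pow_right[of g f a] F_closed by (auto simp: Fa_def)
qed

lemma comm_group_Fa: "comm_group (G\<lparr>carrier := Fa\<rparr>)"
proof (rule group.group_comm_groupI[OF subgroup_imp_group[OF subgroup_Fa]])
  fix u v assume "u \<in> carrier (G\<lparr>carrier := Fa\<rparr>)" "v \<in> carrier (G\<lparr>carrier := Fa\<rparr>)"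
  then show "u \<otimes>\<^bsub>G\<lparr>carrier := Fa\<rparr>\<^esub> v = v \<otimes>\<^bsub>G\<lparr>carrier := Fa\<rparr>\<^esub> u"
    using F_commute by (simp add: Fa_def)
qed

lemma apart_Fa: "f \<in> F \<Longrightarrow> apart f \<in> Fa"
  using apart_mem[OF subgroup_F] apart_pow F_closed by (simp add: Fa_def)

lemma F_inter_centralizer:
  assumes x: "x \<in> carrier G" "x [^] b = \<one>" "x \<notin> centre G"
  shows "F \<inter> centralizer x = centre G"
proof -
  obtain y where y: "y \<in> carrier G" "csize y = m" by (rule exists_csize_m)
  show ?thesis
    using centralizer_inter_eq_centre[OF x y] F_eq_centralizer[OF y] by auto
qed

text \<open>A Frattini argument: \<open>F\<close> is transitive on the class of \<open>x\<close>, so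
  \<open>G\<close> is the product of \<open>F\<close> and \<open>centralizer x\<close>. The
  \<open>b\<close>-part of the factor in \<open>F\<close> is central and moves to the other
  side.\<close>

lemma decompose:
  assumes x: "x \<in> carrier G" "x [^] b = \<one>" "x \<notin> centre G" and g: "g \<in> carrier G"
  obtains f h where "f \<in> Fa" "h \<in> centralizer x" "g = f \<otimes> h"
proof -
  obtain y where y: "y \<in> carrier G" "csize y = m" by (rule exists_csize_m)
  have "cj g x \<in> orb F x"
    unfolding F_eq_centralizer[OF y] orb_centralizer_b_element[OF x y] using g by (simp add: orb_def)
  then obtain f where f: "f \<in> F" "cj g x = cj f x" by (auto simp: orb_def)
  have fc: "f \<in> carrier G" by (rule F_closed[OF f(1)])
  have "cj (inv f \<otimes> g) x = x" using f(2) fc g x by (simp add: cj_mult_left)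
  then have "inv f \<otimes> g \<in> centralizer x" using fc g x by (simp add: mem_centralizer)
  moreover have "bpart f \<in> centralizer x"
    using bpart_F[OF f(1)] centre_subset_centralizer[OF x(1)] by blast
  ultimately have 1: "bpart f \<otimes> (inv f \<otimes> g) \<in> centralizer x"
    using subgroup.m_closed[OF subgroup_centralizer[OF x(1)]] by blast
  have "g = (apart f \<otimes> bpart f) \<otimes> (inv f \<otimes> g)" using apart_mult_bpart[OF fc] fc g by simp
  also have "\<dots> = apart f \<otimes> (bpart f \<otimes> (inv f \<otimes> g))" using fc g by (simp add: m_assoc)
  finally show ?thesis using that[OF apart_Fa[OF f(1)] 1] by blast
qed

text \<open>Only a noncentral \<open>bpart w\<close> matters. By \<open>decompose\<close> at
  \<open>bpart w\<close>, its commutator with \<open>v\<close> comes from an element of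
  \<open>Fa\<close> and so lies in \<open>Fa\<close>. It also lies in \<open>centralizer x\<close>,
  hence is central; being killed by \<open>a\<close>, it is trivial.\<close>

lemma centralizer_b_element_commute:
  assumes x: "x \<in> carrier G" "x [^] b = \<one>" "x \<notin> centre G"
    and w: "w \<in> centralizer x" and v: "v \<in> centralizer x"
  shows "v \<otimes> w = w \<otimes> v"
proof -
  have wc: "w \<in> carrier G" and vc: "v \<in> carrier G" using w v mem_centralizer_closed by auto
  have C: "subgroup (centralizer x) G" by (rule subgroup_centralizer[OF x(1)])
  have ap: "apart w \<in> centre G"
    using a_element_central_of_commute[OF x apart_mem[OF C w] apart_pow[OF wc]] .
  have "v \<in> centralizer (bpart w)"
  proof (cases "bpart w \<in> centre G")
    case True
    then show ?thesis using vc by (simp add: mem_centre)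
  next
    case False
    note bw = bpart_closed[OF wc] bpart_pow[OF wc] False
    obtain f h where f: "f \<in> Fa" "h \<in> centralizer (bpart w)" "v = f \<otimes> h"
      by (rule decompose[OF bw vc])
    have fc: "f \<in> carrier G" and hc: "h \<in> carrier G"
      using f Fa_closed mem_centralizer_closed by auto
    have cj: "cj v (bpart w) = cj f (bpart w)"
      using f fc hc wc by (simp add: cj_mult_left mem_centralizer)
    define c where "c = cj f (bpart w) \<otimes> inv (bpart w)"
    have cc: "c \<in> carrier G" using fc wc by (simp add: c_def)
    have "c = f \<otimes> cj (bpart w) (inv f)" using fc wc by (simp add: c_def cj_def m_assoc)
    then have cFa: "c \<in> Fa"
      using normal_cj[OF normal_Fa bw(1)] f(1) subgroup.m_closed[OF subgroup_Fa]
        subgroup.m_inv_closed[OF subgroup_Fa] by simp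
    have "cj v (bpart w) \<in> centralizer x"
      unfolding cj_def using bpart_mem[OF C w] v subgroup.m_closed[OF C] subgroup.m_inv_closed[OF C] by blast
    then have "c \<in> centralizer x"
      unfolding c_def cj[symmetric]
      using bpart_mem[OF C w] subgroup.m_closed[OF C] subgroup.m_inv_closed[OF C] by blast
    then have cZ: "c \<in> centre G" using F_inter_centralizer[OF x] cFa by (auto simp: Fa_def)
    have 1: "cj v (bpart w) = c \<otimes> bpart w" using cj fc wc by (simp add: c_def m_assoc)
    have "c \<otimes> bpart w = bpart w \<otimes> c" using cZ wc by (auto simp: centre_def)
    moreover have "c [^] a = \<one>" using cFa by (simp add: Fa_def)
    ultimately have "c = \<one>"
      using commutator_trivial[OF vc bw(1) cc _ _ bw(2), of a] 1 coprime_ab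
      by (simp add: coprime_commute)
    then show ?thesis using 1 vc wc by (simp add: mem_centralizer)
  qed
  moreover have "v \<in> centralizer (apart w)" using ap vc by (simp add: mem_centre)
  ultimately have "v \<in> centralizer w" using centralizer_parts[OF wc] by blast
  then show ?thesis by (simp add: centralizer_def)
qed

text \<open>As \<open>centralizer x\<close> is abelian, it lies in \<open>centralizer w\<close>, so
  \<open>csize w\<close> divides \<open>n\<close> and must be \<open>n\<close>. This is the source
  of the fixed-point-free action.\<close>

lemma centralizer_eq_centralizer_b_element:
  assumes x: "x \<in> carrier G" "x [^] b = \<one>" "x \<notin> centre G"
    and w: "w \<in> centralizer x" "w \<notin> centre G"
  shows "centralizer w = centralizer x"
proof -
  have wc: "w \<in> carrier G" using w mem_centralizer_closed by auto
  have sub: "centralizer x \<subseteq> centralizer w"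
    using centralizer_b_element_commute[OF x w(1)] mem_centralizer_closed by (auto simp: centralizer_def[of w])
  have "csize w dvd n"
    using class_size_dvd[OF x(1) wc sub] csize_b_element[OF x] by simp
  then have "csize w = n" using csize_cases_noncentral[OF wc w(2)] not_m_dvd_n by auto
  then show ?thesis using centralizer_eqI[OF x(1) wc sub] csize_b_element[OF x] by simp
qed

text \<open>Put \<open>K = [Fa, x]\<close>. The part \<open>A\<close> of the centre killed by \<open>a\<close> is a direct factor, with complement
  \<open>K W\<close> where \<open>W\<close> consists of the elements of \<open>C(x)\<close> killed by \<open>b\<close>. So \<open>A\<close> is trivial and \<open>K = Fa\<close>.\<close>

lemma Fa_centralizer_semidirect:
  assumes x: "x \<in> carrier G" "x [^] b = \<one>" "x \<notin> centre G"
    and nf: "no_abelian_direct_factors G"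
  shows "Fa <#> centralizer x = carrier G" "Fa \<inter> centralizer x = {\<one>}" "card Fa = n"
    "\<forall>h \<in> centralizer x. h [^] b = \<one>"
proof -
  let ?L = "centralizer x"
  have L: "subgroup ?L G" by (rule subgroup_centralizer[OF x(1)])
  have Lc: "\<And>h. h \<in> ?L \<Longrightarrow> h \<in> carrier G" by (rule mem_centralizer_closed)
  define K where "K = (\<lambda>u. inv u \<otimes> cj x u) ` Fa"
  have "\<forall>v \<in> Fa. v [^] a = \<one>" by (simp add: Fa_def)
  moreover have "\<forall>u \<in> Fa. \<forall>v \<in> Fa. u \<otimes> v = v \<otimes> u" using F_commute by (simp add: Fa_def)
  moreover have "\<forall>v \<in> Fa. cj x v \<in> Fa" using normal_cj[OF normal_Fa x(1)] by blast
  ultimately have split': "subgroup K G" "K \<subseteq> Fa" "K \<inter> ?L = {\<one>}"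
    "\<forall>y \<in> Fa. \<exists>v \<in> Fa \<inter> ?L. \<exists>t \<in> K. y = v \<otimes> t" "card K = card (orb Fa x)"
    using coprime_action_split[OF subgroup_Fa _ _ x(1,2)] unfolding K_def by blast+
  have Kc: "\<And>k. k \<in> K \<Longrightarrow> k \<in> carrier G" using split'(2) Fa_closed by blast
  have FaL: "v \<in> centre G" if "v \<in> Fa" "v \<in> ?L" for v
    using F_inter_centralizer[OF x] that by (auto simp: Fa_def)
  have dec: "\<exists>t \<in> K. \<exists>h \<in> ?L. g = t \<otimes> h" if g: "g \<in> carrier G" for g
  proof -
    obtain f h where f: "f \<in> Fa" "h \<in> ?L" "g = f \<otimes> h" by (rule decompose[OF x g])
    obtain v t where v: "v \<in> Fa" "v \<in> ?L" "t \<in> K" "f = v \<otimes> t" using split'(4) f(1) by blast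
    have "v \<otimes> t = t \<otimes> v" using F_commute[of v t] v split'(2) by (auto simp: Fa_def)
    then have "g = t \<otimes> (v \<otimes> h)" using f v Fa_closed[OF v(1)] Kc[OF v(3)] Lc[OF f(2)] by (simp add: m_assoc)
    then show ?thesis using v(3) subgroup.m_closed[OF L v(2) f(2)] by blast
  qed
  \<comment> \<open>For \<open>g = t \<otimes> h\<close>, the factor \<open>h\<close> commutes with
    \<open>x\<close> and preserves \<open>Fa\<close>, hence \<open>K\<close>; \<open>t\<close> lies
    in the abelian \<open>Fa\<close> and acts trivially on \<open>K\<close>.\<close>
  have Kn: "K \<lhd> G"
  proof (rule normalI_cj[OF split'(1)])
    fix g k assume g: "g \<in> carrier G" and k: "k \<in> K"
    obtain t h where t: "t \<in> K" "h \<in> ?L" "g = t \<otimes> h" using dec[OF g] by blast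
    obtain u where u: "u \<in> Fa" "k = inv u \<otimes> cj x u" using k by (auto simp: K_def)
    have hc: "h \<in> carrier G" "h \<otimes> x = x \<otimes> h" using t by (auto simp: centralizer_def)
    have uc: "u \<in> carrier G" by (rule Fa_closed[OF u(1)])
    have "cj h (cj x u) = cj x (cj h u)"
      using hc x(1) uc by (simp flip: cj_mult_left)
    then have "cj h k = inv (cj h u) \<otimes> cj x (cj h u)"
      unfolding u(2) using hc x uc by (simp add: cj_mult_right cj_inv_right)
    then have hk: "cj h k \<in> K" unfolding K_def using normal_cj[OF normal_Fa hc(1) u(1)] by blast
    have "t \<otimes> cj h k = cj h k \<otimes> t"
      using F_commute[of t "cj h k"] t(1) hk split'(2) by (auto simp: Fa_def)
    then have "cj t (cj h k) = cj h k"
      using cj_eq_iff_commute[OF Kc[OF t(1)] Kc[OF hk]] by blast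
    moreover have "cj g k = cj t (cj h k)"
      unfolding t(3) using cj_mult_left[OF Kc[OF t(1)] hc(1) Kc[OF k]] .
    ultimately show "cj g k \<in> K" using hk by simp
  qed
  have Lcomm: "u \<otimes> v = v \<otimes> u" if "u \<in> ?L" "v \<in> ?L" for u v
    using centralizer_b_element_commute[OF x that(2,1)] .
  define A where "A = {z \<in> centre G. z [^] a = \<one>}"
  define W where "W = {h \<in> ?L. h [^] b = \<one>}"
  have Zc: "\<And>z. z \<in> centre G \<Longrightarrow> z \<in> carrier G" by (simp add: centre_def)
  have Zcomm: "z \<otimes> g = g \<otimes> z" if "z \<in> centre G" "g \<in> carrier G" for z g
    using that by (simp add: centre_def)
  have Ac: "\<And>z. z \<in> A \<Longrightarrow> z \<in> carrier G" by (simp add: A_def Zc)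
  have A: "subgroup A G"
  proof
    show "A \<subseteq> carrier G" using Ac by blast
    show "\<one> \<in> A" using subgroup.one_closed[OF subgroup_centre] by (simp add: A_def)
    show "u \<otimes> v \<in> A" if "u \<in> A" "v \<in> A" for u v
      using that mult_mem_centre Zc Zcomm by (auto simp: A_def pow_mult_distrib)
    show "inv u \<in> A" if "u \<in> A" for u
      using that subgroup.m_inv_closed[OF subgroup_centre] Zc by (auto simp: A_def nat_pow_inv)
  qed
  have W: "subgroup W G"
  proof
    show "W \<subseteq> carrier G" using Lc by (auto simp: W_def)
    show "\<one> \<in> W" using subgroup.one_closed[OF L] by (simp add: W_def)
    show "u \<otimes> v \<in> W" if "u \<in> W" "v \<in> W" for u v
      using that subgroup.m_closed[OF L] Lcomm[of u v] Lc by (auto simp: W_def pow_mult_distrib)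
    show "inv u \<in> W" if "u \<in> W" for u
      using that subgroup.m_inv_closed[OF L] Lc by (auto simp: W_def nat_pow_inv)
  qed
  have An: "A \<lhd> G"
    by (rule normalI_cj[OF A]) (auto simp: A_def mem_centre_cj)
  have KW: "subgroup (K <#> W) G" by (rule mult_norm_subgroup[OF Kn W])
  \<comment> \<open>Here \<open>h\<close> fixes \<open>w\<close> because
    \<open>centralizer x\<close> is abelian, while \<open>t\<close> changes \<open>w\<close> only by
    a factor from \<open>K\<close>.\<close>
  have KWn: "K <#> W \<lhd> G"
  proof (rule normalI_cj[OF KW])
    fix g p assume g: "g \<in> carrier G" and p: "p \<in> K <#> W"
    obtain k w where k: "k \<in> K" "w \<in> W" "p = k \<otimes> w" using p by (auto simp: set_mult_def)
    obtain t h where t: "t \<in> K" "h \<in> ?L" "g = t \<otimes> h" using dec[OF g] by blast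
    have car: "k \<in> carrier G" "w \<in> carrier G" "t \<in> carrier G" "h \<in> carrier G" "w \<in> ?L"
      using k t Kc Lc by (auto simp: W_def)
    have "cj h w = w" using Lcomm[OF t(2) car(5)] cj_eq_iff_commute car by blast
    then have "cj g w = (t \<otimes> cj w (inv t)) \<otimes> w"
      unfolding t(3) using car by (simp add: cj_mult_left) (simp add: cj_def m_assoc)
    then have "cj g p = (cj g k \<otimes> (t \<otimes> cj w (inv t))) \<otimes> w"
      unfolding k(3) using car g by (simp add: cj_mult_right m_assoc)
    moreover have "cj g k \<otimes> (t \<otimes> cj w (inv t)) \<in> K"
      using normal_cj[OF Kn g k(1)] t(1) subgroup.m_closed[OF split'(1)]
        normal_cj[OF Kn car(2) subgroup.m_inv_closed[OF split'(1) t(1)]] by simp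
    ultimately show "cj g p \<in> K <#> W" using k(2) unfolding set_mult_def by blast
  qed
  have int: "A \<inter> (K <#> W) = {\<one>}"
  proof
    show "{\<one>} \<subseteq> A \<inter> (K <#> W)" using subgroup.one_closed[OF A] subgroup.one_closed[OF KW] by blast
    show "A \<inter> (K <#> W) \<subseteq> {\<one>}"
    proof
      fix z assume z: "z \<in> A \<inter> (K <#> W)"
      obtain k w where k: "k \<in> K" "w \<in> W" "z = k \<otimes> w" using z by (auto simp: set_mult_def)
      have car: "k \<in> carrier G" "w \<in> carrier G" "w \<in> ?L" using k Kc Lc by (auto simp: W_def)
      have zL: "z \<in> ?L" using z centre_subset_centralizer[OF x(1)] by (auto simp: A_def)
      have "k = z \<otimes> inv w" unfolding k(3) using car by (simp add: m_assoc)
      then have "k \<in> ?L" using subgroup.m_closed[OF L zL subgroup.m_inv_closed[OF L car(3)]] by simp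
      then have "k = \<one>" using split'(3) k(1) by blast
      then have "z = w" using k(3) car by simp
      then show "z \<in> {\<one>}" using eq_one_of_pow_ab[of z] z k(2) car by (auto simp: A_def W_def)
    qed
  qed
  have apL: "apart h \<in> A" if "h \<in> ?L" for h
    using a_element_central_of_commute[OF x apart_mem[OF L that]] apart_pow[OF Lc[OF that]]
    by (simp add: A_def)
  have prod: "A <#> (K <#> W) = carrier G"
  proof
    show "A <#> (K <#> W) \<subseteq> carrier G"
      using set_mult_closed[OF subgroup.subset[OF A] subgroup.subset[OF KW]] .
    show "carrier G \<subseteq> A <#> (K <#> W)"
    proof
      fix g assume g: "g \<in> carrier G"
      obtain t h where t: "t \<in> K" "h \<in> ?L" "g = t \<otimes> h" using dec[OF g] by blast
      have hc: "h \<in> carrier G" and tc: "t \<in> carrier G" using t Lc Kc by auto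
      have az: "apart h \<in> A" by (rule apL[OF t(2)])
      have bW: "bpart h \<in> W" using bpart_mem[OF L t(2)] bpart_pow[OF hc] by (simp add: W_def)
      have "g = t \<otimes> (apart h \<otimes> bpart h)" using t(3) apart_mult_bpart[OF hc] by simp
      also have "\<dots> = apart h \<otimes> (t \<otimes> bpart h)"
        using Zcomm[of "apart h" t] az tc hc by (simp add: A_def flip: m_assoc)
      finally show "g \<in> A <#> (K <#> W)" using az bW t(1) unfolding set_mult_def by blast
    qed
  qed
  have "direct_factor G A"
    unfolding direct_factor_def direct_product_def using An KWn int prod by blast
  moreover have "comm_group (G\<lparr>carrier := A\<rparr>)"
  proof (rule group.group_comm_groupI[OF subgroup_imp_group[OF A]])
    fix u v assume "u \<in> carrier (G\<lparr>carrier := A\<rparr>)" "v \<in> carrier (G\<lparr>carrier := A\<rparr>)"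
    then have "u \<in> centre G" "v \<in> carrier G" using Ac by (auto simp: A_def)
    then show "u \<otimes>\<^bsub>G\<lparr>carrier := A\<rparr>\<^esub> v = v \<otimes>\<^bsub>G\<lparr>carrier := A\<rparr>\<^esub> u" using Zcomm by simp
  qed
  ultimately have "direct_factor G A \<and> abelian_subgroup G A"
    using A by (simp add: abelian_subgroup_def)
  then have A1: "A = {\<one>}" using nf unfolding no_abelian_direct_factors_def by blast
  show "\<forall>h \<in> ?L. h [^] b = \<one>"
  proof
    fix h assume h: "h \<in> ?L"
    have "apart h = \<one>" using apL[OF h] A1 by blast
    then have "bpart h = h" using apart_mult_bpart[OF Lc[OF h]] bpart_closed[OF Lc[OF h]] by simp
    then show "h [^] b = \<one>" using bpart_pow[OF Lc[OF h]] by simp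
  qed
  show FaL1: "Fa \<inter> ?L = {\<one>}"
  proof -
    have "Fa \<inter> ?L \<subseteq> A" using FaL by (auto simp: A_def Fa_def)
    then show ?thesis
      using A1 subgroup.one_closed[OF subgroup_Fa] subgroup.one_closed[OF L] by blast
  qed
  show "Fa <#> ?L = carrier G"
  proof
    show "Fa <#> ?L \<subseteq> carrier G"
      using set_mult_closed[OF subgroup.subset[OF subgroup_Fa] subgroup.subset[OF L]] .
    show "carrier G \<subseteq> Fa <#> ?L"
      using dec split'(2) unfolding set_mult_def by blast
  qed
  have "orb Fa x = orb (carrier G) x"
  proof
    show "orb Fa x \<subseteq> orb (carrier G) x" using orb_mono[OF subgroup.subset[OF subgroup_Fa]] .
    show "orb (carrier G) x \<subseteq> orb Fa x"
    proof
      fix u assume "u \<in> orb (carrier G) x"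
      then obtain g where g: "g \<in> carrier G" "u = cj g x" by (auto simp: orb_def)
      obtain f h where f: "f \<in> Fa" "h \<in> ?L" "g = f \<otimes> h" by (rule decompose[OF x g(1)])
      have "u = cj f x" using f g Fa_closed[OF f(1)] x by (simp add: cj_mult_left mem_centralizer)
      then show "u \<in> orb Fa x" using f(1) by (auto simp: orb_def)
    qed
  qed
  then have "card (orb Fa x) = n" using csize_b_element[OF x] by simp
  then show "card Fa = n" using card_orb[OF subgroup_Fa x(1)] FaL1 by simp
qed

end

section \<open>The Frobenius structure\<close>

context coprime_largest_class_sizes
begin

lemma Fa_noncentral:
  assumes x: "x \<in> carrier G" "x [^] b = \<one>" "x \<notin> centre G" and nf: "no_abelian_direct_factors G"
    and f: "f \<in> Fa" "f \<in> centre G"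
  shows "f = \<one>"
  using Fa_centralizer_semidirect(2)[OF x nf] f centre_subset_centralizer[OF x(1)] by blast

lemma Fa_fixed_point_free:
  assumes x: "x \<in> carrier G" "x [^] b = \<one>" "x \<notin> centre G" and nf: "no_abelian_direct_factors G"
    and l: "l \<in> centralizer x" "l \<notin> centre G" and f: "f \<in> Fa" "cj l f = f"
  shows "f = \<one>"
proof -
  have "l \<in> carrier G" "f \<in> carrier G" using l f mem_centralizer_closed Fa_closed by auto
  then have "f \<in> centralizer l" using f(2) mem_centralizer mem_centralizer_sym by blast
  then have "f \<in> centralizer x" using centralizer_eq_centralizer_b_element[OF x l] by simp
  then show ?thesis using Fa_centralizer_semidirect(2)[OF x nf] f(1) by blast
qed

lemma Fa_commutator_closed:
  assumes f: "f \<in> Fa" and l: "l \<in> carrier G"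
  shows "cj f l \<otimes> inv l \<in> Fa"
proof -
  have "cj f l \<otimes> inv l = f \<otimes> cj l (inv f)"
    using Fa_closed[OF f] l by (simp add: cj_def m_assoc)
  then show ?thesis
    using f l normal_cj[OF normal_Fa l] subgroup.m_closed[OF subgroup_Fa]
      subgroup.m_inv_closed[OF subgroup_Fa] by simp
qed

text \<open>This is the condition on a Frobenius complement. For \<open>g = f \<otimes> h\<close>,
  the factor \<open>h\<close> fixes \<open>l\<close>, and the commutator of \<open>f\<close> and
  \<open>l\<close> lies in \<open>Fa\<close> and in \<open>centralizer x\<close>, so it is trivial.
  Hence \<open>l\<close> fixes \<open>f\<close>, and \<open>f = \<one>\<close>.\<close>

lemma mem_centralizer_of_cj:
  assumes x: "x \<in> carrier G" "x [^] b = \<one>" "x \<notin> centre G" and nf: "no_abelian_direct_factors G"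
    and l: "l \<in> centralizer x" "l \<notin> centre G" and g: "g \<in> carrier G" "cj g l \<in> centralizer x"
  shows "g \<in> centralizer x"
proof -
  have L: "subgroup (centralizer x) G" by (rule subgroup_centralizer[OF x(1)])
  obtain f h where f: "f \<in> Fa" "h \<in> centralizer x" "g = f \<otimes> h" by (rule decompose[OF x g(1)])
  have car: "f \<in> carrier G" "h \<in> carrier G" "l \<in> carrier G"
    using f l Fa_closed mem_centralizer_closed by auto
  have "cj h l = l"
    using centralizer_b_element_commute[OF x l(1) f(2)] cj_eq_iff_commute car by blast
  then have cj: "cj g l = cj f l" using f(3) car by (simp add: cj_mult_left)
  have "cj f l \<otimes> inv l \<in> centralizer x"
    using g(2) cj l(1) subgroup.m_closed[OF L] subgroup.m_inv_closed[OF L] by simp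
  then have "cj f l \<otimes> inv l = \<one>"
    using Fa_commutator_closed[OF f(1) car(3)] Fa_centralizer_semidirect(2)[OF x nf] by blast
  then have "cj f l = l" using car inv_solve_right'[of \<one> "cj f l" l] by simp
  then have "cj l f = f" using cj_eq_iff_commute car by metis
  then have "f = \<one>" using Fa_fixed_point_free[OF x nf l f(1)] by simp
  then show ?thesis using f car by simp
qed

text \<open>The map \<open>k \<mapsto> [k, l]\<close> is injective, hence surjective, on \<open>Fa\<close>.\<close>

lemma mem_class_of_complement_element:
  assumes x: "x \<in> carrier G" "x [^] b = \<one>" "x \<notin> centre G" and nf: "no_abelian_direct_factors G"
    and l: "l \<in> centralizer x" "l \<notin> centre G" and f: "f \<in> Fa"
  shows "\<exists>k \<in> Fa. f \<otimes> l = cj k l"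
proof -
  have lc: "l \<in> carrier G" using l mem_centralizer_closed by auto
  let ?t = "\<lambda>k. cj k l \<otimes> inv l"
  have "inj_on ?t Fa"
  proof (rule inj_onI)
    fix u v assume uv: "u \<in> Fa" "v \<in> Fa" "?t u = ?t v"
    have car: "u \<in> carrier G" "v \<in> carrier G" using uv Fa_closed by auto
    have "cj u l = cj v l" using uv(3) car lc by simp
    then have "cj (inv v \<otimes> u) l = l" using car lc by (simp add: cj_mult_left)
    then have "cj l (inv v \<otimes> u) = inv v \<otimes> u" using cj_eq_iff_commute car lc by (metis inv_closed m_closed)
    moreover have "inv v \<otimes> u \<in> Fa"
      using uv subgroup.m_closed[OF subgroup_Fa] subgroup.m_inv_closed[OF subgroup_Fa] by blast
    ultimately have "inv v \<otimes> u = \<one>" using Fa_fixed_point_free[OF x nf l] by blast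
    then show "u = v" using car inv_solve_left'[of \<one> v u] by simp
  qed
  moreover have "?t ` Fa \<subseteq> Fa" using Fa_commutator_closed lc by blast
  ultimately have "?t ` Fa = Fa" using endo_inj_surj finite_subgroup[OF subgroup_Fa] by blast
  then obtain k where k: "k \<in> Fa" "f = cj k l \<otimes> inv l" using f by blast
  then have "f \<otimes> l = cj k l" using lc Fa_closed[OF k(1)] by (simp add: m_assoc)
  then show ?thesis using k(1) by blast
qed

text \<open>The \<open>n - 1\<close> nontrivial elements of \<open>Fa\<close> fall into conjugacy
  classes of \<open>G\<close>, all of size \<open>m\<close>.\<close>

lemma m_dvd_n_minus_1:
  assumes x: "x \<in> carrier G" "x [^] b = \<one>" "x \<notin> centre G" and nf: "no_abelian_direct_factors G"
  shows "m dvd n - 1"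
proof -
  let ?C = "orb (carrier G) ` (Fa - {\<one>})"
  have sub: "orb (carrier G) f \<subseteq> Fa - {\<one>}" if f: "f \<in> Fa - {\<one>}" for f
  proof
    fix u assume "u \<in> orb (carrier G) f"
    then obtain g where g: "g \<in> carrier G" "u = cj g f" by (auto simp: orb_def)
    have "u \<noteq> \<one>" using g f Fa_closed[of f] cj_inj[of g f \<one>] by auto
    then show "u \<in> Fa - {\<one>}" using g f normal_cj[OF normal_Fa] by simp
  qed
  have "\<Union> ?C = Fa - {\<one>}"
  proof
    show "\<Union> ?C \<subseteq> Fa - {\<one>}" using sub by blast
    show "Fa - {\<one>} \<subseteq> \<Union> ?C"
    proof
      fix f assume f: "f \<in> Fa - {\<one>}"
      then have "f \<in> orb (carrier G) f" using self_mem_orb[OF subgroup_self] Fa_closed by simp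
      then show "f \<in> \<Union> ?C" using f by blast
    qed
  qed
  moreover have "csize f = m" if "f \<in> Fa - {\<one>}" for f
  proof -
    have "f \<notin> centre G" using that Fa_noncentral[OF x nf] by blast
    then have "csize f \<noteq> 1" using class_size_1_iff[of f] that Fa_closed[of f] by simp
    then show ?thesis using that by (simp add: Fa_def F_def)
  qed
  moreover have "\<forall>c1 \<in> ?C. \<forall>c2 \<in> ?C. c1 \<noteq> c2 \<longrightarrow> c1 \<inter> c2 = {}"
  proof (intro ballI impI)
    fix c1 c2 assume c: "c1 \<in> ?C" "c2 \<in> ?C" "c1 \<noteq> c2"
    from c(1) obtain u where u: "u \<in> Fa" "c1 = orb (carrier G) u" by (elim imageE) blast
    from c(2) obtain v where v: "v \<in> Fa" "c2 = orb (carrier G) v" by (elim imageE) blast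
    note u = Fa_closed[OF u(1)] u(2) and v = Fa_closed[OF v(1)] v(2)
    have "c1 = orb (carrier G) t \<and> c2 = orb (carrier G) t" if "t \<in> c1 \<inter> c2" for t
      using orb_eq[OF subgroup_self u(1), of t] orb_eq[OF subgroup_self v(1), of t] that u(2) v(2)
      by blast
    then show "c1 \<inter> c2 = {}" using c(3) by blast
  qed
  moreover have "finite (Fa - {\<one>})" using finite_subgroup[OF subgroup_Fa] by simp
  ultimately have "m dvd card (Fa - {\<one>})" using dvd_partition[of ?C m] by auto
  then show ?thesis
    using Fa_centralizer_semidirect(3)[OF x nf] subgroup.one_closed[OF subgroup_Fa]
    by (simp add: card_Diff_singleton)
qed

text \<open>If the \<open>q\<close>-torsion were not cyclic, two of its elements would generate a
  group of type \<open>C_q \<times> C_q\<close> acting fixed point freely on \<open>Fa\<close>. Then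
  \<open>q\<close> kills \<open>Fa\<close> and divides \<open>n\<close>; but \<open>b\<close> kills
  the complement, so \<open>q\<close> also divides \<open>b\<close>.\<close>

lemma cyclic_quotient_complement:
  assumes x: "x \<in> carrier G" "x [^] b = \<one>" "x \<notin> centre G" and nf: "no_abelian_direct_factors G"
  shows "cyclic_group (quotient_in G (centralizer x) (centre G))"
proof -
  let ?L = "centralizer x" and ?Z = "centre G"
  let ?GL = "G\<lparr>carrier := ?L\<rparr>"
  have L: "subgroup ?L G" by (rule subgroup_centralizer[OF x(1)])
  have Lc: "\<And>l. l \<in> ?L \<Longrightarrow> l \<in> carrier G" by (rule mem_centralizer_closed)
  interpret GL: comm_group ?GL
  proof (rule group.group_comm_groupI[OF subgroup_imp_group[OF L]])
    fix u v assume "u \<in> carrier ?GL" "v \<in> carrier ?GL"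
    then show "u \<otimes>\<^bsub>?GL\<^esub> v = v \<otimes>\<^bsub>?GL\<^esub> u"
      using centralizer_b_element_commute[OF x] by simp
  qed
  have ZL: "subgroup ?Z ?GL"
    using subgroup_incl[OF subgroup_centre L] centre_subset_centralizer[OF x(1)] .
  have ZLn: "?Z \<lhd> ?GL" by (rule GL.subgroup_imp_normal[OF ZL])
  let ?A = "quotient_in G ?L ?Z"
  interpret A: comm_group ?A
    unfolding quotient_in_def by (rule GL.abelian_FactGroup[OF ZL])
  have car: "carrier ?A = (\<lambda>l. ?Z #> l) ` ?L" by (rule carrier_quotient_in)
  have one: "\<one>\<^bsub>?A\<^esub> = ?Z" by (simp add: quotient_in_def)
  have pow: "(?Z #> l) [^]\<^bsub>?A\<^esub> i = ?Z #> (l [^] i)" if "l \<in> ?L" for l and i :: nat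
    using normal.FactGroup_pow[OF ZLn, of l i] that by (simp add: quotient_in_def nat_pow_def)
  have mult: "(?Z #> l) \<otimes>\<^bsub>?A\<^esub> (?Z #> l') = ?Z #> (l \<otimes> l')" if "l \<in> ?L" "l' \<in> ?L" for l l'
    using normal.rcos_sum[OF normal_centre, of l l'] that Lc by (simp add: quotient_in_def)
  show ?thesis
  proof (rule A.cyclic_group_if_prime_torsion_cyclic)
    show "finite (carrier ?A)" using car finite_subgroup[OF L] by simp
    fix q :: nat and u v
    assume q: "prime q" and uv: "u \<in> carrier ?A" "v \<in> carrier ?A"
      and tor: "u [^]\<^bsub>?A\<^esub> q = \<one>\<^bsub>?A\<^esub>" "v [^]\<^bsub>?A\<^esub> q = \<one>\<^bsub>?A\<^esub>" "u \<noteq> \<one>\<^bsub>?A\<^esub>"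
    show "\<exists>i::nat. v = u [^]\<^bsub>?A\<^esub> i"
    proof (rule ccontr)
      assume neg: "\<not> ?thesis"
      obtain g where g: "g \<in> ?L" "u = ?Z #> g" using uv(1) car by auto
      obtain h where h: "h \<in> ?L" "v = ?Z #> h" using uv(2) car by auto
      have gc: "g \<in> carrier G" and hc: "h \<in> carrier G" using g h Lc by auto
      have gq: "g [^] q \<in> ?Z" "h [^] q \<in> ?Z"
        using tor(1,2) pow[OF g(1), of q] pow[OF h(1), of q] g h gc hc
          coset_centre_eq_centre_iff one by auto
      have gZ: "g \<notin> ?Z" using tor(3) g(2) one coset_centre_eq_centre_iff[OF gc] by simp
      have hgL: "h \<otimes> g [^] i \<in> ?L" for i :: nat
        using subgroup.m_closed[OF L h(1) subgroup_pow_closed[OF L g(1)]] .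
      have hgZ: "h \<otimes> g [^] i \<notin> ?Z" for i :: nat
      proof
        assume "h \<otimes> g [^] i \<in> ?Z"
        then have "?Z #> (h \<otimes> g [^] i) = \<one>\<^bsub>?A\<^esub>"
          using one coset_centre_eq_centre_iff[of "h \<otimes> g [^] i"] gc hc by simp
        then have 1: "v \<otimes>\<^bsub>?A\<^esub> u [^]\<^bsub>?A\<^esub> i = \<one>\<^bsub>?A\<^esub>"
          using mult[OF h(1) subgroup_pow_closed[OF L g(1)], of i] pow[OF g(1), of i] g(2) h(2) by simp
        have "q > 0" using prime_gt_0_nat[OF q] .
        \<comment> \<open>Since \<open>q\<close> kills \<open>u\<close>, the exponent
          \<open>i * (q - 1)\<close> expresses the inverse of the \<open>i\<close>-th power of
          \<open>u\<close> by a natural power.\<close>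
        then have "i * (q - 1) + i = q * i" by (cases q) (auto simp: algebra_simps)
        then have "u [^]\<^bsub>?A\<^esub> (i * (q - 1)) \<otimes>\<^bsub>?A\<^esub> u [^]\<^bsub>?A\<^esub> i = (u [^]\<^bsub>?A\<^esub> q) [^]\<^bsub>?A\<^esub> i"
          using uv(1) by (simp add: A.nat_pow_mult A.nat_pow_pow)
        then have "u [^]\<^bsub>?A\<^esub> (i * (q - 1)) \<otimes>\<^bsub>?A\<^esub> u [^]\<^bsub>?A\<^esub> i = v \<otimes>\<^bsub>?A\<^esub> u [^]\<^bsub>?A\<^esub> i"
          using 1 tor(1) by simp
        then have "v = u [^]\<^bsub>?A\<^esub> (i * (q - 1))" using uv A.right_cancel by simp
        then show False using neg by blast
      qed
      have Zfix: "cj z k = k" if "z \<in> ?Z" "k \<in> Fa" for z k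
        using that Fa_closed[OF that(2)] cj_eq_iff_commute[of z k] by (auto simp: centre_def)
      have pq: "k [^] q = \<one>" if k: "k \<in> Fa" for k
        by (rule pow_eq_one_of_fixed_point_free[OF normal_Fa comm_group_Fa q gc hc _ _ _ _ _ k])
          (use centralizer_b_element_commute[OF x h(1) g(1)] Zfix gq hgL hgZ gZ g(1)
            Fa_fixed_point_free[OF x nf] in blast)+
      have "card Fa > 1" using Fa_centralizer_semidirect(3)[OF x nf] n_gt_1 by simp
      then have "\<not> Fa \<subseteq> {\<one>}" using card_mono[of "{\<one>}" Fa] by auto
      then obtain k where k: "k \<in> Fa" "k \<noteq> \<one>" by blast
      have "k [^] n = \<one>"
        using pow_card_subgroup[OF subgroup_Fa k(1)] Fa_centralizer_semidirect(3)[OF x nf] by simp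
      then have "\<not> coprime q n"
        using eq_one_of_coprime_pows[OF Fa_closed[OF k(1)] pq[OF k(1)]] k(2) by blast
      then have "q dvd n" using prime_imp_coprime[OF q] by blast
      moreover have "g [^] b = \<one>" using Fa_centralizer_semidirect(4)[OF x nf] g(1) by blast
      then have "u [^]\<^bsub>?A\<^esub> b = \<one>\<^bsub>?A\<^esub>"
        using pow[OF g(1), of b] g(2) one coset_centre_eq_centre_iff[of \<one>]
          subgroup.one_closed[OF subgroup_centre] by simp
      then have "\<not> coprime q b"
        using A.eq_one_of_coprime_pows[OF uv(1) tor(1)] tor(3) by blast
      then have "q dvd b" using prime_imp_coprime[OF q] by blast
      ultimately have "is_unit q" using coprime_b_n coprime_common_divisor by blast
      then show False using q by simp
    qed
  qed
qed

text \<open>The complement is the image of \<open>centralizer x\<close>. Modulo the centre no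
  nontrivial element of \<open>Fa\<close> is conjugate into it, since \<open>F\<close> is normal and
  meets \<open>centralizer x\<close> in the centre. Conversely, \<open>f \<otimes> l\<close> with
  noncentral \<open>l\<close> is conjugate to \<open>l\<close>.\<close>

lemma frobenius_quotient:
  assumes x: "x \<in> carrier G" "x [^] b = \<one>" "x \<notin> centre G" and nf: "no_abelian_direct_factors G"
  shows "frobenius_group_with_kernel (G Mod centre G)
    (carrier (quotient_in G (Fa <#> centre G) (centre G)))"
proof -
  let ?L = "centralizer x" and ?Z = "centre G" and ?X = "G Mod centre G"
  let ?p = "\<lambda>g. ?Z #> g"
  have L: "subgroup ?L G" by (rule subgroup_centralizer[OF x(1)])
  have Lc: "\<And>l. l \<in> ?L \<Longrightarrow> l \<in> carrier G" by (rule mem_centralizer_closed)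
  have Zc: "\<And>z. z \<in> ?Z \<Longrightarrow> z \<in> carrier G" by (simp add: centre_def)
  have ZL: "?Z \<subseteq> ?L" by (rule centre_subset_centralizer[OF x(1)])
  have X: "group ?X" by (rule normal.factorgroup_is_group[OF normal_centre])
  interpret p: group_hom G ?X ?p
    by (intro group_hom.intro group_hom_axioms.intro X centre_coset_hom is_group)
  have carX: "carrier ?X = ?p ` carrier G" by (rule carrier_FactGroup)
  have one: "\<one>\<^bsub>?X\<^esub> = ?Z" by simp
  let ?H = "?p ` ?L"
  have conjH: "conjugate ?X ?H (?p g) = (\<lambda>l. ?p (cj (inv g) l)) ` ?L" if g: "g \<in> carrier G" for g
  proof -
    have "inv\<^bsub>?X\<^esub> (?p g) \<otimes>\<^bsub>?X\<^esub> ?p l \<otimes>\<^bsub>?X\<^esub> ?p g = ?p (cj (inv g) l)" if "l \<in> ?L" for l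
      using that g Lc by (simp only: cj_def p.hom_mult p.hom_inv inv_closed m_closed inv_inv)
    then show ?thesis unfolding group.conjugate_eq_image[OF X] image_image by (intro image_cong) auto
  qed
  have pH: "g \<in> ?L" if g: "g \<in> carrier G" "?p g \<in> ?H" for g
  proof -
    obtain l where l: "l \<in> ?L" "?p g = ?p l" using g(2) by auto
    then obtain z where "z \<in> ?Z" "g = z \<otimes> l" using mem_coset_centre_iff[OF g(1) Lc[OF l(1)]] by auto
    then show ?thesis using l(1) ZL subgroup.m_closed[OF L] by blast
  qed
  have compl: "frobenius_complement ?X ?H"
    unfolding frobenius_complement_def
  proof (intro conjI ballI)
    show "subgroup ?H ?X" by (rule p.subgroup_img_is_subgroup[OF L])
    show "?H \<noteq> {\<one>\<^bsub>?X\<^esub>}"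
    proof
      assume "?H = {\<one>\<^bsub>?X\<^esub>}"
      then have "?p x = ?Z" using self_mem_centralizer[OF x(1)] by auto
      then show False using x(3) coset_centre_eq_centre_iff[OF x(1)] by simp
    qed
    show "?H \<noteq> carrier ?X"
    proof
      assume eq: "?H = carrier ?X"
      have "?p f \<in> ?H" if "f \<in> Fa" for f
        unfolding eq carX using Fa_closed[OF that] by (rule imageI)
      then have "Fa \<subseteq> ?L" using pH Fa_closed by auto
      then have "Fa = {\<one>}" using Fa_centralizer_semidirect(2)[OF x nf] by blast
      then show False using Fa_centralizer_semidirect(3)[OF x nf] n_gt_1 by simp
    qed
    fix g' assume g': "g' \<in> carrier ?X - ?H"
    then obtain g where g: "g \<in> carrier G" "g' = ?p g" using carX by auto
    have gL: "g \<notin> ?L" using g g' by auto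
    show "?H \<inter> conjugate ?X ?H g' = {\<one>\<^bsub>?X\<^esub>}"
    proof
      have 1: "cj (inv g) \<one> = \<one>" using g(1) by simp
      have "\<one> \<in> ?L" by (rule subgroup.one_closed[OF L])
      then have "?p \<one> \<in> ?H \<inter> conjugate ?X ?H g'" unfolding g(2) conjH[OF g(1)] using 1
        by (metis (no_types, lifting) IntI image_eqI)
      then show "{\<one>\<^bsub>?X\<^esub>} \<subseteq> ?H \<inter> conjugate ?X ?H g'" using p.hom_one by simp
      show "?H \<inter> conjugate ?X ?H g' \<subseteq> {\<one>\<^bsub>?X\<^esub>}"
      proof
        fix t assume t: "t \<in> ?H \<inter> conjugate ?X ?H g'"
        then obtain l where l: "l \<in> ?L" "t = ?p (cj (inv g) l)" unfolding g(2) conjH[OF g(1)] by auto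
        have lc: "l \<in> carrier G" by (rule Lc[OF l(1)])
        have cjL: "cj (inv g) l \<in> ?L" using pH[of "cj (inv g) l"] t l(2) g(1) lc by simp
        have "l \<in> ?Z"
        proof (rule ccontr)
          assume "l \<notin> ?Z"
          then have "inv g \<in> ?L" using mem_centralizer_of_cj[OF x nf l(1) _ _ cjL] g(1) by simp
          then have "inv (inv g) \<in> ?L" by (rule subgroup.m_inv_closed[OF L])
          then show False using gL g(1) by simp
        qed
        then have "cj (inv g) l \<in> ?Z" using normal_cj[OF normal_centre] g(1) by simp
        then show "t \<in> {\<one>\<^bsub>?X\<^esub>}" using l(2) coset_centre_eq_centre_iff g(1) lc by simp
      qed
    qed
  qed
  have kernel: "(\<lambda>g. ?Z #> g) ` (Fa <#> ?Z) = frobenius_kernel ?X ?H"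
  proof
    show "?p ` (Fa <#> ?Z) \<subseteq> frobenius_kernel ?X ?H"
    proof
      fix t assume "t \<in> ?p ` (Fa <#> ?Z)"
      then obtain f z where f: "f \<in> Fa" "z \<in> ?Z" "t = ?p (f \<otimes> z)" by (auto simp: set_mult_def)
      have fc: "f \<in> carrier G" and zc: "z \<in> carrier G" using f Fa_closed Zc by auto
      show "t \<in> frobenius_kernel ?X ?H"
      proof (cases "f = \<one>")
        case True
        then show ?thesis using f zc coset_centre_eq_centre_iff[of z] by (simp add: frobenius_kernel_def)
      next
        case False
        have "t \<notin> conjugate ?X ?H g'" if g': "g' \<in> carrier ?X" for g'
        proof
          assume "t \<in> conjugate ?X ?H g'"
          moreover obtain g where g: "g \<in> carrier G" "g' = ?p g" using g' carX by auto
          ultimately obtain l where l: "l \<in> ?L" "?p (f \<otimes> z) = ?p (cj (inv g) l)"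
            unfolding g(2) conjH[OF g(1)] using f(3) by auto
          have lc: "l \<in> carrier G" by (rule Lc[OF l(1)])
          obtain z' where z': "z' \<in> ?Z" "cj (inv g) l = z' \<otimes> (f \<otimes> z)"
            using mem_coset_centre_iff[of "cj (inv g) l" "f \<otimes> z"] l(2) g(1) lc fc zc by auto
          have "f \<in> F" "z \<in> F" "z' \<in> F" using f z' centre_subset_F by (auto simp: Fa_def)
          then have "cj (inv g) l \<in> F" using z'(2) subgroup.m_closed[OF subgroup_F] by simp
          then have "cj g (cj (inv g) l) \<in> F" using normal_cj[OF normal_F g(1)] by blast
          then have "l \<in> F" using g(1) lc by simp
          then have "l \<in> ?Z" using F_inter_centralizer[OF x] l(1) by blast
          then have "cj (inv g) l \<in> ?Z" using normal_cj[OF normal_centre] g(1) by simp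
          moreover have "f = inv z' \<otimes> cj (inv g) l \<otimes> inv z"
            using z' fc zc Zc[OF z'(1)] by (simp add: m_assoc)
          ultimately have "f \<in> ?Z"
            using z'(1) f(2) mult_mem_centre subgroup.m_inv_closed[OF subgroup_centre] by simp
          then show False using Fa_noncentral[OF x nf f(1)] False by simp
        qed
        moreover have "t \<in> carrier ?X"
          unfolding f(3) carX by (rule imageI[OF m_closed[OF fc zc]])
        ultimately show ?thesis by (simp add: frobenius_kernel_def)
      qed
    qed
    show "frobenius_kernel ?X ?H \<subseteq> ?p ` (Fa <#> ?Z)"
    proof
      fix t assume t: "t \<in> frobenius_kernel ?X ?H"
      show "t \<in> ?p ` (Fa <#> ?Z)"
      proof (cases "t = \<one>\<^bsub>?X\<^esub>")
        case True
        have "\<one> \<otimes> \<one> \<in> Fa <#> ?Z"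
          using subgroup.one_closed[OF subgroup_Fa] subgroup.one_closed[OF subgroup_centre]
          unfolding set_mult_def by blast
        then have "\<one> \<in> Fa <#> ?Z" by simp
        moreover have "t = ?p \<one>" using True p.hom_one by simp
        ultimately show ?thesis by blast
      next
        case False
        then have tc: "t \<in> carrier ?X" and tn: "\<And>g. g \<in> carrier ?X \<Longrightarrow> t \<notin> conjugate ?X ?H g"
          using t by (auto simp: frobenius_kernel_def)
        obtain g where g: "g \<in> carrier G" "t = ?p g" using tc carX by auto
        have "g \<in> Fa <#> ?L" using g(1) Fa_centralizer_semidirect(1)[OF x nf] by simp
        then obtain f l where f: "f \<in> Fa" "l \<in> ?L" "g = f \<otimes> l" by (auto simp: set_mult_def)
        have "l \<in> ?Z"
        proof (rule ccontr)
          assume "l \<notin> ?Z"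
          then obtain k where k: "k \<in> Fa" "g = cj k l"
            using mem_class_of_complement_element[OF x nf f(2) _ f(1)] f(3) by blast
          have kc: "k \<in> carrier G" by (rule Fa_closed[OF k(1)])
          \<comment> \<open>\<open>conjugate\<close> has the inverse on the left, so the conjugator
            \<open>k\<close> enters as \<open>inv k\<close>.\<close>
          have "?p (inv k) \<in> carrier ?X" unfolding carX by (rule imageI[OF inv_closed[OF kc]])
          moreover have "t \<in> conjugate ?X ?H (?p (inv k))"
            unfolding conjH[OF inv_closed[OF kc]] using f(2) k(2) kc g(2) by auto
          ultimately show False using tn by blast
        qed
        then show ?thesis using g(2) f unfolding set_mult_def by blast
      qed
    qed
  qed
  show ?thesis
    unfolding frobenius_group_with_kernel_def carrier_quotient_in
    using X compl kernel by blast
qed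

lemma frobenius_structure:
  assumes nf: "no_abelian_direct_factors G"
  shows "\<exists>K L. semidirect_product G K L \<and> abelian_subgroup G K \<and> gcd (card K) (card L) = 1 \<and>
    centre G \<subset> L \<and> cyclic_group (quotient_in G L (centre G)) \<and>
    frobenius_group_with_kernel (G Mod centre G)
      (carrier (quotient_in G (K <#> centre G) (centre G))) \<and>
    m = order (quotient_in G L (centre G)) \<and> n = card K \<and> [n = 1] (mod m)"
proof -
  obtain x where x: "x \<in> carrier G" "x [^] b = \<one>" "x \<notin> centre G" by (rule b_element_exists)
  let ?L = "centralizer x"
  note sd = Fa_centralizer_semidirect[OF x nf]
  have L: "subgroup ?L G" by (rule subgroup_centralizer[OF x(1)])
  have "abelian_subgroup G Fa" using subgroup_Fa comm_group_Fa by (simp add: abelian_subgroup_def)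
  moreover have "semidirect_product G Fa ?L"
    using normal_Fa L sd(1,2) by (simp add: semidirect_product_def)
  moreover have "coprime (card ?L) n"
    using coprime_card_if_exponent[OF L, of b n] sd(4) coprime_b_n by blast
  then have "gcd (card Fa) (card ?L) = 1" using sd(3) by (simp add: coprime_iff_gcd_eq_1 gcd.commute)
  moreover have "centre G \<subset> ?L"
    using centre_subset_centralizer[OF x(1)] self_mem_centralizer[OF x(1)] x(3) by blast
  moreover have "m = order (quotient_in G ?L (centre G))"
  proof -
    interpret GL: group "G\<lparr>carrier := ?L\<rparr>" by (rule subgroup_imp_group[OF L])
    have "subgroup (centre G) (G\<lparr>carrier := ?L\<rparr>)"
      using subgroup_incl[OF subgroup_centre L] centre_subset_centralizer[OF x(1)] .
    then have "order (quotient_in G ?L (centre G)) * card (centre G) = card ?L"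
      using GL.lagrange[of "centre G"] by (simp add: order_def quotient_in_def FactGroup_def)
    also have "\<dots> = m * card (centre G)"
      using card_centralizer_csize_n[OF x(1) csize_b_element[OF x]] .
    finally show ?thesis using card_subgroup_pos[OF subgroup_centre] by simp
  qed
  moreover have "[n = 1] (mod m)"
    using m_dvd_n_minus_1[OF x nf] n_gt_1 by (simp add: cong_altdef_nat)
  ultimately show ?thesis
    using cyclic_quotient_complement[OF x nf] frobenius_quotient[OF x nf] sd(3) by metis
qed

end

theorem theorem1:
  fixes G :: "('a, 'b) monoid_scheme" and m n :: nat
  assumes "group G" and "finite (carrier G)"
    and "no_abelian_direct_factors G"
    and "two_largest (noncentral_class_sizes G) m n"
  shows "gcd m n = 1 \<longleftrightarrow>
    class_sizes G = {1, m, n} \<and>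
    (\<exists>K L. semidirect_product G K L \<and>
      abelian_subgroup G K \<and>
      gcd (card K) (card L) = 1 \<and>
      centre G \<subset> L \<and>
      cyclic_group (quotient_in G L (centre G)) \<and>
      frobenius_group_with_kernel (G Mod centre G)
        (carrier (quotient_in G (K <#>\<^bsub>G\<^esub> centre G) (centre G))) \<and>
      m = order (quotient_in G L (centre G)) \<and>
      n = card K \<and>
      [n = 1] (mod m))"
proof
  assume mn: "gcd m n = 1"
  interpret finite_group G
    using assms(1,2) by (simp add: finite_group_def finite_group_axioms_def)
  have "n \<in> class_sizes G" using assms(4) by (simp add: two_largest_def noncentral_class_sizes_def)
  then obtain x where "x \<in> carrier G" "csize x = n" by (auto simp: class_sizes_eq)
  then have n_dvd: "n dvd order G" using card_class by (metis dvd_triv_left)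
  have "order G > 0" using order_gt_0_iff_finite fin by blast
  then obtain a b where ab: "order G = a * b" "coprime b n" "\<forall>k. coprime k n \<longrightarrow> coprime k a"
    using exists_coprime_split by blast
  have cop: "coprime a b" using ab(2,3) coprime_commute by blast
  have "n dvd a" using n_dvd ab(1,2) by (simp add: coprime_commute coprime_dvd_mult_left_iff)
  moreover have "coprime m a" using ab(3) mn by (simp add: coprime_iff_gcd_eq_1)
  \<comment> \<open>The Chinese remainder theorem supplies the exponents that extract the two parts
    of an element.\<close>
  moreover obtain ea where "[ea = 1] (mod a)" "[ea = 0] (mod b)"
    using binary_chinese_remainder_nat[OF cop] by blast
  moreover obtain eb where "[eb = 0] (mod a)" "[eb = 1] (mod b)"
    using binary_chinese_remainder_nat[OF cop] by blast
  ultimately interpret coprime_largest_class_sizes G a b ea eb m n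
    by unfold_locales (use ab(1) cop assms(4) in auto)
  show "class_sizes G = {1, m, n} \<and> (\<exists>K L. semidirect_product G K L \<and>
      abelian_subgroup G K \<and> gcd (card K) (card L) = 1 \<and> centre G \<subset> L \<and>
      cyclic_group (quotient_in G L (centre G)) \<and>
      frobenius_group_with_kernel (G Mod centre G)
        (carrier (quotient_in G (K <#>\<^bsub>G\<^esub> centre G) (centre G))) \<and>
      m = order (quotient_in G L (centre G)) \<and> n = card K \<and> [n = 1] (mod m))"
    using class_sizes_eq_1_m_n frobenius_structure[OF assms(3)] by (rule conjI)
next
  assume "class_sizes G = {1, m, n} \<and> (\<exists>K L. semidirect_product G K L \<and>
      abelian_subgroup G K \<and> gcd (card K) (card L) = 1 \<and> centre G \<subset> L \<and>
      cyclic_group (quotient_in G L (centre G)) \<and>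
      frobenius_group_with_kernel (G Mod centre G)
        (carrier (quotient_in G (K <#>\<^bsub>G\<^esub> centre G) (centre G))) \<and>
      m = order (quotient_in G L (centre G)) \<and> n = card K \<and> [n = 1] (mod m))"
  then have "[n = 1] (mod m)" by blast
  then have "gcd n m = gcd 1 m" by (rule cong_gcd_eq)
  then show "gcd m n = 1" by (simp add: gcd.commute)
qed

end
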